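(* For $p\in[\frac12,1]$ and $\varepsilon\in[0,1)$, let $\mathbb{B}=\mathbb{B}(p,\varepsilon)\subseteq\Omega=\{B,W\}^{\mathbb{N}}$ be the set of bad configurations for the random color record $Y$ of the random walk in random scenery with parameters $(p,\varepsilon)$. Then: (i) There exists a neighborhood of $(1,0)$ in the $(p,\varepsilon)$-plane (relative to the parameter set $[\frac12,1]\times[0,1)$) such that $\mathbb{B}=\varnothing$ for all $(p,\varepsilon)$ in this neighborhood. This neighborhood can be taken to contain the line segment $(p_*,1]\times\{0\}$ with $p_*=1/(1+5^5\,12^{-6})$. (ii) If $p\in(\frac12,\frac45)$ and $\varepsilon=0$, then $\mathbb{B}=\Omega$. (iii) If $p=\frac12$ and $\varepsilon=0$, then $\mathbb{B}\notin\{\varnothing,\Omega\}$.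
   Context: $\mathbb{N}=\{1,2,\ldots\}$, $\mathbb{N}_0=\mathbb{N}\cup\{0\}$. Random walk in random scenery. Let $p\in[\frac12,1]$ and $\varepsilon\in[0,1)$. Let $X=(X_n)_{n\in\mathbb{N}}$ be i.i.d. random variables taking the values $0,+1,-1$ with probability $\varepsilon$, $p(1-\varepsilon)$, $(1-p)(1-\varepsilon)$, respectively. Let $S_0=0$ and $S_n=X_1+\cdots+X_n$ for $n\in\mathbb{N}$. Let $C=(C_z)_{z\in\mathbb{Z}}$ be i.i.d. random variables, independent of $X$, taking the values $B$ (black) and $W$ (white) with probability $\frac12$ each. The random color record is $Y=(Y_n)_{n\in\mathbb{N}_0}$ with $Y_n=C_{S_n}$. $\mathbb{P}$ denotes the joint law of $X$ and $C$. Under $\mathbb{P}$, $Y$ has full support on $\{B,W\}^{\mathbb{N}_0}$. Bad configurations. Let $\Omega=\{B,W\}^{\mathbb{N}}$. A configuration $\eta\in\Omega$ is bad if there is a $\delta>0$ such that for all $m\in\mathbb{N}$ there are $n\in\mathbb{N}$ and $\zeta\in\Omega$, with $n>m$ and $\zeta=\eta$ on $(0,m)\cap\mathbb{N}$, such that $$\bigl|\mathbb{P}(Y_0=B\mid Y=\eta\text{ on }(0,n)\cap\mathbb{N})-\mathbb{P}(Y_0=B\mid Y=\zeta\text{ on }(0,n)\cap\mathbb{N})\bigr|\ge\delta.$$ A configuration that is not bad is called good. $\mathbb{B}$ denotes the set of bad configurations. *)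

theory Defs
  imports "HOL-Probability.Probability"
begin

datatype color = Black | White

text \<open>
  Law of a single step: 0 with probability \<open>e\<close>, otherwise \<open>+1\<close> or \<open>-1\<close> with
  probability \<open>p\<close> resp. \<open>1 - p\<close>; the weights are computed in \<open>pmf_step\<close> below.
\<close>

definition step_pmf :: "real \<Rightarrow> real \<Rightarrow> int pmf" where
  "step_pmf p e =
     bind_pmf (bernoulli_pmf e) (\<lambda>pause.
       if pause then return_pmf 0
       else map_pmf (\<lambda>right. if right then 1 else -1) (bernoulli_pmf p))"

lemma pmf_step:
  assumes "p \<in> {0..1}" "e \<in> {0..1}"
  shows "pmf (step_pmf p e) 0 = e"
    and "pmf (step_pmf p e) 1 = p * (1 - e)"
    and "pmf (step_pmf p e) (-1) = (1 - p) * (1 - e)"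
  using assms
  by (simp_all add: step_pmf_def pmf_bind map_pmf_def)

text \<open>The joint law of the steps \<open>X = (X n)\<close>, \<open>n \<ge> 1\<close>, and the independent scenery \<open>C\<close>.\<close>

definition rwrs :: "real \<Rightarrow> real \<Rightarrow> ((nat \<Rightarrow> int) \<times> (int \<Rightarrow> color)) measure" where
  "rwrs p e =
     (\<Pi>\<^sub>M n\<in>{1..}. measure_pmf (step_pmf p e)) \<Otimes>\<^sub>M
     (\<Pi>\<^sub>M z\<in>UNIV. measure_pmf (pmf_of_set {Black, White}))"

definition walk :: "(nat \<Rightarrow> int) \<Rightarrow> nat \<Rightarrow> int" where
  "walk X n = (\<Sum>k=1..n. X k)"

definition color_record :: "(nat \<Rightarrow> int) \<times> (int \<Rightarrow> color) \<Rightarrow> nat \<Rightarrow> color" where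
  "color_record \<omega> n = snd \<omega> (walk (fst \<omega>) n)"

definition configs :: "(nat \<Rightarrow> color) set" where
  "configs = {1..} \<rightarrow>\<^sub>E UNIV"

definition cond_black :: "real \<Rightarrow> real \<Rightarrow> (nat \<Rightarrow> color) \<Rightarrow> nat \<Rightarrow> real" where
  "cond_black p e \<eta> n =
     \<P>(\<omega> in rwrs p e. color_record \<omega> 0 = Black \<bar> \<forall>k\<in>{0<..<n}. color_record \<omega> k = \<eta> k)"

definition bad_config :: "real \<Rightarrow> real \<Rightarrow> (nat \<Rightarrow> color) \<Rightarrow> bool" where
  "bad_config p e \<eta> \<longleftrightarrow>
     (\<exists>\<delta>>0. \<forall>m\<ge>1. \<exists>n>m. \<exists>\<zeta>\<in>configs.
        (\<forall>k\<in>{0<..<m}. \<zeta> k = \<eta> k) \<and>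
        \<bar>cond_black p e \<eta> n - cond_black p e \<zeta> n\<bar> \<ge> \<delta>)"

definition bad_set :: "real \<Rightarrow> real \<Rightarrow> (nat \<Rightarrow> color) set" where
  "bad_set p e = {\<eta> \<in> configs. bad_config p e \<eta>}"

definition params :: "(real \<times> real) set" where
  "params = {1/2..1} \<times> {0..<1}"

definition p_star :: real where
  "p_star = 1 / (1 + 5 ^ 5 * 12 powi (-6))"

end

theory Submission
  imports Defs
begin

text \<open>
  Given a path of the walk, the record fixes the colours of the visited sites, so each path carries
  the posterior weight of its steps times \<open>2\<close> to the power minus the size of its range.

  (i) Call \<open>t\<close> a cut time if all sites visited before \<open>t\<close> lie below all sites visited from \<open>t\<close> on; the
  weight factorises there. Exchanging prefixes of two independent trajectories at their first common
  cut time shows that two records agreeing before \<open>m\<close> give conditional probabilities differing by at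
  most the probability of having no common cut time before \<open>m\<close>. Without one, a sixth of the steps of one
  trajectory up to some cut time \<open>T \<ge> m\<close> are not to the right, and comparing with a straight prefix
  bounds the probability of this by a geometric series.

  (ii) Where the record differs at times \<open>k - 1\<close> and \<open>k + 1\<close>, the walk cannot turn. Extend the record
  so that turns are possible only at two times, in a zigzag of length \<open>L\<close> on the scenery
  \<open>BBWWBBWW\<dots>\<close>. For \<open>p < 4/5\<close> new sites are expensive enough to force both turns as \<open>L\<close> grows, and for
  \<open>p > 1/2\<close> the first leg goes to the right. In that scenery the earlier path is determined backwards
  down to \<open>S 1\<close>, whose two neighbours have different colours, so \<open>Y 0\<close> is decided by \<open>X 1\<close> and its
  conditional law tends to \<open>p\<close> or to \<open>1 - p\<close>, depending on the orientation of the scenery.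

  (iii) For \<open>p = 1/2\<close> the all-black record has conditional probabilities at least \<open>3/4\<close>, whereas the zigzag
  extensions give \<open>1/2\<close> in the limit. For the record that allows turns exactly at the powers of two, any
  path that turns sees both, differently coloured, neighbours of \<open>S 1\<close>; and a path not turning before
  time \<open>2 ^ K\<close> can be folded at each of the \<open>K\<close> turning times without losing weight, so such paths
  have posterior probability at most \<open>1 / (K + 1)\<close> under every extension.
\<close>

section \<open>Path weights\<close>

definition consistent :: "'i set \<Rightarrow> ('i \<Rightarrow> int) \<Rightarrow> ('i \<Rightarrow> color) \<Rightarrow> bool" where
  "consistent I f \<eta> \<longleftrightarrow> (\<forall>i\<in>I. \<forall>j\<in>I. f i = f j \<longrightarrow> \<eta> i = \<eta> j)"

text \<open>Each distinct site carries one fair coin, so this is the probability that a random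
  scenery shows the colours \<open>\<eta>\<close> along \<open>f\<close>. Repeated visits cost
  nothing but must agree.\<close>

definition site_weight :: "'i set \<Rightarrow> ('i \<Rightarrow> int) \<Rightarrow> ('i \<Rightarrow> color) \<Rightarrow> real" where
  "site_weight I f \<eta> = (if consistent I f \<eta> then (1 / 2) ^ card (f ` I) else 0)"

lemma consistentD: "consistent I f \<eta> \<Longrightarrow> i \<in> I \<Longrightarrow> j \<in> I \<Longrightarrow> f i = f j \<Longrightarrow> \<eta> i = \<eta> j"
  unfolding consistent_def by blast

lemma consistent_subset: "consistent I f \<eta> \<Longrightarrow> J \<subseteq> I \<Longrightarrow> consistent J f \<eta>"
  unfolding consistent_def by blast

lemma site_weight_nonneg [simp]: "0 \<le> site_weight I f \<eta>"
  by (simp add: site_weight_def)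

text \<open>Only the partition of the indices into visits of the same site matters, so any renaming
  of the sites, such as a translation or a reflection, keeps the weight.\<close>

lemma site_weight_cong:
  assumes "\<And>i j. i \<in> I \<Longrightarrow> j \<in> I \<Longrightarrow> f i = f j \<longleftrightarrow> g i = g j" "\<And>i. i \<in> I \<Longrightarrow> \<eta> i = \<zeta> i"
  shows "site_weight I f \<eta> = site_weight I g \<zeta>"
proof -
  define h where "h = (\<lambda>y. g (SOME i. i \<in> I \<and> f i = y))"
  have h: "h (f i) = g i" if "i \<in> I" for i
  proof -
    have "\<exists>j. j \<in> I \<and> f j = f i" using that by blast
    from someI_ex[OF this] show ?thesis
      unfolding h_def using assms(1) that by blast
  qed
  have "inj_on h (f ` I)"
    by (auto simp: inj_on_def h assms(1))
  moreover have "h ` f ` I = g ` I"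
    using h by (auto simp: image_iff)
  ultimately have "card (g ` I) = card (f ` I)"
    using card_image by fastforce
  moreover have "consistent I f \<eta> \<longleftrightarrow> consistent I g \<zeta>"
    unfolding consistent_def by (intro ball_cong refl) (metis assms)
  ultimately show ?thesis
    by (simp add: site_weight_def)
qed

text \<open>Consistency only relates indices at the same site, so pieces of a path with disjoint
  ranges read independent colours.\<close>

lemma site_weight_Un_disjoint:
  assumes "f ` I \<inter> f ` J = {}" "finite I" "finite J"
  shows "site_weight (I \<union> J) f \<eta> = site_weight I f \<eta> * site_weight J f \<eta>"
proof -
  have "card (f ` (I \<union> J)) = card (f ` I) + card (f ` J)"
    using assms by (simp add: image_Un card_Un_disjoint)
  moreover have "consistent (I \<union> J) f \<eta> \<longleftrightarrow> consistent I f \<eta> \<and> consistent J f \<eta>"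
    using assms(1) unfolding consistent_def by blast
  ultimately show ?thesis
    by (simp add: site_weight_def power_add)
qed

lemma site_weight_mono:
  assumes "J \<subseteq> I" "finite I"
  shows "site_weight I f \<eta> \<le> site_weight J f \<eta>"
  using assms consistent_subset[of I f \<eta> J] unfolding site_weight_def
  by (auto intro!: power_decreasing card_mono)

text \<open>A consistent record prescribes one colour per visited site, and the event is a cylinder
  set. For an inconsistent record the event is empty.\<close>

lemma prob_scenery:
  fixes f :: "'i \<Rightarrow> int"
  assumes "finite I"
  shows "measure (\<Pi>\<^sub>M z\<in>UNIV. measure_pmf (pmf_of_set {Black, White}))
           {C. \<forall>i\<in>I. C (f i) = \<eta> i} = site_weight I f \<eta>"
proof (cases "consistent I f \<eta>")
  case True
  interpret product_prob_space "\<lambda>_. measure_pmf (pmf_of_set {Black, White})" "UNIV :: int set"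
    by unfold_locales
  \<comment> \<open>The colour prescribed at a site is read off at an arbitrary visit; consistency
    makes the choice immaterial.\<close>
  define g where "g = (\<lambda>z. \<eta> (SOME i. i \<in> I \<and> f i = z))"
  have g: "g (f i) = \<eta> i" if "i \<in> I" for i
  proof -
    have "\<exists>j. j \<in> I \<and> f j = f i" using that by blast
    from someI_ex[OF this] have *: "(SOME j. j \<in> I \<and> f j = f i) \<in> I" "f (SOME j. j \<in> I \<and> f j = f i) = f i"
      by blast+
    show ?thesis
      unfolding g_def by (rule consistentD[OF True *(1) that *(2)])
  qed
  have eq: "{C. \<forall>i\<in>I. C (f i) = \<eta> i} =
    prod_emb UNIV (\<lambda>_. measure_pmf (pmf_of_set {Black, White})) (f ` I) (Pi\<^sub>E (f ` I) (\<lambda>z. {g z}))"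
    using g by (auto simp: prod_emb_def PiE_def Pi_def)
  have half: "measure (measure_pmf (pmf_of_set {Black, White})) {c} = 1 / 2" for c
    by (cases c) (auto simp: measure_pmf_single)
  have sw: "site_weight I f \<eta> = (1 / 2) ^ card (f ` I)"
    using True by (simp add: site_weight_def)
  show ?thesis
    unfolding eq sw using assms
    by (subst measure_PiM_emb) (simp_all add: half)
next
  case False
  hence "{C. \<forall>i\<in>I. C (f i) = \<eta> i} = {}"
    unfolding consistent_def by (auto; metis)
  thus ?thesis using False by (simp only: site_weight_def if_False measure_empty)
qed

section \<open>The law of the record as a finite sum over step sequences\<close>

definition paths :: "nat set \<Rightarrow> (nat \<Rightarrow> int) set" where
  "paths K = K \<rightarrow>\<^sub>E {-1, 0, 1}"

definition step_weight :: "real \<Rightarrow> real \<Rightarrow> nat set \<Rightarrow> (nat \<Rightarrow> int) \<Rightarrow> real" where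
  "step_weight p e K x = (\<Prod>k\<in>K. pmf (step_pmf p e) (x k))"

lemma finite_paths [simp]: "finite K \<Longrightarrow> finite (paths K)"
  by (auto simp: paths_def intro!: finite_PiE)

lemma step_weight_nonneg [simp]: "0 \<le> step_weight p e K x"
  by (simp add: step_weight_def prod_nonneg)

lemma set_step_pmf: "set_pmf (step_pmf p e) \<subseteq> {-1, 0, 1}"
  by (auto simp: step_pmf_def split: if_splits)

lemma walk_cong: "(\<And>k. 1 \<le> k \<Longrightarrow> k \<le> n \<Longrightarrow> x k = y k) \<Longrightarrow> walk x n = walk y n"
  by (auto simp: walk_def intro!: sum.cong)

text \<open>Splitting by the steps before time \<open>n\<close> gives finitely many disjoint
  rectangles, steps times scenery, that fill the event up to a null set. The time set
  \<open>I\<close> is general: with time 0 it gives the numerator of \<open>cond_black\<close>,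
  without it the denominator.\<close>

lemma prob_color_record:
  assumes "I \<subseteq> {..<n}"
  shows "\<P>(\<omega> in rwrs p e. \<forall>k\<in>I. color_record \<omega> k = \<eta> k) =
    (\<Sum>x\<in>paths {1..<n}. step_weight p e {1..<n} x * site_weight I (walk x) \<eta>)"
proof -
  define M1 where "M1 = (\<Pi>\<^sub>M n\<in>{1::nat..}. measure_pmf (step_pmf p e))"
  define M2 where "M2 = (\<Pi>\<^sub>M z\<in>(UNIV :: int set). measure_pmf (pmf_of_set {Black, White}))"
  interpret P1: product_prob_space "\<lambda>_. measure_pmf (step_pmf p e)" "{1::nat..}"
    by unfold_locales
  interpret P2: product_prob_space "\<lambda>_. measure_pmf (pmf_of_set {Black, White})" "UNIV :: int set"
    by unfold_locales
  interpret M1: prob_space M1 unfolding M1_def by (rule P1.prob_space_axioms)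
  interpret M2: prob_space M2 unfolding M2_def by (rule P2.prob_space_axioms)
  interpret P: pair_prob_space M1 M2 by unfold_locales
  have rw: "rwrs p e = M1 \<Otimes>\<^sub>M M2" by (simp add: rwrs_def M1_def M2_def)
  have finI: "finite I" using assms finite_subset by blast
  have sp2: "space M2 = UNIV" by (auto simp: M2_def space_PiM)
  define U where "U x = {X \<in> space M1. \<forall>k\<in>{1..<n}. X k = x k}" for x
  define V where "V x = {C. \<forall>k\<in>I. C (walk x k) = \<eta> k}" for x
  have Umeas: "U x \<in> sets M1" for x
    unfolding U_def M1_def by measurable
  have V': "V x = {C \<in> space M2. \<forall>k\<in>I. C (walk x k) = \<eta> k}" for x
    by (simp add: V_def sp2)
  have Vmeas: "V x \<in> sets M2" for x
    unfolding V' unfolding M2_def using finI by measurable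
  have mU: "measure M1 (U x) = step_weight p e {1..<n} x" for x
  proof -
    have eq: "U x = prod_emb {1..} (\<lambda>_. measure_pmf (step_pmf p e)) {1..<n} (Pi\<^sub>E {1..<n} (\<lambda>k. {x k}))"
      by (auto simp: U_def M1_def prod_emb_def space_PiM PiE_def Pi_def)
    show ?thesis unfolding eq unfolding M1_def
      by (subst P1.measure_PiM_emb) (auto simp: step_weight_def measure_pmf_single)
  qed
  have mV: "measure M2 (V x) = site_weight I (walk x) \<eta>" for x
    unfolding V_def M2_def by (rule prob_scenery[OF finI])
  define R where "R = (\<Union>x\<in>paths {1..<n}. U x \<times> V x)"
  have Rmeas: "R \<in> sets (M1 \<Otimes>\<^sub>M M2)"
    unfolding R_def using Umeas Vmeas by (intro sets.finite_UN) auto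
  have "measure (M1 \<Otimes>\<^sub>M M2) R = (\<Sum>x\<in>paths {1..<n}. measure (M1 \<Otimes>\<^sub>M M2) (U x \<times> V x))"
    unfolding R_def
  proof (rule P.finite_measure_finite_Union)
    show "disjoint_family_on (\<lambda>x. U x \<times> V x) (paths {1..<n})"
    unfolding disjoint_family_on_def
    proof (intro ballI impI)
      fix x y assume xy: "x \<in> paths {1..<n}" "y \<in> paths {1..<n}" "x \<noteq> y"
      then obtain k where "k \<in> {1..<n}" "x k \<noteq> y k"
        unfolding paths_def by (meson PiE_ext)
      thus "U x \<times> V x \<inter> U y \<times> V y = {}" by (auto simp: U_def)
    qed
  qed (use Umeas Vmeas in auto)
  also have "\<dots> = (\<Sum>x\<in>paths {1..<n}. measure M1 (U x) * measure M2 (V x))"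
    by (intro sum.cong refl)
       (simp add: Sigma_Algebra.measure_def M2.emeasure_pair_measure_Times[OF Umeas Vmeas]
         enn2real_mult)
  also have "\<dots> = (\<Sum>x\<in>paths {1..<n}. step_weight p e {1..<n} x * site_weight I (walk x) \<eta>)"
    by (simp only: mU mV)
  finally have mR: "measure (M1 \<Otimes>\<^sub>M M2) R = \<dots>" .
  have iff: "\<omega> \<in> R \<longleftrightarrow> (\<forall>k\<in>I. color_record \<omega> k = \<eta> k) \<and> (\<forall>k\<in>{1..<n}. fst \<omega> k \<in> {-1, 0, 1})"
    if "\<omega> \<in> space (M1 \<Otimes>\<^sub>M M2)" for \<omega>
  proof -
    obtain X C where \<omega>: "\<omega> = (X, C)" by (cases \<omega>)
    have X: "X \<in> space M1" using that by (simp add: \<omega> space_pair_measure)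
    have w: "walk x k = walk X k" if "\<forall>k\<in>{1..<n}. X k = x k" "k \<in> I" for x k
      using assms that by (intro walk_cong) auto
    show ?thesis
    proof
      assume "\<omega> \<in> R"
      then obtain x where x: "x \<in> paths {1..<n}" "X \<in> U x" "C \<in> V x"
        by (auto simp: R_def \<omega>)
      from x(2) have Xx: "\<forall>k\<in>{1..<n}. X k = x k" by (simp add: U_def)
      have "color_record \<omega> k = \<eta> k" if "k \<in> I" for k
      proof -
        have "C (walk x k) = \<eta> k" using x(3) that by (simp add: V_def)
        thus ?thesis by (simp only: w[OF Xx that] \<omega> color_record_def fst_conv snd_conv)
      qed
      moreover have "fst \<omega> k \<in> {-1, 0, 1}" if "k \<in> {1..<n}" for k
        using x(1) that bspec[OF Xx that] unfolding paths_def \<omega> by (metis PiE_mem fst_conv)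
      ultimately show "(\<forall>k\<in>I. color_record \<omega> k = \<eta> k) \<and> (\<forall>k\<in>{1..<n}. fst \<omega> k \<in> {-1, 0, 1})"
        by blast
    next
      assume *: "(\<forall>k\<in>I. color_record \<omega> k = \<eta> k) \<and> (\<forall>k\<in>{1..<n}. fst \<omega> k \<in> {-1, 0, 1})"
      define x where "x = restrict X {1..<n}"
      have "x \<in> paths {1..<n}" using * by (auto simp: x_def \<omega> paths_def)
      moreover have "X \<in> U x" using X by (auto simp: U_def x_def)
      moreover have "C (walk x k) = \<eta> k" if "k \<in> I" for k
      proof -
        have "walk x k = walk X k" using that by (intro w) (simp_all add: x_def)
        moreover have "color_record \<omega> k = \<eta> k" using * that by blast
        ultimately show ?thesis by (simp only: \<omega> color_record_def fst_conv snd_conv)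
      qed
      hence "C \<in> V x" by (simp add: V_def)
      ultimately show "\<omega> \<in> R" by (auto simp: R_def \<omega>)
    qed
  qed
  \<comment> \<open>\<open>R\<close> differs from the event only where some step lies outside
    \<open>{-1, 0, 1}\<close>, which has probability zero.\<close>
  have AE1: "AE X in M1. \<forall>k\<in>{1..<n}. X k \<in> {-1, 0, 1}"
  proof (subst AE_finite_all[OF finite_atLeastLessThan], intro ballI)
    fix k assume k: "k \<in> {1..<n}"
    have "AE s in measure_pmf (step_pmf p e). s \<in> {-1, 0, 1}"
      using set_step_pmf by (auto simp: AE_measure_pmf_iff)
    thus "AE X in M1. X k \<in> {-1, 0, 1}"
      unfolding M1_def using k
      by (intro AE_PiM_component) (auto simp: measure_pmf.prob_space_axioms)
  qed
  have X: "(\<lambda>\<omega>. fst \<omega> k) \<in> (M1 \<Otimes>\<^sub>M M2) \<rightarrow>\<^sub>M count_space UNIV" if "k \<ge> 1" for k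
  proof -
    have "(\<lambda>\<omega>. fst \<omega> k) \<in> (M1 \<Otimes>\<^sub>M M2) \<rightarrow>\<^sub>M measure_pmf (step_pmf p e)"
      unfolding M1_def using that
      by (intro measurable_compose[OF measurable_fst measurable_component_singleton]) auto
    thus ?thesis by simp
  qed
  have meas3: "{\<omega> \<in> space (M1 \<Otimes>\<^sub>M M2). \<forall>k\<in>{1..<n}. fst \<omega> k \<in> {-1, 0, 1}} \<in> sets (M1 \<Otimes>\<^sub>M M2)"
  proof (intro sets.sets_Collect_finite_All)
    fix k assume "k \<in> {1..<n}"
    hence "(\<lambda>\<omega>. fst \<omega> k) -` {-1, 0, 1} \<inter> space (M1 \<Otimes>\<^sub>M M2) \<in> sets (M1 \<Otimes>\<^sub>M M2)"
      by (intro measurable_sets[OF X]) auto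
    also have "(\<lambda>\<omega>. fst \<omega> k) -` {-1, 0, 1} \<inter> space (M1 \<Otimes>\<^sub>M M2) =
        {\<omega> \<in> space (M1 \<Otimes>\<^sub>M M2). fst \<omega> k \<in> {-1, 0, 1}}" by blast
    finally show "{\<omega> \<in> space (M1 \<Otimes>\<^sub>M M2). fst \<omega> k \<in> {-1, 0, 1}} \<in> sets (M1 \<Otimes>\<^sub>M M2)" .
  qed auto
  have AE2: "AE \<omega> in M1 \<Otimes>\<^sub>M M2. \<forall>k\<in>{1..<n}. fst \<omega> k \<in> {-1, 0, 1}"
    using AE1 by (intro P.AE_pair_measure meas3) auto
  have colmeas: "{\<omega> \<in> space (M1 \<Otimes>\<^sub>M M2). \<forall>k\<in>I. color_record \<omega> k = \<eta> k} \<in> sets (M1 \<Otimes>\<^sub>M M2)"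
  proof -
    have w: "{\<omega> \<in> space (M1 \<Otimes>\<^sub>M M2). walk (fst \<omega>) k = z} \<in> sets (M1 \<Otimes>\<^sub>M M2)" for k z
    proof -
      have "(\<lambda>\<omega>. walk (fst \<omega>) k) \<in> (M1 \<Otimes>\<^sub>M M2) \<rightarrow>\<^sub>M count_space UNIV"
      proof (induction k)
        case (Suc k)
        have [measurable]: "(\<lambda>\<omega>. fst \<omega> (Suc k)) \<in> (M1 \<Otimes>\<^sub>M M2) \<rightarrow>\<^sub>M count_space UNIV"
          by (intro X) auto
        note Suc [measurable]
        have "(\<lambda>\<omega>. walk (fst \<omega>) k + fst \<omega> (Suc k)) \<in> (M1 \<Otimes>\<^sub>M M2) \<rightarrow>\<^sub>M count_space UNIV"
          by measurable
        thus ?case by (simp add: walk_def)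
      qed (simp add: walk_def)
      hence "(\<lambda>\<omega>. walk (fst \<omega>) k) -` {z} \<inter> space (M1 \<Otimes>\<^sub>M M2) \<in> sets (M1 \<Otimes>\<^sub>M M2)"
        by (rule measurable_sets) auto
      also have "(\<lambda>\<omega>. walk (fst \<omega>) k) -` {z} \<inter> space (M1 \<Otimes>\<^sub>M M2) =
          {\<omega> \<in> space (M1 \<Otimes>\<^sub>M M2). walk (fst \<omega>) k = z}" by blast
      finally show ?thesis .
    qed
    have c: "{\<omega> \<in> space (M1 \<Otimes>\<^sub>M M2). snd \<omega> z = b} \<in> sets (M1 \<Otimes>\<^sub>M M2)" for z b
      unfolding M2_def by measurable
    have "{\<omega> \<in> space (M1 \<Otimes>\<^sub>M M2). color_record \<omega> k = \<eta> k} \<in> sets (M1 \<Otimes>\<^sub>M M2)" for k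
    proof -
      have "{\<omega> \<in> space (M1 \<Otimes>\<^sub>M M2). color_record \<omega> k = \<eta> k} =
        (\<Union>z. {\<omega> \<in> space (M1 \<Otimes>\<^sub>M M2). walk (fst \<omega>) k = z} \<inter> {\<omega> \<in> space (M1 \<Otimes>\<^sub>M M2). snd \<omega> z = \<eta> k})"
        by (auto simp: color_record_def)
      also have "\<dots> \<in> sets (M1 \<Otimes>\<^sub>M M2)"
        using w c by (intro sets.countable_UN') auto
      finally show ?thesis .
    qed
    thus ?thesis using finI by (intro sets.sets_Collect_finite_All) auto
  qed
  have "\<P>(\<omega> in rwrs p e. \<forall>k\<in>I. color_record \<omega> k = \<eta> k) = measure (M1 \<Otimes>\<^sub>M M2) R"
    unfolding rw
  proof (rule measure_eq_AE)
    show "AE \<omega> in M1 \<Otimes>\<^sub>M M2.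
        (\<omega> \<in> {\<omega> \<in> space (M1 \<Otimes>\<^sub>M M2). \<forall>k\<in>I. color_record \<omega> k = \<eta> k}) = (\<omega> \<in> R)"
      using AE2 AE_space by eventually_elim (auto simp: iff)
  qed (use colmeas Rmeas in auto)
  thus ?thesis using mR by simp
qed

definition record_weight :: "real \<Rightarrow> real \<Rightarrow> (nat \<Rightarrow> color) \<Rightarrow> nat \<Rightarrow> (nat \<Rightarrow> int) \<Rightarrow> real" where
  "record_weight p e \<eta> n x = step_weight p e {1..<n} x * site_weight {1..<n} (walk x) \<eta>"

text \<open>Overwriting the record at time 0 turns \<open>Y 0 = Black\<close> into one more observed
  colour.\<close>

definition black_weight :: "real \<Rightarrow> real \<Rightarrow> (nat \<Rightarrow> color) \<Rightarrow> nat \<Rightarrow> (nat \<Rightarrow> int) \<Rightarrow> real" where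
  "black_weight p e \<eta> n x =
     step_weight p e {1..<n} x * site_weight {..<n} (walk x) (\<eta>(0 := Black))"

definition partition_sum :: "real \<Rightarrow> real \<Rightarrow> (nat \<Rightarrow> color) \<Rightarrow> nat \<Rightarrow> real" where
  "partition_sum p e \<eta> n = (\<Sum>x\<in>paths {1..<n}. record_weight p e \<eta> n x)"

lemma record_weight_nonneg [simp]: "0 \<le> record_weight p e \<eta> n x"
  by (simp add: record_weight_def)

lemma black_weight_nonneg [simp]: "0 \<le> black_weight p e \<eta> n x"
  by (simp add: black_weight_def)

lemma black_weight_le: "black_weight p e \<eta> n x \<le> record_weight p e \<eta> n x"
proof -
  have "site_weight {..<n} (walk x) (\<eta>(0 := Black)) \<le> site_weight {1..<n} (walk x) (\<eta>(0 := Black))"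
    by (intro site_weight_mono) auto
  also have "\<dots> = site_weight {1..<n} (walk x) \<eta>"
    by (intro site_weight_cong) auto
  finally show ?thesis
    by (simp add: black_weight_def record_weight_def mult_left_mono)
qed

lemma cond_black_eq:
  assumes "n \<ge> 1"
  shows "cond_black p e \<eta> n =
    (\<Sum>x\<in>paths {1..<n}. black_weight p e \<eta> n x) / partition_sum p e \<eta> n"
proof -
  have 1: "(color_record \<omega> 0 = Black \<and> (\<forall>k\<in>{0<..<n}. color_record \<omega> k = \<eta> k)) \<longleftrightarrow>
      (\<forall>k\<in>{..<n}. color_record \<omega> k = (\<eta>(0 := Black)) k)" for \<omega>
    using assms by (auto simp: less_Suc_eq_0_disj)
  have 2: "{0<..<n} = {1..<n}" by auto
  show ?thesis
    unfolding cond_black_def cond_prob_def 1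
    by (subst prob_color_record[of _ n], simp, subst prob_color_record[of _ n])
       (auto simp: 2 black_weight_def record_weight_def partition_sum_def)
qed

lemma pmf_step_weights:
  assumes "p \<in> {0..1}" "e \<in> {0..1}"
  shows "pmf (step_pmf p e) (-1) + pmf (step_pmf p e) 0 + pmf (step_pmf p e) 1 = 1"
  using assms by (simp add: pmf_step algebra_simps)

lemma sum_step_pmf:
  assumes "p \<in> {0..1}" "e \<in> {0..1}"
  shows "(\<Sum>s\<in>{-1, 0, 1}. pmf (step_pmf p e) s) = 1"
  using pmf_step_weights[OF assms] by simp

lemma sum_step_weight:
  assumes "p \<in> {0..1}" "e \<in> {0..1}" "finite K"
  shows "(\<Sum>x\<in>paths K. step_weight p e K x) = 1"
proof -
  have "(\<Sum>x\<in>paths K. step_weight p e K x) = (\<Prod>k\<in>K. \<Sum>s\<in>{-1, 0, 1}. pmf (step_pmf p e) s)"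
    unfolding paths_def step_weight_def using assms(3) by (intro prod_sum_PiE[symmetric]) auto
  thus ?thesis by (simp only: sum_step_pmf[OF assms(1,2)] prod.neutral_const)
qed

lemma sum_paths_Un:
  assumes "A \<inter> B = {}"
  shows "(\<Sum>x\<in>paths (A \<union> B). f x) =
    (\<Sum>y\<in>paths A. \<Sum>z\<in>paths B. f (\<lambda>k. if k \<in> A then y k else z k))"
proof -
  have "(\<Sum>x\<in>paths (A \<union> B). f x) =
    (\<Sum>(y, z)\<in>paths A \<times> paths B. f (\<lambda>k. if k \<in> A then y k else z k))"
  proof (rule sum.reindex_bij_witness[where
        i = "\<lambda>(y, z) k. if k \<in> A then y k else z k" and j = "\<lambda>x. (restrict x A, restrict x B)"])
    fix x assume x: "x \<in> paths (A \<union> B)"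
    show *: "(case (restrict x A, restrict x B) of (y, z) \<Rightarrow> \<lambda>k. if k \<in> A then y k else z k) = x"
      using x by (auto simp: paths_def fun_eq_iff PiE_def extensional_def restrict_def)
    show "(restrict x A, restrict x B) \<in> paths A \<times> paths B"
      using x by (auto simp: paths_def PiE_iff)
    show "(case (restrict x A, restrict x B) of (y, z) \<Rightarrow> f (\<lambda>k. if k \<in> A then y k else z k)) = f x"
      using * by simp
  next
    fix b assume "b \<in> paths A \<times> paths B"
    then obtain y z where b: "b = (y, z)" "y \<in> paths A" "z \<in> paths B" by blast
    show "(restrict (case b of (y, z) \<Rightarrow> \<lambda>k. if k \<in> A then y k else z k) A,
        restrict (case b of (y, z) \<Rightarrow> \<lambda>k. if k \<in> A then y k else z k) B) = b"
      using b assms by (fastforce simp: paths_def fun_eq_iff PiE_def extensional_def restrict_def)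
    show "(case b of (y, z) \<Rightarrow> \<lambda>k. if k \<in> A then y k else z k) \<in> paths (A \<union> B)"
      using b by (auto simp: paths_def PiE_iff extensional_def)
  qed
  thus ?thesis by (simp add: sum.cartesian_product)
qed

lemma walk_split:
  assumes "t \<le> s"
  shows "walk x s = walk x t + (\<Sum>k\<in>{t<..s}. x k)"
proof -
  have "{1..s} = {1..t} \<union> {t<..s}" using assms by auto
  thus ?thesis
    unfolding walk_def by (simp add: sum.union_disjoint ivl_disj_int)
qed

lemma walk_0 [simp]: "walk x 0 = 0"
  by (simp add: walk_def)

lemma walk_Suc: "walk x (Suc n) = walk x n + x (Suc n)"
  by (simp add: walk_def)

lemma paths_mem: "x \<in> paths K \<Longrightarrow> k \<in> K \<Longrightarrow> x k = -1 \<or> x k = 0 \<or> x k = 1"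
  by (auto simp: paths_def PiE_iff)

section \<open>Cut times\<close>

text \<open>Time 0 counts among the earlier times, so that weights including \<open>Y 0\<close>
  factorise as well. The end \<open>t = n\<close> is always a cut time.\<close>

definition cut :: "nat \<Rightarrow> (nat \<Rightarrow> int) \<Rightarrow> nat \<Rightarrow> bool" where
  "cut n x t \<longleftrightarrow> (\<forall>s<t. \<forall>s'\<in>{t..<n}. walk x s < walk x s')"

definition splice :: "nat \<Rightarrow> (nat \<Rightarrow> int) \<Rightarrow> (nat \<Rightarrow> int) \<Rightarrow> nat \<Rightarrow> int" where
  "splice t y x = (\<lambda>k. if k \<le> t then y k else x k)"

lemma splice_splice [simp]:
  "splice t (splice t y x) z = splice t y z" "splice t y (splice t z x) = splice t y x"
  "splice t x x = x"
  by (auto simp: splice_def fun_eq_iff)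

lemma splice_paths: "x \<in> paths {1..<n} \<Longrightarrow> y \<in> paths {1..<n} \<Longrightarrow> splice t y x \<in> paths {1..<n}"
  by (auto simp: splice_def paths_def PiE_iff extensional_def)

lemma walk_splice_le: "s \<le> t \<Longrightarrow> walk (splice t y x) s = walk y s"
  by (intro walk_cong) (auto simp: splice_def)

lemma walk_splice_ge:
  assumes "t \<le> s"
  shows "walk (splice t y x) s = walk y t + (walk x s - walk x t)"
proof -
  have "(\<Sum>k\<in>{t<..s}. splice t y x k) = (\<Sum>k\<in>{t<..s}. x k)"
    by (intro sum.cong) (auto simp: splice_def)
  thus ?thesis
    using walk_split[OF assms, of "splice t y x"] walk_split[OF assms, of x]
    by (simp add: walk_splice_le)
qed

text \<open>The later sites lie strictly above \<open>walk x (t - 1)\<close>, and step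
  \<open>t\<close> climbs at most 1.\<close>

lemma cut_walk_ge:
  assumes "x \<in> paths {1..<n}" "cut n x t" "1 \<le> t" "t \<le> s" "s < n"
  shows "walk x t \<le> walk x s"
proof -
  have "t \<in> {1..<n}" using assms by auto
  hence "x t \<le> 1" using paths_mem[OF assms(1)] by fastforce
  moreover have "walk x t = walk x (t - 1) + x t"
    using walk_Suc[of x "t - 1"] assms(3) by simp
  moreover have "walk x (t - 1) < walk x s"
    using assms by (auto simp: cut_def)
  ultimately show ?thesis by simp
qed

text \<open>Both suffixes stay at or above the site reached at time \<open>t\<close>, and everything
  earlier lies strictly below it. Changing the suffix therefore keeps the cut times up to
  \<open>t\<close>, so the first common cut time survives an exchange of prefixes.\<close>

lemma cut_splice:
  assumes x: "x \<in> paths {1..<n}" "cut n x t" and y: "y \<in> paths {1..<n}" "cut n y t"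
    and t: "1 \<le> t" "t < n" and "s \<le> t"
  shows "cut n (splice t y x) s \<longleftrightarrow> cut n y s"
proof -
  have "walk (splice t y x) a < walk (splice t y x) b \<longleftrightarrow> walk y a < walk y b"
    if "a < s" "s \<le> b" "b < n" for a b
  proof (cases "b \<le> t")
    case True
    thus ?thesis using that assms by (simp add: walk_splice_le)
  next
    case False
    have a: "a < t" using that assms by simp
    have "walk y a < walk y t" using y t a by (auto simp: cut_def)
    moreover have "walk x t \<le> walk x b" using cut_walk_ge[OF x t(1)] False that by simp
    moreover have "walk y a < walk y b" using y False that a by (auto simp: cut_def)
    ultimately show ?thesis using False a by (simp add: walk_splice_le walk_splice_ge)
  qed
  thus ?thesis by (auto simp: cut_def)
qed

lemma cut_image_disjoint: "cut n x t \<Longrightarrow> walk x ` {a..<t} \<inter> walk x ` {t..<n} = {}"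
  by (fastforce simp: cut_def)

lemma step_weight_Un:
  "A \<inter> B = {} \<Longrightarrow> finite A \<Longrightarrow> finite B \<Longrightarrow>
   step_weight p e (A \<union> B) x = step_weight p e A x * step_weight p e B x"
  by (simp add: step_weight_def prod.union_disjoint)

lemma step_weight_cong: "(\<And>k. k \<in> A \<Longrightarrow> x k = y k) \<Longrightarrow> step_weight p e A x = step_weight p e A y"
  by (simp add: step_weight_def)

text \<open>Step \<open>t\<close> is counted in the prefix, but the site at time \<open>t\<close> in
  the suffix: the site weight of the suffix depends on its sites only up to translation.\<close>

lemma record_weight_cut:
  assumes "cut n x t" "1 \<le> t" "t < n"
  shows "record_weight p e \<eta> n x =
    step_weight p e {1..t} x * step_weight p e {t<..<n} x *
    (site_weight {1..<t} (walk x) \<eta> * site_weight {t..<n} (walk x) \<eta>)"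
proof -
  have a: "{1..<n} = {1..t} \<union> {t<..<n}" and b: "{1..<n} = {1..<t} \<union> {t..<n}"
    using assms by auto
  have "site_weight {1..<n} (walk x) \<eta> = site_weight {1..<t} (walk x) \<eta> * site_weight {t..<n} (walk x) \<eta>"
    unfolding b by (rule site_weight_Un_disjoint[OF cut_image_disjoint[OF assms(1)]]) auto
  moreover have "step_weight p e {1..<n} x = step_weight p e {1..t} x * step_weight p e {t<..<n} x"
    unfolding a by (rule step_weight_Un) auto
  ultimately show ?thesis by (simp add: record_weight_def)
qed

lemma black_weight_cut:
  assumes "cut n x t" "1 \<le> t" "t < n"
  shows "black_weight p e \<eta> n x =
    step_weight p e {1..t} x * step_weight p e {t<..<n} x *
    (site_weight {..<t} (walk x) (\<eta>(0 := Black)) * site_weight {t..<n} (walk x) \<eta>)"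
proof -
  have a: "{1..<n} = {1..t} \<union> {t<..<n}" and b: "{..<n} = {0..<t} \<union> {t..<n}"
    using assms by auto
  have "site_weight {..<n} (walk x) (\<eta>(0 := Black)) =
      site_weight {0..<t} (walk x) (\<eta>(0 := Black)) * site_weight {t..<n} (walk x) (\<eta>(0 := Black))"
    unfolding b by (rule site_weight_Un_disjoint[OF cut_image_disjoint[OF assms(1)]]) auto
  moreover have "site_weight {t..<n} (walk x) (\<eta>(0 := Black)) = site_weight {t..<n} (walk x) \<eta>"
    using assms by (intro site_weight_cong) auto
  moreover have "step_weight p e {1..<n} x = step_weight p e {1..t} x * step_weight p e {t<..<n} x"
    unfolding a by (rule step_weight_Un) auto
  ultimately show ?thesis by (simp add: black_weight_def lessThan_atLeast0)
qed

text \<open>Prefix factors see only colours before \<open>t\<close>, where the two records agree,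
  and each suffix keeps its own record. Exchanging the prefixes therefore moves the requirement
  \<open>Y 0 = Black\<close> from one record to the other.\<close>

lemma swap_weights:
  assumes x: "x \<in> paths {1..<n}" "cut n x t" and y: "y \<in> paths {1..<n}" "cut n y t"
    and t: "1 \<le> t" "t < n" and agree: "\<And>k. 1 \<le> k \<Longrightarrow> k < t \<Longrightarrow> \<zeta> k = \<eta> k"
  shows "black_weight p e \<eta> n x * record_weight p e \<zeta> n y =
    black_weight p e \<zeta> n (splice t x y) * record_weight p e \<eta> n (splice t y x)"
proof -
  have c: "cut n (splice t x y) t" "cut n (splice t y x) t"
    using cut_splice[of y n t x t] cut_splice[of x n t y t] assms by auto
  have sw: "step_weight p e {1..t} (splice t a b) = step_weight p e {1..t} a"
    "step_weight p e {t<..<n} (splice t a b) = step_weight p e {t<..<n} b" for a b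
    by (auto intro!: step_weight_cong simp: splice_def)
  have pre: "site_weight {..<t} (walk (splice t a b)) \<xi> = site_weight {..<t} (walk a) \<xi>"
    "site_weight {1..<t} (walk (splice t a b)) \<xi> = site_weight {1..<t} (walk a) \<xi>" for a b \<xi>
    by (auto intro!: site_weight_cong simp: walk_splice_le)
  have post: "site_weight {t..<n} (walk (splice t a b)) \<xi> = site_weight {t..<n} (walk b) \<xi>" for a b \<xi>
    by (auto intro!: site_weight_cong simp: walk_splice_ge)
  have ag: "site_weight {..<t} (walk x) (\<zeta>(0 := Black)) = site_weight {..<t} (walk x) (\<eta>(0 := Black))"
    "site_weight {1..<t} (walk y) \<zeta> = site_weight {1..<t} (walk y) \<eta>"
    using agree by (auto intro!: site_weight_cong)
  show ?thesis
    by (simp only: black_weight_cut[OF x(2) t] record_weight_cut[OF y(2) t]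
      black_weight_cut[OF c(1) t] record_weight_cut[OF c(2) t] sw pre post ag mult_ac)
qed

section \<open>Exchange of prefixes at the first common cut time\<close>

definition common_cut :: "nat \<Rightarrow> nat \<Rightarrow> (nat \<Rightarrow> int) \<Rightarrow> (nat \<Rightarrow> int) \<Rightarrow> nat \<Rightarrow> bool" where
  "common_cut n m x y t \<longleftrightarrow> t \<in> {1..<m} \<and> cut n x t \<and> cut n y t"

text \<open>Exchanging prefixes at the first common cut time is an involution of \<open>G\<close>,
  and \<open>swap_weights\<close> matches the summands.\<close>

lemma common_cut_sum_swap:
  assumes "m \<le> n" and agree: "\<And>k. 1 \<le> k \<Longrightarrow> k < m \<Longrightarrow> \<zeta> k = \<eta> k"
  defines "G \<equiv> {(x, y). x \<in> paths {1..<n} \<and> y \<in> paths {1..<n} \<and> (\<exists>t. common_cut n m x y t)}"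
  shows "(\<Sum>(x, y)\<in>G. black_weight p e \<eta> n x * record_weight p e \<zeta> n y) =
    (\<Sum>(x, y)\<in>G. black_weight p e \<zeta> n y * record_weight p e \<eta> n x)"
proof -
  define T where "T = (\<lambda>x y. LEAST t. common_cut n m x y t)"
  define f where "f = (\<lambda>(x, y). (splice (T x y) y x, splice (T x y) x y))"
  have *: "f (x, y) \<in> G \<and> f (f (x, y)) = (x, y) \<and>
    black_weight p e \<eta> n x * record_weight p e \<zeta> n y =
    (case f (x, y) of (x', y') \<Rightarrow> black_weight p e \<zeta> n y' * record_weight p e \<eta> n x')"
    if "(x, y) \<in> G" for x y
  proof -
    define t where "t = T x y"
    have x: "x \<in> paths {1..<n}" and y: "y \<in> paths {1..<n}" and ex: "\<exists>t. common_cut n m x y t"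
      using that by (auto simp: G_def)
    have cc: "common_cut n m x y t"
      unfolding t_def T_def using LeastI_ex[OF ex] .
    hence t: "1 \<le> t" "t < n" "t < m" and cx: "cut n x t" and cy: "cut n y t"
      using assms(1) by (auto simp: common_cut_def)
    have same: "common_cut n m (splice t y x) (splice t x y) s \<longleftrightarrow> common_cut n m x y s" if "s \<le> t" for s
      using cut_splice[OF x cx y cy t(1,2) that] cut_splice[OF y cy x cx t(1,2) that]
      by (auto simp: common_cut_def)
    have "T (splice t y x) (splice t x y) = t"
      unfolding T_def
    proof (rule Least_equality)
      show "common_cut n m (splice t y x) (splice t x y) t" using same cc by simp
      fix s assume s: "common_cut n m (splice t y x) (splice t x y) s"
      show "t \<le> s"
      proof (rule ccontr)
        assume "\<not> t \<le> s"
        hence "common_cut n m x y s" using same[of s] s by simp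
        thus False using \<open>\<not> t \<le> s\<close> unfolding t_def T_def by (simp add: Least_le)
      qed
    qed
    moreover have "(splice t y x, splice t x y) \<in> G"
      using same[of t] cc splice_paths x y by (auto simp: G_def)
    moreover have "black_weight p e \<eta> n x * record_weight p e \<zeta> n y =
      black_weight p e \<zeta> n (splice t x y) * record_weight p e \<eta> n (splice t y x)"
      using agree t by (intro swap_weights[OF x cx y cy]) auto
    ultimately show ?thesis by (simp add: f_def t_def[symmetric])
  qed
  show ?thesis
    by (rule sum.reindex_bij_witness[of _ f f]) (use * in \<open>fastforce+\<close>)
qed

lemma abs_le_weights:
  fixes a b c d :: real
  assumes "0 \<le> a" "a \<le> b" "0 \<le> c" "c \<le> d"
  shows "\<bar>a * d - c * b\<bar> \<le> b * d"
proof -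
  have "a * d \<le> b * d" "c * b \<le> b * d" "0 \<le> a * d" "0 \<le> c * b"
    using assms by (auto intro!: mult_right_mono mult_left_mono simp: mult.commute[of c])
  thus ?thesis by linarith
qed

text \<open>Exchanging the prefixes of two independent trajectories up to their first common cut time
  cancels all pairs that have a common cut time before \<open>m\<close>.\<close>

lemma cond_black_diff_le:
  assumes m: "1 \<le> m" "m \<le> n" and agree: "\<And>k. 1 \<le> k \<Longrightarrow> k < m \<Longrightarrow> \<zeta> k = \<eta> k"
    and pos: "0 < partition_sum p e \<eta> n" "0 < partition_sum p e \<zeta> n"
  defines "B \<equiv> {x \<in> paths {1..<n}. m - 1 \<le> 2 * card {t \<in> {1..<m}. \<not> cut n x t}}"
  shows "\<bar>cond_black p e \<eta> n - cond_black p e \<zeta> n\<bar> \<le>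
    (\<Sum>x\<in>B. record_weight p e \<eta> n x) / partition_sum p e \<eta> n +
    (\<Sum>x\<in>B. record_weight p e \<zeta> n x) / partition_sum p e \<zeta> n"
proof -
  define P where "P = paths {1..<n}"
  define G where "G = {(x, y). x \<in> P \<and> y \<in> P \<and> (\<exists>t. common_cut n m x y t)}"
  define H where "H = {(x, y). x \<in> P \<and> y \<in> P \<and> \<not> (\<exists>t. common_cut n m x y t)}"
  define b r where "b = black_weight p e" and "r = record_weight p e"
  define Zx Zy where "Zx = partition_sum p e \<eta> n" and "Zy = partition_sum p e \<zeta> n"
  define Nx Ny where "Nx = (\<Sum>x\<in>P. b \<eta> n x)" and "Ny = (\<Sum>x\<in>P. b \<zeta> n x)"
  have finP: "finite P" by (simp add: P_def)
  have PP: "P \<times> P = G \<union> H" "G \<inter> H = {}" by (auto simp: G_def H_def)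
  have fin: "finite G" "finite H"
    using finP PP(1) by (metis finite_Un finite_SigmaI)+
  have bb: "0 \<le> b \<xi> n x" "b \<xi> n x \<le> r \<xi> n x" "0 \<le> r \<xi> n x" for \<xi> x
    by (auto simp: b_def r_def black_weight_le)
  have Z: "Zx = (\<Sum>x\<in>P. r \<eta> n x)" "Zy = (\<Sum>x\<in>P. r \<zeta> n x)"
    by (auto simp: Zx_def Zy_def partition_sum_def r_def P_def)
  \<comment> \<open>Cross-multiplying the difference of the two fractions yields sums over pairs of
    independent trajectories, one for each record.\<close>
  have "Nx * Zy - Ny * Zx = (\<Sum>(x, y)\<in>P \<times> P. b \<eta> n x * r \<zeta> n y) - (\<Sum>(x, y)\<in>P \<times> P. b \<zeta> n y * r \<eta> n x)"
  proof -
    have "Nx * Zy = (\<Sum>(x, y)\<in>P \<times> P. b \<eta> n x * r \<zeta> n y)"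
      unfolding Nx_def Z sum_product sum.cartesian_product ..
    moreover have "Zx * Ny = (\<Sum>(x, y)\<in>P \<times> P. b \<zeta> n y * r \<eta> n x)"
      unfolding Ny_def Z sum_product sum.cartesian_product by (simp add: mult.commute)
    ultimately show ?thesis by (simp add: mult.commute)
  qed
  also have "\<dots> = (\<Sum>(x, y)\<in>H. b \<eta> n x * r \<zeta> n y) - (\<Sum>(x, y)\<in>H. b \<zeta> n y * r \<eta> n x)"
    using common_cut_sum_swap[OF m(2) agree, where p = p and e = e] PP fin
    by (simp add: sum.union_disjoint G_def P_def b_def r_def)
  also have "\<dots> = (\<Sum>(x, y)\<in>H. b \<eta> n x * r \<zeta> n y - b \<zeta> n y * r \<eta> n x)"
    by (simp add: sum_subtractf case_prod_unfold)
  finally have "\<bar>Nx * Zy - Ny * Zx\<bar> \<le> (\<Sum>(x, y)\<in>H. r \<eta> n x * r \<zeta> n y)"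
    using bb by (auto intro!: order_trans[OF sum_abs] sum_mono abs_le_weights simp: case_prod_unfold)
  also have "\<dots> \<le> (\<Sum>(x, y)\<in>B \<times> P \<union> P \<times> B. r \<eta> n x * r \<zeta> n y)"
  proof (rule sum_mono2)
    \<comment> \<open>Without a common cut time, each of the \<open>m - 1\<close> times is a non-cut
      time of one of the two paths, so one path has at least half of them.\<close>
    show "H \<subseteq> B \<times> P \<union> P \<times> B"
    proof (clarify)
      fix x y assume h: "(x, y) \<in> H" "\<not> (x \<in> P \<and> y \<in> B)"
      hence xy: "x \<in> P" "y \<in> P" by (auto simp: H_def)
      have "x \<in> B"
      proof (rule ccontr)
        assume "x \<notin> B"
        hence "2 * card {t \<in> {1..<m}. \<not> cut n x t} < m - 1" "2 * card {t \<in> {1..<m}. \<not> cut n y t} < m - 1"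
          using h xy by (auto simp: B_def P_def)
        moreover have "card {1..<m} \<le> card ({t \<in> {1..<m}. \<not> cut n x t} \<union> {t \<in> {1..<m}. \<not> cut n y t})"
          using h(1) by (intro card_mono) (auto simp: H_def common_cut_def)
        moreover have "\<dots> \<le> card {t \<in> {1..<m}. \<not> cut n x t} + card {t \<in> {1..<m}. \<not> cut n y t}"
          by (rule card_Un_le)
        ultimately show False by simp
      qed
      thus "x \<in> B \<and> y \<in> P" using xy by simp
    qed
    show "finite (B \<times> P \<union> P \<times> B)" using finP by (simp add: B_def)
  qed (use bb in auto)
  also have "\<dots> \<le> (\<Sum>(x, y)\<in>B \<times> P. r \<eta> n x * r \<zeta> n y) + (\<Sum>(x, y)\<in>P \<times> B. r \<eta> n x * r \<zeta> n y)"
    using finP bb by (subst sum_Un) (auto simp: B_def intro!: sum_nonneg)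
  also have "\<dots> = (\<Sum>x\<in>B. r \<eta> n x) * Zy + Zx * (\<Sum>x\<in>B. r \<zeta> n x)"
    by (simp add: Z sum_product sum.cartesian_product)
  finally have main: "\<bar>Nx * Zy - Ny * Zx\<bar> \<le> (\<Sum>x\<in>B. r \<eta> n x) * Zy + Zx * (\<Sum>x\<in>B. r \<zeta> n x)" .
  have zpos: "Zx > 0" "Zy > 0" using pos by (auto simp: Zx_def Zy_def)
  have "cond_black p e \<eta> n - cond_black p e \<zeta> n = (Nx * Zy - Ny * Zx) / (Zx * Zy)"
    using zpos m by (subst (1 2) cond_black_eq)
      (auto simp: Nx_def Ny_def b_def P_def Zx_def[symmetric] Zy_def[symmetric] field_simps)
  also have "\<bar>\<dots>\<bar> \<le> ((\<Sum>x\<in>B. r \<eta> n x) * Zy + Zx * (\<Sum>x\<in>B. r \<zeta> n x)) / (Zx * Zy)"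
    using main zpos by (simp add: abs_divide divide_right_mono)
  also have "\<dots> = (\<Sum>x\<in>B. r \<eta> n x) / Zx + (\<Sum>x\<in>B. r \<zeta> n x) / Zy"
    using zpos by (simp add: field_simps)
  finally show ?thesis by (simp add: r_def Zx_def Zy_def)
qed

section \<open>Counting the times that are not cut times\<close>

lemma card_records_ge:
  fixes S :: "nat \<Rightarrow> int"
  assumes "\<And>i. i < N \<Longrightarrow> S (Suc i) \<le> S i + 1" "s \<le> N"
  shows "S s - S 0 \<le> int (card {t \<in> {1..N}. \<forall>s<t. S s < S t})"
  using assms
proof (induction N arbitrary: s)
  case (Suc N)
  let ?R = "\<lambda>N. {t \<in> {1..N}. \<forall>s<t. S s < S t}"
  have IH: "S s - S 0 \<le> int (card (?R N))" if "s \<le> N" for s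
    using that Suc by auto
  have mono: "card (?R N) \<le> card (?R (Suc N))"
    by (intro card_mono) auto
  show ?case
  proof (cases "s \<le> N")
    case True
    thus ?thesis using IH[of s] mono by linarith
  next
    case False
    hence s: "s = Suc N" using Suc.prems by simp
    show ?thesis
    \<comment> \<open>A step climbs at most 1, so a record raises the maximum by at most 1. At a
      non-record some earlier height is at least as large, and the induction hypothesis applies to
      it.\<close>
    proof (cases "\<forall>s<Suc N. S s < S (Suc N)")
      case True
      hence "?R (Suc N) = insert (Suc N) (?R N)" by (auto simp: le_Suc_eq)
      hence "card (?R (Suc N)) = Suc (card (?R N))" by simp
      thus ?thesis using IH[of N] Suc.prems(1)[of N] s by simp
    next
      case False
      then obtain a where "a \<le> N" "S (Suc N) \<le> S a" by (auto simp: not_less less_Suc_eq_le)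
      thus ?thesis using IH[of a] mono unfolding s by linarith
    qed
  qed
qed simp

text \<open>Every non-right step is neither a record nor a time-reversed record, hence is counted twice in
  the union bound; this improves the constant from 4 to 3.\<close>

lemma card_not_cut_le:
  assumes x: "x \<in> paths {1..<n}" and "T \<le> n" "1 \<le> T"
  shows "card {t \<in> {1..<T}. \<not> cut T x t} \<le> 3 * card {k \<in> {1..<T}. x k \<noteq> 1}"
proof -
  define N where "N = T - 1"
  have T: "T = Suc N" "{1..<T} = {1..N}" using assms by (auto simp: N_def)
  have step: "walk x (Suc i) \<le> walk x i + 1" if "i < N" for i
  proof -
    have "Suc i \<in> {1..<n}" using that assms by (auto simp: N_def)
    from paths_mem[OF x this] show ?thesis by (auto simp: walk_Suc)
  qed
  define A where "A = {t \<in> {1..N}. \<not> (\<forall>s<t. walk x s < walk x t)}"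
  define B where "B = {t \<in> {1..N}. \<not> (\<forall>s\<in>{t..N}. walk x (t - 1) < walk x s)}"
  define R where "R = {k \<in> {1..N}. x k \<noteq> 1}"
  have sub: "A \<subseteq> {1..N}" "B \<subseteq> {1..N}" by (auto simp: A_def B_def)
  have A: "walk x N \<le> int N - int (card A)"
  proof -
    have "walk x N \<le> int (card {t \<in> {1..N}. \<forall>s<t. walk x s < walk x t})"
      using card_records_ge[of N "walk x" N] step by simp
    also have "{t \<in> {1..N}. \<forall>s<t. walk x s < walk x t} = {1..N} - A" by (auto simp: A_def)
    also have "int (card ({1..N} - A)) = int N - int (card A)"
      using card_mono[of "{1..N}" A] sub finite_subset[of A "{1..N}"]
      by (simp add: card_Diff_subset of_nat_diff)
    finally show ?thesis .
  qed
  have B: "walk x N \<le> int N - int (card B)"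
  proof -
    \<comment> \<open>Reversing time and flipping the sign again gives steps that climb at most 1,
      and turns a site below all later ones into a record.\<close>
    define S where "S = (\<lambda>i. - walk x (N - i))"
    have "S (Suc i) \<le> S i + 1" if "i < N" for i
      using step[of "N - Suc i"] that by (simp add: S_def Suc_diff_Suc)
    from card_records_ge[of N S N, OF this]
    have "walk x N \<le> int (card {t \<in> {1..N}. \<forall>s<t. S s < S t})"
      by (simp add: S_def)
    also have "card {t \<in> {1..N}. \<forall>s<t. S s < S t} = card ({1..N} - B)"
    \<comment> \<open>A record of \<open>S\<close> at \<open>t\<close> says that the site at time
      \<open>N - t\<close> is below all later ones. This is the condition whose failure defines
      \<open>B\<close>, at the time \<open>N - t + 1\<close>; hence the reflection about
      \<open>Suc N\<close>.\<close>
    proof (rule bij_betw_same_card[where f = "\<lambda>i. Suc N - i"], rule bij_betw_byWitness[where f' = "\<lambda>i. Suc N - i"])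
      have *: "(\<forall>s<t. S s < S t) \<longleftrightarrow> (\<forall>s\<in>{Suc N - t..N}. walk x (Suc N - t - 1) < walk x s)"
        if "t \<in> {1..N}" for t
      proof
        assume l: "\<forall>s<t. S s < S t"
        show "\<forall>s\<in>{Suc N - t..N}. walk x (Suc N - t - 1) < walk x s"
        proof
          fix s assume "s \<in> {Suc N - t..N}"
          hence "N - s < t" "N - (N - s) = s" using that by auto
          thus "walk x (Suc N - t - 1) < walk x s" using l by (auto simp: S_def)
        qed
      next
        assume r: "\<forall>s\<in>{Suc N - t..N}. walk x (Suc N - t - 1) < walk x s"
        show "\<forall>s<t. S s < S t"
        proof (intro allI impI)
          fix s assume "s < t"
          hence "N - s \<in> {Suc N - t..N}" using that by auto
          thus "S s < S t" using r by (auto simp: S_def)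
        qed
      qed
      have B': "{1..N} - B = {t \<in> {1..N}. \<forall>s\<in>{t..N}. walk x (t - 1) < walk x s}"
        by (auto simp: B_def)
      show "(\<lambda>i. Suc N - i) ` {t \<in> {1..N}. \<forall>s<t. S s < S t} \<subseteq> {1..N} - B"
        unfolding B' using * by auto
      show "(\<lambda>i. Suc N - i) ` ({1..N} - B) \<subseteq> {t \<in> {1..N}. \<forall>s<t. S s < S t}"
      proof (rule image_subsetI)
        fix i assume "i \<in> {1..N} - B"
        thus "Suc N - i \<in> {t \<in> {1..N}. \<forall>s<t. S s < S t}"
          unfolding B' using *[of "Suc N - i"] by auto
      qed
    qed auto
    also have "int (card ({1..N} - B)) = int N - int (card B)"
      using card_mono[of "{1..N}" B] sub finite_subset[of B "{1..N}"]
      by (simp add: card_Diff_subset of_nat_diff)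
    finally show ?thesis .
  qed
  \<comment> \<open>Each step that is not to the right loses at most 2 against the straight
    walk.\<close>
  have C: "int N - 2 * int (card R) \<le> walk x N"
  proof -
    have "int N - 2 * int (card R) = (\<Sum>k\<in>{1..N}. 1 - 2 * (if x k \<noteq> 1 then 1 else 0))"
      by (simp add: sum_subtractf R_def sum.If_cases Int_def flip: sum_distrib_left)
    also have "\<dots> \<le> (\<Sum>k\<in>{1..N}. x k)"
    proof (rule sum_mono)
      fix k assume k: "k \<in> {1..N}"
      hence "k \<in> {1..<n}" using assms by (auto simp: N_def)
      from paths_mem[OF x this] show "1 - 2 * (if x k \<noteq> 1 then 1 else 0) \<le> x k"
        by auto
    qed
    finally show ?thesis by (simp add: walk_def)
  qed
  have "R \<subseteq> A \<inter> B"
  proof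
    fix k assume "k \<in> R"
    hence k: "k \<in> {1..N}" "x k \<noteq> 1" by (auto simp: R_def)
    hence "k \<in> {1..<n}" using assms by (auto simp: N_def)
    from paths_mem[OF x this] have "walk x k \<le> walk x (k - 1)"
      using k walk_Suc[of x "k - 1"] by auto
    moreover have "k - 1 < k" using k by auto
    ultimately show "k \<in> A \<inter> B" using k by (fastforce simp: A_def B_def not_less)
  qed
  hence RAB: "card R \<le> card (A \<inter> B)" by (intro card_mono) (auto simp: A_def)
  \<comment> \<open>A record whose predecessor lies below all later sites is a cut time, because the
    step between them climbs at most 1.\<close>
  have "{t \<in> {1..<T}. \<not> cut T x t} \<subseteq> A \<union> B"
  proof
    fix t assume t: "t \<in> {t \<in> {1..<T}. \<not> cut T x t}"
    show "t \<in> A \<union> B"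
    proof (rule ccontr)
      assume n: "t \<notin> A \<union> B"
      have tN: "t \<in> {1..N}" using t T by auto
      have rec: "\<forall>s<t. walk x s < walk x t" and fut: "\<forall>s\<in>{t..N}. walk x (t - 1) < walk x s"
        using n tN by (auto simp: A_def B_def)
      have "walk x t \<le> walk x (t - 1) + 1" using step[of "t - 1"] tN by auto
      hence "cut T x t"
        unfolding cut_def
      proof (intro allI impI ballI)
        fix s s' assume "s < t" "s' \<in> {t..<T}"
        hence "walk x s < walk x t" "walk x (t - 1) < walk x s'" using rec fut T(1) by auto
        thus "walk x s < walk x s'" using \<open>walk x t \<le> walk x (t - 1) + 1\<close> by linarith
      qed
      thus False using t by simp
    qed
  qed
  hence "card {t \<in> {1..<T}. \<not> cut T x t} \<le> card (A \<union> B)"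
    by (intro card_mono) (auto simp: A_def B_def)
  moreover have "card (A \<union> B) + card (A \<inter> B) = card A + card B"
    using card_Un_Int[of A B] by (simp add: A_def B_def)
  \<comment> \<open>\<open>A\<close> and \<open>B\<close> have at most \<open>2 * card R\<close>
    elements each and share at least \<open>card R\<close>, which gives 4 - 1 = 3.\<close>
  ultimately have "card {t \<in> {1..<T}. \<not> cut T x t} \<le> 3 * card R" using A B C RAB by linarith
  thus ?thesis unfolding R_def T(2) .
qed

text \<open>A time from \<open>T\<close> on is handled by the cut at \<open>T\<close>, an earlier
  one by the cut within the prefix.\<close>

lemma cut_from_prefix:
  assumes "cut n x T" "cut T x t" "t < T"
  shows "cut n x t"
  unfolding cut_def
proof (intro allI impI ballI)
  fix s s' assume "s < t" "s' \<in> {t..<n}"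
  thus "walk x s < walk x s'"
    using assms by (cases "s' < T") (auto simp: cut_def)
qed

text \<open>Let \<open>T\<close> be the first cut time from \<open>m\<close> on; \<open>n\<close> is
  a candidate. All times in \<open>{m..<T}\<close> are non-cut times, and together with those before
  \<open>m\<close> they make up at least half of the \<open>T - 1\<close> times. The factor 6 is
  this 2 times the 3 of \<open>card_not_cut_le\<close>.\<close>

lemma bad_path_prefix:
  assumes x: "x \<in> paths {1..<n}" and m: "1 \<le> m" "m \<le> n"
    and bad: "m - 1 \<le> 2 * card {t \<in> {1..<m}. \<not> cut n x t}"
  shows "\<exists>T\<in>{m..n}. cut n x T \<and> T - 1 \<le> 6 * card {k \<in> {1..<T}. x k \<noteq> 1}"
proof -
  define T where "T = (LEAST T. m \<le> T \<and> cut n x T)"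
  have ex: "m \<le> n \<and> cut n x n" using m by (simp add: cut_def)
  have T: "m \<le> T" "cut n x T" "T \<le> n"
    using LeastI[of "\<lambda>T. m \<le> T \<and> cut n x T", OF ex] Least_le[of "\<lambda>T. m \<le> T \<and> cut n x T", OF ex]
    by (auto simp: T_def)
  have gap: "\<not> cut n x t" if "m \<le> t" "t < T" for t
    using that not_less_Least[of t "\<lambda>T. m \<le> T \<and> cut n x T"] by (auto simp: T_def)
  have "{t \<in> {1..<m}. \<not> cut n x t} \<union> {m..<T} \<subseteq> {t \<in> {1..<T}. \<not> cut T x t}"
    (is "?L \<subseteq> ?R")
  proof
    fix t assume t: "t \<in> ?L"
    hence "t \<in> {1..<T}" "\<not> cut n x t" using T m gap by auto
    thus "t \<in> ?R" using cut_from_prefix[OF T(2), of t] by auto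
  qed
  hence "card ({t \<in> {1..<m}. \<not> cut n x t} \<union> {m..<T}) \<le> card {t \<in> {1..<T}. \<not> cut T x t}"
    by (intro card_mono) auto
  moreover have "card ({t \<in> {1..<m}. \<not> cut n x t} \<union> {m..<T}) =
      card {t \<in> {1..<m}. \<not> cut n x t} + (T - m)"
    by (subst card_Un_disjoint) auto
  moreover have "card {t \<in> {1..<T}. \<not> cut T x t} \<le> 3 * card {k \<in> {1..<T}. x k \<noteq> 1}"
    using T m by (intro card_not_cut_le[OF x]) auto
  ultimately have "T - 1 \<le> 6 * card {k \<in> {1..<T}. x k \<noteq> 1}" using bad T(1) m by linarith
  thus ?thesis using T by auto
qed

section \<open>Geometric bound for the weight of paths with few cut times\<close>

lemma site_weight_shift:
  assumes "\<And>i. i \<in> I \<Longrightarrow> g i = f i + c"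
  shows "site_weight I g \<eta> = site_weight I f \<eta>"
  using assms by (intro site_weight_cong) auto

text \<open>This is the generating function of the number of non-right steps, a product because the
  steps are independent.\<close>

lemma sum_prod_step_weight:
  fixes a :: real
  assumes "p \<in> {0..1}" "e \<in> {0..1}" "finite K"
  defines "r \<equiv> pmf (step_pmf p e) 1"
  shows "(\<Sum>y\<in>paths K. step_weight p e K y * a ^ card {k \<in> K. y k \<noteq> 1}) = (r + a * (1 - r)) ^ card K"
proof -
  have "step_weight p e K y * a ^ card {k \<in> K. y k \<noteq> 1} =
      (\<Prod>k\<in>K. pmf (step_pmf p e) (y k) * (if y k \<noteq> 1 then a else 1))" for y
    using assms(3) by (simp add: step_weight_def prod.distrib prod.If_cases Int_def)
  hence "(\<Sum>y\<in>paths K. step_weight p e K y * a ^ card {k \<in> K. y k \<noteq> 1}) =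
      (\<Sum>y\<in>paths K. \<Prod>k\<in>K. pmf (step_pmf p e) (y k) * (if y k \<noteq> 1 then a else 1))"
    by simp
  also have "\<dots> = (\<Prod>k\<in>K. \<Sum>s\<in>{-1, 0, 1}. pmf (step_pmf p e) s * (if s \<noteq> 1 then a else 1))"
    unfolding paths_def using assms(3) by (subst prod_sum_PiE) auto
  also have "(\<Sum>s\<in>{-1, 0, 1::int}. pmf (step_pmf p e) s * (if s \<noteq> 1 then a else 1)) =
      (pmf (step_pmf p e) (-1) + pmf (step_pmf p e) 0) * a + r"
    by (simp add: r_def algebra_simps)
  also have "pmf (step_pmf p e) (-1) + pmf (step_pmf p e) 0 = 1 - r"
    using pmf_step_weights[OF assms(1,2)] by (simp add: r_def)
  finally show ?thesis by (simp add: algebra_simps)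
qed

definition suffix_walk :: "nat \<Rightarrow> (nat \<Rightarrow> int) \<Rightarrow> nat \<Rightarrow> int" where
  "suffix_walk T z s = (\<Sum>k\<in>{T..s}. z k)"

lemma walk_merge:
  assumes "T - 1 \<le> s" "1 \<le> T"
  shows "walk (\<lambda>k. if k \<in> {1..<T} then y k else z k) s = suffix_walk T z s + walk y (T - 1)"
proof -
  let ?u = "\<lambda>k. if k \<in> {1..<T} then y k else z k"
  have "walk ?u s = walk ?u (T - 1) + (\<Sum>k\<in>{T - 1<..s}. ?u k)"
    by (rule walk_split[OF assms(1)])
  moreover have "walk ?u (T - 1) = walk y (T - 1)" by (intro walk_cong) auto
  moreover have "(\<Sum>k\<in>{T - 1<..s}. ?u k) = (\<Sum>k\<in>{T..s}. z k)"
    using assms by (intro sum.cong) auto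
  ultimately show ?thesis by (simp add: suffix_walk_def)
qed

text \<open>An exponential Markov bound with parameter \<open>\<mu>\<close> controls the step weight
  of the bad prefixes, whose site weight is bounded by 1. Putting a straight prefix of weight
  \<open>(r / 2) ^ (T - 1)\<close> before the same suffixes bounds the partition sum from below; the
  quotient gives the base of the power.\<close>

lemma bad_prefix_weight:
  assumes pe: "p \<in> {0..1}" "e \<in> {0..1}" and T: "1 \<le> T" "T \<le> n" and \<mu>: "1 \<le> \<mu>"
  defines "r \<equiv> pmf (step_pmf p e) 1"
  assumes r: "0 < r"
  shows "(\<Sum>x | x \<in> paths {1..<n} \<and> cut n x T \<and> T - 1 \<le> 6 * card {k \<in> {1..<T}. x k \<noteq> 1}.
      record_weight p e \<eta> n x) \<le>
    (2 * (1 + \<mu> ^ 6 * ((1 - r) / r)) / \<mu>) ^ (T - 1) * partition_sum p e \<eta> n"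
proof -
  define A B where "A = {1..<T}" and "B = {T..<n}"
  have AB: "A \<inter> B = {}" "{1..<n} = A \<union> B" "finite A" "finite B"
    using T by (auto simp: A_def B_def)
  define u where "u = (\<lambda>(y :: nat \<Rightarrow> int) z k. if k \<in> A then y k else z k)"
  define E where "E = (\<lambda>x. cut n x T \<and> T - 1 \<le> 6 * card {k \<in> {1..<T}. x k \<noteq> 1})"
  \<comment> \<open>A condition on the suffix alone: it follows from a cut at \<open>T\<close> after
    any prefix, and it keeps the suffix off the sites of a straight prefix.\<close>
  define stay where "stay = (\<lambda>z. \<forall>s\<in>B. 1 \<le> suffix_walk T z s)"
  define W where "W = (\<lambda>z. if stay z then step_weight p e B z * site_weight B (suffix_walk T z) \<eta> else 0)"
  \<comment> \<open>The factor \<open>\<mu> ^ (6 * R) / \<mu> ^ (T - 1)\<close>, with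
    \<open>R\<close> the number of non-right steps of the prefix, is at least 1 on the event
    \<open>E\<close>.\<close>
  define L where "L = (\<lambda>y. step_weight p e A y * (\<mu> ^ 6) ^ card {k \<in> A. y k \<noteq> 1} / \<mu> ^ (T - 1))"
  have W0: "0 \<le> W z" for z by (simp add: W_def)
  have walkB: "walk (u y z) s = suffix_walk T z s + walk y (T - 1)" if "T - 1 \<le> s" for y z s
    using walk_merge[OF that T(1), of y z] by (simp add: u_def A_def)
  have suff: "suffix_walk T z (T - 1) = 0" for z using T by (simp add: suffix_walk_def)
  have sw: "step_weight p e {1..<n} (u y z) = step_weight p e A y * step_weight p e B z" for y z
  proof -
    have "step_weight p e {1..<n} (u y z) = step_weight p e A (u y z) * step_weight p e B (u y z)"
      unfolding AB(2) by (rule step_weight_Un[OF AB(1,3,4)])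
    moreover have "step_weight p e A (u y z) = step_weight p e A y"
      by (rule step_weight_cong) (simp add: u_def)
    moreover have "step_weight p e B (u y z) = step_weight p e B z"
      using AB(1) by (intro step_weight_cong) (auto simp: u_def)
    ultimately show ?thesis by simp
  qed
  have siteB: "site_weight B (walk (u y z)) \<eta> = site_weight B (suffix_walk T z) \<eta>" for y z
    by (rule site_weight_shift[where c = "walk y (T - 1)"]) (auto simp: walkB B_def)
  have upper: "(if E (u y z) then record_weight p e \<eta> n (u y z) else 0) \<le> L y * W z" for y z
  proof (cases "E (u y z)")
    case True
    have "stay z"
      unfolding stay_def
    proof
      fix s assume s: "s \<in> B"
      have "T - 1 < T" using T by simp
      hence "walk (u y z) (T - 1) < walk (u y z) s"
        using True s by (auto simp: E_def cut_def B_def)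
      thus "1 \<le> suffix_walk T z s"
        using s walkB[of "T - 1" y z] walkB[of s y z] suff[of z] by (auto simp: B_def)
    qed
    have "card {k \<in> A. u y z k \<noteq> 1} = card {k \<in> A. y k \<noteq> 1}"
      by (rule arg_cong[where f = card]) (auto simp: u_def)
    hence "\<mu> ^ (T - 1) \<le> \<mu> ^ (6 * card {k \<in> A. y k \<noteq> 1})"
      using True \<mu> by (intro power_increasing) (auto simp: E_def A_def)
    hence "1 \<le> (\<mu> ^ 6) ^ card {k \<in> A. y k \<noteq> 1} / \<mu> ^ (T - 1)"
      using \<mu> by (simp add: power_mult)
    hence "step_weight p e A y * 1 \<le> step_weight p e A y * ((\<mu> ^ 6) ^ card {k \<in> A. y k \<noteq> 1} / \<mu> ^ (T - 1))"
      by (rule mult_left_mono) simp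
    hence 1: "step_weight p e A y \<le> L y" by (simp add: L_def)
    \<comment> \<open>The colours read along the prefix are dropped.\<close>
    have "site_weight {1..<n} (walk (u y z)) \<eta> \<le> site_weight B (walk (u y z)) \<eta>"
      using T by (intro site_weight_mono) (auto simp: B_def)
    hence "record_weight p e \<eta> n (u y z) \<le> step_weight p e A y * (step_weight p e B z * site_weight B (suffix_walk T z) \<eta>)"
      unfolding record_weight_def sw siteB mult.assoc by (intro mult_left_mono) auto
    also have "\<dots> \<le> L y * W z"
      using 1 \<open>stay z\<close> by (simp add: W_def mult_right_mono)
    finally show ?thesis using True by simp
  next
    case False
    thus ?thesis using W0 \<mu> by (simp add: L_def)
  qed
  have "(\<Sum>x | x \<in> paths {1..<n} \<and> E x. record_weight p e \<eta> n x) =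
      (\<Sum>x\<in>paths (A \<union> B). if E x then record_weight p e \<eta> n x else 0)"
    using AB by (simp add: sum.If_cases Int_def)
  also have "\<dots> = (\<Sum>y\<in>paths A. \<Sum>z\<in>paths B. if E (u y z) then record_weight p e \<eta> n (u y z) else 0)"
    unfolding u_def by (rule sum_paths_Un[OF AB(1)])
  also have "\<dots> \<le> (\<Sum>y\<in>paths A. \<Sum>z\<in>paths B. L y * W z)"
    by (intro sum_mono upper)
  also have "\<dots> = (\<Sum>y\<in>paths A. L y) * (\<Sum>z\<in>paths B. W z)"
    by (simp add: sum_product)
  also have "(\<Sum>y\<in>paths A. L y) = (r + \<mu> ^ 6 * (1 - r)) ^ (T - 1) / \<mu> ^ (T - 1)"
    using sum_prod_step_weight[OF pe AB(3), of "\<mu> ^ 6"]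
    by (simp add: L_def A_def r_def flip: sum_divide_distrib)
  finally have up: "(\<Sum>x | x \<in> paths {1..<n} \<and> E x. record_weight p e \<eta> n x) \<le>
      (r + \<mu> ^ 6 * (1 - r)) ^ (T - 1) / \<mu> ^ (T - 1) * (\<Sum>z\<in>paths B. W z)" .
  define y1 where "y1 = restrict (\<lambda>_. 1 :: int) A"
  have y1: "y1 \<in> paths A" by (auto simp: y1_def paths_def)
  \<comment> \<open>A straight prefix visits \<open>T - 1\<close> distinct sites below the suffix,
    so it fits every record.\<close>
  have lower: "(r / 2) ^ (T - 1) * W z \<le> record_weight p e \<eta> n (u y1 z)" for z
  proof (cases "stay z")
    case True
    have wA: "walk (u y1 z) s = int s" if "s < T" for s
    proof -
      have "walk (u y1 z) s = (\<Sum>k = 1..s. 1)"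
        unfolding walk_def using that by (intro sum.cong) (auto simp: u_def y1_def A_def)
      thus ?thesis by simp
    qed
    have wB: "int (T - 1) < walk (u y1 z) s" if "s \<in> B" for s
    proof -
      have "walk y1 (T - 1) = walk (u y1 z) (T - 1)"
        using walkB[of "T - 1" y1 z] suff[of z] by simp
      moreover have "1 \<le> suffix_walk T z s" using True that unfolding stay_def by blast
      ultimately show ?thesis using that wA[of "T - 1"] T by (auto simp: walkB B_def)
    qed
    have "walk (u y1 z) ` A \<inter> walk (u y1 z) ` B = {}"
    proof -
      have "walk (u y1 z) a \<noteq> walk (u y1 z) b" if "a \<in> A" "b \<in> B" for a b
        using wA[of a] wB[of b] that by (auto simp: A_def)
      thus ?thesis by blast
    qed
    hence "site_weight {1..<n} (walk (u y1 z)) \<eta> =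
        site_weight A (walk (u y1 z)) \<eta> * site_weight B (walk (u y1 z)) \<eta>"
      unfolding AB(2) using AB by (intro site_weight_Un_disjoint)
    also have "site_weight A (walk (u y1 z)) \<eta> = (1 / 2) ^ (T - 1)"
    proof -
      have "site_weight A (walk (u y1 z)) \<eta> = site_weight A int \<eta>"
        by (intro site_weight_cong) (auto simp: wA A_def)
      also have "\<dots> = (1 / 2) ^ (T - 1)"
        by (auto simp: site_weight_def consistent_def card_image A_def)
      finally show ?thesis .
    qed
    finally have "record_weight p e \<eta> n (u y1 z) =
        step_weight p e A y1 * (1 / 2) ^ (T - 1) * W z"
      using True unfolding record_weight_def sw siteB W_def by simp
    also have "step_weight p e A y1 = r ^ (T - 1)"
      by (simp add: step_weight_def y1_def r_def A_def)
    finally show ?thesis by (simp add: power_divide power_one_over)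
  qed (simp add: W_def)
  have "(r / 2) ^ (T - 1) * (\<Sum>z\<in>paths B. W z) \<le> (\<Sum>z\<in>paths B. record_weight p e \<eta> n (u y1 z))"
    unfolding sum_distrib_left by (intro sum_mono lower)
  also have "\<dots> \<le> (\<Sum>y\<in>paths A. \<Sum>z\<in>paths B. record_weight p e \<eta> n (u y z))"
    using y1 AB(3) by (intro member_le_sum) (auto intro!: sum_nonneg)
  also have "\<dots> = partition_sum p e \<eta> n"
    unfolding partition_sum_def AB(2) u_def by (rule sum_paths_Un[OF AB(1), symmetric])
  finally have low: "(\<Sum>z\<in>paths B. W z) \<le> (2 / r) ^ (T - 1) * partition_sum p e \<eta> n"
    using r by (simp add: power_divide field_simps)
  have "0 \<le> r + \<mu> ^ 6 * (1 - r)"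
    using r \<mu> pmf_le_1[of "step_pmf p e" 1] by (auto simp: r_def)
  hence "(r + \<mu> ^ 6 * (1 - r)) ^ (T - 1) / \<mu> ^ (T - 1) * (\<Sum>z\<in>paths B. W z) \<le>
      (r + \<mu> ^ 6 * (1 - r)) ^ (T - 1) / \<mu> ^ (T - 1) * ((2 / r) ^ (T - 1) * partition_sum p e \<eta> n)"
    using \<mu> by (intro mult_left_mono low) auto
  also have "\<dots> = ((r + \<mu> ^ 6 * (1 - r)) / \<mu> * (2 / r)) ^ (T - 1) * partition_sum p e \<eta> n"
    by (simp only: power_mult_distrib power_divide mult.assoc)
  also have "(r + \<mu> ^ 6 * (1 - r)) / \<mu> * (2 / r) = 2 * (1 + \<mu> ^ 6 * ((1 - r) / r)) / \<mu>"
    using r \<mu> by (simp add: field_simps)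
  finally show ?thesis using up by (simp add: E_def)
qed

text \<open>The straight path to the right sees no site twice and is consistent with every
  record.\<close>

lemma partition_sum_pos:
  assumes "0 < pmf (step_pmf p e) 1"
  shows "0 < partition_sum p e \<eta> n"
proof -
  define x where "x = restrict (\<lambda>_. 1 :: int) {1..<n}"
  have "x \<in> paths {1..<n}" by (auto simp: x_def paths_def)
  moreover have "0 < record_weight p e \<eta> n x"
  proof -
    have w: "walk x s = int s" if "s < n" for s
    proof -
      have "walk x s = (\<Sum>k = 1..s. 1)"
        unfolding walk_def using that by (intro sum.cong) (auto simp: x_def)
      thus ?thesis by simp
    qed
    have "site_weight {1..<n} (walk x) \<eta> = site_weight {1..<n} int \<eta>"
      by (intro site_weight_cong) (auto simp: w)
    also have "\<dots> > 0" by (auto simp: site_weight_def consistent_def)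
    finally show ?thesis
      using assms by (simp add: record_weight_def step_weight_def x_def)
  qed
  ultimately show ?thesis
    unfolding partition_sum_def by (intro sum_pos2) auto
qed

lemma sum_UN_le:
  fixes f :: "'a \<Rightarrow> real"
  assumes "finite I" "\<And>i. i \<in> I \<Longrightarrow> finite (A i)" "\<And>x. 0 \<le> f x"
  shows "sum f (\<Union>i\<in>I. A i) \<le> (\<Sum>i\<in>I. sum f (A i))"
  using assms
proof (induction I rule: finite_induct)
  case (insert i I)
  have "sum f (A i \<union> (\<Union>i\<in>I. A i)) \<le> sum f (A i) + sum f (\<Union>i\<in>I. A i)"
    using insert by (subst sum_Un) (auto intro!: sum_nonneg)
  thus ?case using insert by force
qed simp

text \<open>Union bound over the cut time \<open>T\<close> supplied by
  \<open>bad_path_prefix\<close>; the resulting geometric series starts at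
  \<open>T = m\<close>.\<close>

lemma bad_paths_weight:
  assumes pe: "p \<in> {0..1}" "e \<in> {0..1}" and m: "1 \<le> m" "m \<le> n" and \<mu>: "1 \<le> \<mu>"
  defines "r \<equiv> pmf (step_pmf p e) 1"
  assumes r: "0 < r"
  defines "\<theta> \<equiv> 2 * (1 + \<mu> ^ 6 * ((1 - r) / r)) / \<mu>"
  assumes \<theta>: "\<theta> < 1"
  shows "(\<Sum>x | x \<in> paths {1..<n} \<and> m - 1 \<le> 2 * card {t \<in> {1..<m}. \<not> cut n x t}.
      record_weight p e \<eta> n x) / partition_sum p e \<eta> n \<le> \<theta> ^ (m - 1) / (1 - \<theta>)"
proof -
  define Q where "Q = (\<lambda>T. {x \<in> paths {1..<n}. cut n x T \<and> T - 1 \<le> 6 * card {k \<in> {1..<T}. x k \<noteq> 1}})"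
  define Z where "Z = partition_sum p e \<eta> n"
  have Z: "0 < Z" unfolding Z_def using r by (intro partition_sum_pos) (simp add: r_def)
  have \<theta>0: "0 \<le> \<theta>"
    using r \<mu> pmf_le_1[of "step_pmf p e" 1] by (simp add: \<theta>_def r_def)
  have "(\<Sum>x | x \<in> paths {1..<n} \<and> m - 1 \<le> 2 * card {t \<in> {1..<m}. \<not> cut n x t}. record_weight p e \<eta> n x)
      \<le> (\<Sum>x\<in>(\<Union>T\<in>{m..n}. Q T). record_weight p e \<eta> n x)"
    using bad_path_prefix[OF _ m] by (intro sum_mono2) (auto simp: Q_def)
  also have "\<dots> \<le> (\<Sum>T\<in>{m..n}. \<Sum>x\<in>Q T. record_weight p e \<eta> n x)"
    by (rule sum_UN_le) (auto simp: Q_def)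
  also have "\<dots> \<le> (\<Sum>T\<in>{m..n}. \<theta> ^ (T - 1) * Z)"
    using m r unfolding Q_def Z_def \<theta>_def r_def
    by (intro sum_mono bad_prefix_weight[OF pe _ _ \<mu>]) auto
  also have "\<dots> = (\<Sum>T\<in>{m..n}. \<theta> ^ (T - 1)) * Z"
    by (simp add: sum_distrib_right)
  also have "(\<Sum>T\<in>{m..n}. \<theta> ^ (T - 1)) = (\<Sum>i<Suc n - m. \<theta> ^ (m - 1) * \<theta> ^ i)"
    using m by (intro sum.reindex_bij_witness[where i = "\<lambda>i. i + m" and j = "\<lambda>T. T - m"])
      (auto simp flip: power_add)
  also have "\<dots> = \<theta> ^ (m - 1) * ((1 - \<theta> ^ (Suc n - m)) / (1 - \<theta>))"
    using \<theta> by (simp add: sum_gp_strict flip: sum_distrib_left)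
  also have "\<dots> * Z \<le> \<theta> ^ (m - 1) * (1 / (1 - \<theta>)) * Z"
    using \<theta> \<theta>0 Z by (intro mult_right_mono mult_left_mono divide_right_mono) auto
  finally show ?thesis using Z by (simp add: Z_def[symmetric] field_simps)
qed

text \<open>The constant \<open>p_star\<close> is where \<open>2 (1 + \<mu>^6 (1 - r) / r) / \<mu> = 1\<close> at the
  optimal \<open>\<mu> = 12/5\<close>.\<close>

lemma not_bad_config_near_1:
  assumes pe: "p \<in> {0..1}" "e \<in> {0..1}" and ps: "p_star < p * (1 - e)"
  shows "\<not> bad_config p e \<eta>"
proof
  assume bad: "bad_config p e \<eta>"
  define r where "r = pmf (step_pmf p e) 1"
  have r: "r = p * (1 - e)" unfolding r_def by (rule pmf_step(2)[OF pe])
  have ps': "p_star = 1 / (1 + 5 ^ 5 / 12 ^ 6)"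
    by (simp add: p_star_def power_int_minus)
  have rpos: "0 < r" using ps r by (simp add: ps')
  define \<theta> where "\<theta> = 2 * (1 + (12 / 5) ^ 6 * ((1 - r) / r)) / (12 / 5)"
  have "(1 - r) / r < 5 ^ 5 / 12 ^ 6"
    using ps r rpos by (simp add: ps' field_simps)
  moreover have "2 * (1 + (12 / 5) ^ 6 * x) / (12 / 5) < 1" if "x < 5 ^ 5 / 12 ^ 6" for x :: real
    using that by (simp add: field_simps)
  ultimately have \<theta>: "\<theta> < 1" unfolding \<theta>_def by blast
  have \<theta>0: "0 \<le> \<theta>"
    using rpos pmf_le_1[of "step_pmf p e" 1] by (simp add: \<theta>_def r_def)
  from bad obtain \<delta> where \<delta>: "\<delta> > 0" "\<And>m. m \<ge> 1 \<Longrightarrow> \<exists>n>m. \<exists>\<zeta>\<in>configs.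
      (\<forall>k\<in>{0<..<m}. \<zeta> k = \<eta> k) \<and> \<bar>cond_black p e \<eta> n - cond_black p e \<zeta> n\<bar> \<ge> \<delta>"
    unfolding bad_config_def by blast
  have "(\<lambda>k. 2 * (\<theta> ^ k / (1 - \<theta>))) \<longlonglongrightarrow> 2 * (0 / (1 - \<theta>))"
    using \<theta> \<theta>0 by (intro tendsto_intros LIMSEQ_power_zero) auto
  hence "\<forall>\<^sub>F k in sequentially. 2 * (\<theta> ^ k / (1 - \<theta>)) < \<delta>"
    using \<delta>(1) by (intro order_tendstoD) auto
  then obtain k where k: "2 * (\<theta> ^ k / (1 - \<theta>)) < \<delta>"
    by (auto simp: eventually_sequentially)
  obtain n \<zeta> where n: "n > Suc k" and \<zeta>: "\<forall>j\<in>{0<..<Suc k}. \<zeta> j = \<eta> j"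
    "\<bar>cond_black p e \<eta> n - cond_black p e \<zeta> n\<bar> \<ge> \<delta>"
    using \<delta>(2)[of "Suc k"] by auto
  have b: "(\<Sum>x | x \<in> paths {1..<n} \<and> Suc k - 1 \<le> 2 * card {t \<in> {1..<Suc k}. \<not> cut n x t}.
      record_weight p e \<xi> n x) / partition_sum p e \<xi> n \<le> \<theta> ^ (Suc k - 1) / (1 - \<theta>)" for \<xi>
    unfolding \<theta>_def r_def using n rpos \<theta>
    by (intro bad_paths_weight[OF pe]) (auto simp: r_def \<theta>_def)
  have "\<bar>cond_black p e \<eta> n - cond_black p e \<zeta> n\<bar> \<le>
      \<theta> ^ (Suc k - 1) / (1 - \<theta>) + \<theta> ^ (Suc k - 1) / (1 - \<theta>)"
    using n \<zeta>(1) rpos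
    by (intro order_trans[OF cond_black_diff_le[of "Suc k" n \<zeta> \<eta> p e] add_mono[OF b b]])
       (auto intro!: partition_sum_pos simp: r_def)
  thus False using k \<zeta>(2) by simp
qed

text \<open>The probability \<open>p * (1 - e)\<close> of a step to the right depends continuously
  on the parameters, so exceeding \<open>p_star\<close> is a relatively open condition.\<close>

lemma good_neighborhood:
  "\<exists>N. openin (top_of_set params) N \<and> (1, 0) \<in> N \<and> {p_star<..1} \<times> {0} \<subseteq> N \<and>
     (\<forall>(p, e)\<in>N. bad_set p e = {})"
proof (intro exI conjI)
  define U :: "(real \<times> real) set" where "U = {x. p_star < fst x * (1 - snd x)}"
  have "open U" unfolding U_def by (intro open_Collect_less continuous_intros)
  thus "openin (top_of_set params) (params \<inter> U)" by (rule openin_open_Int)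
  have ps: "p_star < 1" "1 / 2 < p_star" by (simp_all add: p_star_def power_int_minus)
  show "(1, 0) \<in> params \<inter> U" using ps by (simp add: params_def U_def)
  show "{p_star<..1} \<times> {0} \<subseteq> params \<inter> U"
    using ps by (auto simp: params_def U_def)
  show "\<forall>(p, e)\<in>params \<inter> U. bad_set p e = {}"
    using not_bad_config_near_1 by (auto simp: params_def U_def bad_set_def)
qed

section \<open>The first step of the walk\<close>

text \<open>From time 1 on, \<open>X 1\<close> only translates the path, which site weights do not
  notice. If \<open>E\<close> does not look at \<open>X 1\<close> either, this step splits off as an
  independent factor.\<close>

lemma sum_first_step:
  assumes n: "2 \<le> n" and E: "\<And>x s. E (x(1 := s)) \<longleftrightarrow> E x"
  shows "(\<Sum>x\<in>paths {1..<n}. if E x then record_weight p e \<eta> n x * \<phi> (x 1) else 0) =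
    (\<Sum>s\<in>{-1, 0, 1}. pmf (step_pmf p e) s * \<phi> s) *
    (\<Sum>z\<in>paths {2..<n}. if E z then step_weight p e {2..<n} z * site_weight {1..<n} (walk z) \<eta> else 0)"
proof -
  define G where "G = (\<lambda>z. step_weight p e {2..<n} z * site_weight {1..<n} (walk z) \<eta>)"
  have un: "{1..<n} = {1} \<union> {2..<n}" and dis: "{1} \<inter> {2..<n} = {}" using n by auto
  have eq: "(if E u then record_weight p e \<eta> n u * \<phi> (u 1) else 0) =
      pmf (step_pmf p e) (y 1) * \<phi> (y 1) * (if E z then G z else 0)"
    if "u = (\<lambda>k. if k \<in> {1} then y k else z k)" for u y z
  proof -
    have u: "u = z(1 := y 1)" unfolding that by (auto simp: fun_eq_iff)
    have 1: "step_weight p e {1..<n} u = pmf (step_pmf p e) (y 1) * step_weight p e {2..<n} z"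
    proof -
      have "step_weight p e {1..<n} u = step_weight p e {1} u * step_weight p e {2..<n} u"
        unfolding un by (rule step_weight_Un[OF dis]) auto
      moreover have "step_weight p e {2..<n} u = step_weight p e {2..<n} z"
        by (rule step_weight_cong) (simp add: u)
      ultimately show ?thesis by (simp add: step_weight_def u)
    qed
    \<comment> \<open>\<open>z\<close> lives on \<open>{2..<n}\<close>, so \<open>z 1\<close> is an
      unspecified value; it enters \<open>walk z\<close> as a constant shift.\<close>
    have "walk u k = walk z k + (y 1 - z 1)" if "k \<in> {1..<n}" for k
    proof -
      have "1 \<le> k" using that by simp
      have "(\<Sum>i\<in>{1<..k}. u i) = (\<Sum>i\<in>{1<..k}. z i)" by (intro sum.cong) (auto simp: u)
      moreover have "walk u 1 = y 1" "walk z 1 = z 1" by (simp_all add: walk_def u)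
      ultimately show ?thesis
        using walk_split[OF \<open>1 \<le> k\<close>, of u] walk_split[OF \<open>1 \<le> k\<close>, of z] by linarith
    qed
    hence 2: "site_weight {1..<n} (walk u) \<eta> = site_weight {1..<n} (walk z) \<eta>"
      by (rule site_weight_shift)
    have "E u \<longleftrightarrow> E z" unfolding u by (rule E)
    thus ?thesis
      unfolding record_weight_def 1 2 G_def by (simp add: u)
  qed
  have "(\<Sum>x\<in>paths {1..<n}. if E x then record_weight p e \<eta> n x * \<phi> (x 1) else 0) =
      (\<Sum>y\<in>paths {1}. \<Sum>z\<in>paths {2..<n}. pmf (step_pmf p e) (y 1) * \<phi> (y 1) * (if E z then G z else 0))"
    unfolding un sum_paths_Un[OF dis]
    by (intro sum.cong refl) (rule eq[OF refl])
  also have "\<dots> = (\<Sum>y\<in>paths {1}. pmf (step_pmf p e) (y 1) * \<phi> (y 1)) * (\<Sum>z\<in>paths {2..<n}. if E z then G z else 0)"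
    by (simp only: sum_product)
  also have "(\<Sum>y\<in>paths {1}. pmf (step_pmf p e) (y 1) * \<phi> (y 1)) =
      (\<Prod>k\<in>{1::nat}. \<Sum>s\<in>{-1, 0, 1}. pmf (step_pmf p e) s * \<phi> s)"
    unfolding paths_def by (subst prod_sum_PiE) auto
  also have "\<dots> = (\<Sum>s\<in>{-1, 0, 1}. pmf (step_pmf p e) s * \<phi> s)" by simp
  finally show ?thesis unfolding G_def .
qed

text \<open>Taking the test function 1 in \<open>sum_first_step\<close> identifies its second
  factor.\<close>

lemma sum_first_step_factor:
  assumes "2 \<le> n" "\<And>x s. E (x(1 := s)) \<longleftrightarrow> E x" "p \<in> {0..1}" "e \<in> {0..1}"
  shows "(\<Sum>x | x \<in> paths {1..<n} \<and> E x. record_weight p e \<eta> n x * \<phi> (x 1)) =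
    (\<Sum>s\<in>{-1, 0, 1}. pmf (step_pmf p e) s * \<phi> s) *
    (\<Sum>x | x \<in> paths {1..<n} \<and> E x. record_weight p e \<eta> n x)"
proof -
  have *: "(\<Sum>x | x \<in> paths {1..<n} \<and> E x. f x) = (\<Sum>x\<in>paths {1..<n}. if E x then f x else 0)"
    for f :: "_ \<Rightarrow> real"
    by (simp add: sum.If_cases Int_def)
  show ?thesis
    using sum_first_step[OF assms(1), where E = E and \<phi> = "\<lambda>_. 1" and p = p and e = e and \<eta> = \<eta>, OF assms(2)]
    unfolding * sum_first_step[OF assms(1), where E = E and \<phi> = \<phi> and p = p and e = e and \<eta> = \<eta>, OF assms(2)]
    by (simp only: mult_1_right mult_1_left sum_step_pmf[OF assms(3,4)])
qed

text \<open>The walk is back at the origin at time \<open>i\<close>, so time 0 adds no new site and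
  its colour is \<open>\<eta> i\<close>.\<close>

lemma black_weight_known:
  assumes "i \<in> {1..<n}" "walk x i = 0"
  shows "black_weight p e \<eta> n x = (if \<eta> i = Black then record_weight p e \<eta> n x else 0)"
proof -
  have "site_weight {..<n} (walk x) (\<eta>(0 := Black)) =
      (if \<eta> i = Black then site_weight {1..<n} (walk x) \<eta> else 0)"
  proof (cases "\<eta> i = Black")
    case True
    have "consistent {..<n} (walk x) (\<eta>(0 := Black)) \<longleftrightarrow> consistent {1..<n} (walk x) \<eta>" (is "?l \<longleftrightarrow> ?r")
    proof
      assume ?l
      hence l: "consistent {1..<n} (walk x) (\<eta>(0 := Black))" by (rule consistent_subset) auto
      show ?r
        unfolding consistent_def
      proof (intro ballI impI)
        fix a b assume ab: "a \<in> {1..<n}" "b \<in> {1..<n}" "walk x a = walk x b"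
        show "\<eta> a = \<eta> b" using consistentD[OF l ab] ab(1,2) by simp
      qed
    next
      assume r: ?r
      have 0: "\<eta> k = Black" if "k \<in> {1..<n}" "walk x k = 0" for k
        using consistentD[OF r that(1) assms(1)] that assms(2) True by simp
      show ?l
        unfolding consistent_def
      proof (intro ballI impI)
        fix a b assume ab: "a \<in> {..<n}" "b \<in> {..<n}" "walk x a = walk x b"
        show "(\<eta>(0 := Black)) a = (\<eta>(0 := Black)) b"
          using ab 0[of a] 0[of b] consistentD[OF r _ _ ab(3)] by (cases "a = 0"; cases "b = 0") auto
      qed
    qed
    moreover have "walk x ` {..<n} = walk x ` {1..<n}"
    proof
      show "walk x ` {..<n} \<subseteq> walk x ` {1..<n}"
      proof
        fix z assume "z \<in> walk x ` {..<n}"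
        then obtain k where "k < n" "z = walk x k" by auto
        thus "z \<in> walk x ` {1..<n}" using assms by (cases "k = 0") force+
      qed
    qed auto
    ultimately show ?thesis using True by (simp add: site_weight_def)
  next
    case False
    have "\<not> consistent {..<n} (walk x) (\<eta>(0 := Black))"
    proof
      assume "consistent {..<n} (walk x) (\<eta>(0 := Black))"
      from consistentD[OF this, of i 0] show False using assms False by auto
    qed
    thus ?thesis using False by (simp add: site_weight_def)
  qed
  thus ?thesis by (simp add: black_weight_def record_weight_def)
qed

definition colored_at :: "(nat \<Rightarrow> color) \<Rightarrow> nat \<Rightarrow> (nat \<Rightarrow> int) \<Rightarrow> int \<Rightarrow> color \<Rightarrow> bool" where
  "colored_at \<eta> n x z a \<longleftrightarrow> (\<exists>i\<in>{1..<n}. walk x i = z \<and> \<eta> i = a)"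

text \<open>The step \<open>X 1\<close> is independent of the record on \<open>{1..<n}\<close>, and when both neighbours of \<open>S 1\<close>
  have been seen it decides which of the two colours is \<open>Y 0\<close>.\<close>

lemma black_weight_neighbours:
  assumes n: "2 \<le> n" and E: "\<And>x s. E (x(1 := s)) \<longleftrightarrow> E x" and p: "p \<in> {0..1}"
    and col: "\<And>x. x \<in> paths {1..<n} \<Longrightarrow> E x \<Longrightarrow> record_weight p 0 \<eta> n x \<noteq> 0 \<Longrightarrow>
      colored_at \<eta> n x (walk x 1 - 1) a \<and> colored_at \<eta> n x (walk x 1 + 1) b"
    and ab: "a \<noteq> b"
  shows "(\<Sum>x | x \<in> paths {1..<n} \<and> E x. black_weight p 0 \<eta> n x) =
    (if a = Black then p else 1 - p) * (\<Sum>x | x \<in> paths {1..<n} \<and> E x. record_weight p 0 \<eta> n x)"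
proof -
  \<comment> \<open>Indicator of \<open>Y 0 = Black\<close> in terms of \<open>X 1\<close>: after a
    step +1 the origin is the left neighbour of \<open>S 1\<close>, of colour \<open>a\<close>;
    after a step -1 it is the right one, of colour \<open>b\<close>.\<close>
  define \<phi> :: "int \<Rightarrow> real" where "\<phi> = (\<lambda>s. if s = 1 \<and> a = Black \<or> s = -1 \<and> b = Black then 1 else 0)"
  have pmf0: "pmf (step_pmf p 0) 0 = 0" "pmf (step_pmf p 0) 1 = p" "pmf (step_pmf p 0) (-1) = 1 - p"
    using pmf_step[OF p, of 0] by simp_all
  have "black_weight p 0 \<eta> n x = record_weight p 0 \<eta> n x * \<phi> (x 1)"
    if x: "x \<in> paths {1..<n}" "E x" for x
  proof (cases "record_weight p 0 \<eta> n x = 0")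
    case True
    thus ?thesis using black_weight_le[of p 0 \<eta> n x] black_weight_nonneg[of p 0 \<eta> n x] by simp
  next
    case False
    have one: "1 \<in> {1..<n}" using n by simp
    have "x 1 \<noteq> 0"
    proof
      assume "x 1 = 0"
      hence "step_weight p 0 {1..<n} x = 0"
        using one pmf0 unfolding step_weight_def by (intro prod_zero bexI[OF _ one]) auto
      thus False using False by (simp add: record_weight_def)
    qed
    hence x1: "x 1 = 1 \<or> x 1 = -1" using paths_mem[OF x(1) one] by auto
    have w1: "walk x 1 = x 1" by (simp add: walk_def)
    from x1 show ?thesis
    proof
      assume s: "x 1 = 1"
      obtain i where "i \<in> {1..<n}" "walk x i = 0" "\<eta> i = a"
        using col[OF x False] s w1 by (auto simp: colored_at_def)
      thus ?thesis using black_weight_known[of i n x p 0 \<eta>] s by (simp add: \<phi>_def)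
    next
      assume s: "x 1 = -1"
      obtain i where "i \<in> {1..<n}" "walk x i = 0" "\<eta> i = b"
        using col[OF x False] s w1 by (auto simp: colored_at_def)
      thus ?thesis using black_weight_known[of i n x p 0 \<eta>] s by (simp add: \<phi>_def)
    qed
  qed
  hence "(\<Sum>x | x \<in> paths {1..<n} \<and> E x. black_weight p 0 \<eta> n x) =
      (\<Sum>x | x \<in> paths {1..<n} \<and> E x. record_weight p 0 \<eta> n x * \<phi> (x 1))"
    by (intro sum.cong) auto
  also have "\<dots> = (\<Sum>s\<in>{-1, 0, 1}. pmf (step_pmf p 0) s * \<phi> s) *
      (\<Sum>x | x \<in> paths {1..<n} \<and> E x. record_weight p 0 \<eta> n x)"
    using p by (intro sum_first_step_factor[OF n E]) auto
  also have "(\<Sum>s\<in>{-1, 0, 1}. pmf (step_pmf p 0) s * \<phi> s) = (if a = Black then p else 1 - p)"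
    using ab pmf0 by (cases a; cases b) (auto simp: \<phi>_def)
  finally show ?thesis .
qed

text \<open>The conditional probability is a mixture of \<open>v\<close> on \<open>E\<close> and
  some value in the unit interval off \<open>E\<close>.\<close>

lemma cond_black_approx:
  assumes n: "1 \<le> n" and Z: "0 < partition_sum p e \<eta> n" and v: "0 \<le> v" "v \<le> 1"
    and E: "(\<Sum>x | x \<in> paths {1..<n} \<and> E x. black_weight p e \<eta> n x) =
      v * (\<Sum>x | x \<in> paths {1..<n} \<and> E x. record_weight p e \<eta> n x)"
  shows "\<bar>cond_black p e \<eta> n - v\<bar> \<le>
    (\<Sum>x | x \<in> paths {1..<n} \<and> \<not> E x. record_weight p e \<eta> n x) / partition_sum p e \<eta> n"
proof -
  have split: "(\<Sum>x\<in>paths {1..<n}. f x) =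
      (\<Sum>x | x \<in> paths {1..<n} \<and> E x. f x) + (\<Sum>x | x \<in> paths {1..<n} \<and> \<not> E x. f x)" for f :: "_ \<Rightarrow> real"
    by (subst sum.union_disjoint[symmetric]) (auto intro!: sum.cong)
  define N' Z' where "N' = (\<Sum>x | x \<in> paths {1..<n} \<and> \<not> E x. black_weight p e \<eta> n x)"
    and "Z' = (\<Sum>x | x \<in> paths {1..<n} \<and> \<not> E x. record_weight p e \<eta> n x)"
  have N': "0 \<le> N'" "N' \<le> Z'"
    unfolding N'_def Z'_def by (auto intro!: sum_nonneg sum_mono black_weight_le)
  have "(\<Sum>x\<in>paths {1..<n}. black_weight p e \<eta> n x) - v * partition_sum p e \<eta> n = N' - v * Z'"
    unfolding partition_sum_def split[of "black_weight p e \<eta> n"] split[of "record_weight p e \<eta> n"] E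
    by (simp add: N'_def Z'_def algebra_simps)
  moreover have "\<bar>N' - v * Z'\<bar> \<le> Z'"
  proof -
    have "0 \<le> v * Z'" "v * Z' \<le> 1 * Z'" using N' v mult_right_mono[of v 1 Z'] by auto
    thus ?thesis using N' by linarith
  qed
  moreover have "cond_black p e \<eta> n - v =
      ((\<Sum>x\<in>paths {1..<n}. black_weight p e \<eta> n x) - v * partition_sum p e \<eta> n) / partition_sum p e \<eta> n"
    using Z by (simp add: cond_black_eq[OF n] field_simps)
  ultimately show ?thesis using Z by (simp add: abs_divide divide_right_mono Z'_def)
qed

section \<open>Zigzag extensions\<close>

text \<open>Position at time \<open>k\<close> of the walk that starts at 0, goes right and turns at
  times \<open>L\<close> and \<open>2 * L\<close>.\<close>

definition tent :: "nat \<Rightarrow> nat \<Rightarrow> int" where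
  "tent L k = (if k \<le> L then int k else if k \<le> 2 * L then 2 * int L - int k else int k - 2 * int L)"

definition leg :: "nat \<Rightarrow> int \<Rightarrow> int \<Rightarrow> int \<Rightarrow> nat \<Rightarrow> int" where
  "leg L a b c k = (if k \<le> L then a else if k \<le> 2 * L then b else c)"

text \<open>The steps up to time \<open>m\<close> stay free, because there the record is a given
  configuration rather than a zigzag.\<close>

definition legs :: "nat \<Rightarrow> nat \<Rightarrow> int \<Rightarrow> int \<Rightarrow> int \<Rightarrow> (nat \<Rightarrow> int) \<Rightarrow> bool" where
  "legs m L a b c x \<longleftrightarrow> (\<forall>k\<in>{m<..3 * L}. x k = leg L a b c k)"

text \<open>Every site has one neighbour of each colour, as in the periodic scenery \<open>BBWWBBWW\<dots>\<close>.\<close>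

definition split_coloring :: "(int \<Rightarrow> color) \<Rightarrow> bool" where
  "split_coloring c \<longleftrightarrow> (\<forall>z. c (z + 2) \<noteq> c z)"

lemma split_coloring_nbrs: "split_coloring c \<Longrightarrow> c (z - 1) \<noteq> c (z + 1)"
  unfolding split_coloring_def by (drule spec[of _ "z - 1"]) (simp add: algebra_simps eq_commute)

lemma split_coloring_dist2: "split_coloring c \<Longrightarrow> a = b + 2 \<or> b = a + 2 \<Longrightarrow> c a \<noteq> c b"
  unfolding split_coloring_def by metis

text \<open>The shift by \<open>m\<close> puts the zigzag at site 0 of the scenery \<open>c\<close>
  at time \<open>m\<close>, where the extension begins.\<close>

definition zigzag_record :: "nat \<Rightarrow> nat \<Rightarrow> (int \<Rightarrow> color) \<Rightarrow> (nat \<Rightarrow> color) \<Rightarrow> bool" where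
  "zigzag_record m L c \<zeta> \<longleftrightarrow> (\<forall>k\<in>{m..3 * L}. \<zeta> k = c (tent L k - int m))"

lemma record_weight_nonzeroD:
  assumes x: "x \<in> paths {1..<n}" and nz: "record_weight p 0 \<eta> n x \<noteq> 0" and p: "p \<in> {0..1}"
  shows "consistent {1..<n} (walk x) \<eta>" "\<And>k. k \<in> {1..<n} \<Longrightarrow> x k = 1 \<or> x k = -1"
proof -
  show "consistent {1..<n} (walk x) \<eta>"
    using nz by (auto simp: record_weight_def site_weight_def split: if_splits)
  fix k assume k: "k \<in> {1..<n}"
  have "pmf (step_pmf p 0) (x k) \<noteq> 0"
    using nz k unfolding record_weight_def step_weight_def by auto
  thus "x k = 1 \<or> x k = -1"
    using paths_mem[OF x k] pmf_step(1)[OF p, of 0] by auto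
qed

text \<open>A turn would lead back to the site visited two steps before, whose colour is
  different.\<close>

lemma consistent_straight:
  assumes "consistent I (walk x) \<eta>" "k - 1 \<in> I" "Suc k \<in> I" "1 \<le> k" "\<eta> (Suc k) \<noteq> \<eta> (k - 1)"
    and "x k = 1 \<or> x k = -1" "x (Suc k) = 1 \<or> x (Suc k) = -1"
  shows "x (Suc k) = x k"
proof (rule ccontr)
  assume "x (Suc k) \<noteq> x k"
  hence "walk x (Suc k) = walk x (k - 1)"
    using assms(6,7) walk_Suc[of x k] walk_Suc[of x "k - 1"] assms(4) by auto
  hence "\<eta> (Suc k) = \<eta> (k - 1)" using consistentD[OF assms(1) assms(3,2)] by simp
  thus False using assms(5) by simp
qed

lemma tent_step2:
  assumes "1 \<le> k" "k \<noteq> L" "k \<noteq> 2 * L"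
  shows "tent L (Suc k) = tent L (k - 1) + 2 \<or> tent L (k - 1) = tent L (Suc k) + 2"
proof -
  obtain j where "k = Suc j" using assms by (cases k) auto
  thus ?thesis using assms by (auto simp: tent_def)
qed

text \<open>Except at \<open>L\<close> and \<open>2 * L\<close>, the colours read before and after a
  time belong to sites at distance 2 and differ, so the walk cannot turn there.\<close>

lemma zigzag_legs:
  assumes m: "1 \<le> m" "m < L" and x: "x \<in> paths {1..<3 * L + 1}" and p: "p \<in> {0..1}"
    and zz: "zigzag_record m L c \<zeta>" and c: "split_coloring c"
    and nz: "record_weight p 0 \<zeta> (3 * L + 1) x \<noteq> 0"
  shows "\<exists>a\<in>{-1, 1}. \<exists>b\<in>{-1, 1}. \<exists>d\<in>{-1, 1}. legs m L a b d x"
proof -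
  note con = record_weight_nonzeroD(1)[OF x nz p]
  have st: "x k = 1 \<or> x k = -1" if "1 \<le> k" "k \<le> 3 * L" for k
    using record_weight_nonzeroD(2)[OF x nz p] that by auto
  have straight: "x (Suc k) = x k" if k: "m < k" "k < 3 * L" "k \<noteq> L" "k \<noteq> 2 * L" for k
  proof (rule consistent_straight[OF con])
    have "Suc k \<in> {m..3 * L}" "k - 1 \<in> {m..3 * L}" using k by auto
    hence z: "\<zeta> (Suc k) = c (tent L (Suc k) - int m)" "\<zeta> (k - 1) = c (tent L (k - 1) - int m)"
      using zz unfolding zigzag_record_def by blast+
    show "\<zeta> (Suc k) \<noteq> \<zeta> (k - 1)"
      unfolding z using tent_step2[of k L] k by (intro split_coloring_dist2[OF c]) auto
  qed (use k m st[of k] st[of "Suc k"] in auto)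
  have seg: "x k = x (Suc a)" if "m \<le> a" "\<And>j. a < j \<Longrightarrow> j < b \<Longrightarrow> j \<noteq> L \<and> j \<noteq> 2 * L" "b \<le> 3 * L" "k \<in> {a<..b}" for a b k
  proof -
    have "Suc a \<le> k" using that by simp
    thus ?thesis using that(4)
    proof (induction k rule: dec_induct)
      case (step k)
      have "x (Suc k) = x k"
        using step.hyps step.prems that(1,3) that(2)[of k] by (intro straight) auto
      moreover have "x k = x (Suc a)" using step by auto
      ultimately show ?case by simp
    qed simp
  qed
  have seg1: "x k = x (Suc m)" if "k \<in> {m<..L}" for k
    by (rule seg[OF _ _ _ that]) (use m in auto)
  have seg2: "x k = x (Suc L)" if "k \<in> {L<..2 * L}" for k
    by (rule seg[OF _ _ _ that]) (use m in auto)
  have seg3: "x k = x (Suc (2 * L))" if "k \<in> {2 * L<..3 * L}" for k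
    by (rule seg[OF _ _ _ that]) (use m in auto)
  have "legs m L (x (Suc m)) (x (Suc L)) (x (Suc (2 * L))) x"
    unfolding legs_def
  proof
    fix k assume k: "k \<in> {m<..3 * L}"
    consider "k \<in> {m<..L}" | "k \<in> {L<..2 * L}" | "k \<in> {2 * L<..3 * L}" using k by fastforce
    thus "x k = leg L (x (Suc m)) (x (Suc L)) (x (Suc (2 * L))) k"
    proof cases
      case 1 with seg1[OF 1] show ?thesis by (simp add: leg_def)
    next
      case 2 with seg2[OF 2] show ?thesis by (simp add: leg_def)
    next
      case 3 with seg3[OF 3] show ?thesis by (simp add: leg_def)
    qed
  qed
  moreover have "x (Suc m) \<in> {-1, 1}" "x (Suc L) \<in> {-1, 1}" "x (Suc (2 * L)) \<in> {-1, 1}"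
    using st[of "Suc m"] st[of "Suc L"] st[of "Suc (2 * L)"] m by auto
  ultimately show ?thesis by blast
qed

section \<open>Upper bounds for the weight of a leg pattern\<close>

lemma card_walk_segment:
  assumes s: "\<And>k. k \<in> {a<..b} \<Longrightarrow> x k = s" "s \<noteq> 0" and ab: "1 \<le> a" "a \<le> b" "b < n"
  shows "b - a + 1 \<le> card (walk x ` {1..<n})"
proof -
  have w: "walk x k = walk x a + s * (int k - int a)" if "k \<in> {a..b}" for k
  proof -
    have "(\<Sum>i\<in>{a<..k}. x i) = (\<Sum>i\<in>{a<..k}. s)" using that by (intro sum.cong s) auto
    thus ?thesis using walk_split[of a k x] that by (simp add: of_nat_diff mult.commute)
  qed
  have "inj_on (walk x) {a..b}"
  proof (rule inj_onI)
    fix i j assume ij: "i \<in> {a..b}" "j \<in> {a..b}" "walk x i = walk x j"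
    hence "s * (int i - int a) = s * (int j - int a)" using w[OF ij(1)] w[OF ij(2)] by simp
    thus "i = j" using s(2) by simp
  qed
  hence "card (walk x ` {a..b}) = b - a + 1" using ab by (simp add: card_image)
  moreover have "card (walk x ` {a..b}) \<le> card (walk x ` {1..<n})"
    using ab by (intro card_mono) auto
  ultimately show ?thesis by simp
qed

lemma site_weight_le_range: "R \<le> card (f ` I) \<Longrightarrow> site_weight I f \<eta> \<le> (1 / 2) ^ R"
  by (auto simp: site_weight_def intro: power_decreasing)

lemma legs_step_weight:
  assumes "legs m L a b d x" "m \<le> L"
  shows "step_weight p e {m<..3 * L} x =
    pmf (step_pmf p e) a ^ (L - m) * pmf (step_pmf p e) b ^ L * pmf (step_pmf p e) d ^ L"
proof -
  define w where "w = pmf (step_pmf p e)"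
  have un: "{m<..3 * L} = {m<..L} \<union> {L<..2 * L} \<union> {2 * L<..3 * L}" using assms(2) by auto
  have "step_weight p e {m<..3 * L} x = (\<Prod>k\<in>{m<..3 * L}. w (leg L a b d k))"
    using assms(1) by (simp add: step_weight_def w_def legs_def)
  also have "\<dots> = (\<Prod>k\<in>{m<..L}. w (leg L a b d k)) * (\<Prod>k\<in>{L<..2 * L}. w (leg L a b d k)) *
      (\<Prod>k\<in>{2 * L<..3 * L}. w (leg L a b d k))"
    unfolding un
    by (subst prod.union_disjoint, simp, simp, fastforce, subst prod.union_disjoint) auto
  also have "\<dots> = (\<Prod>k\<in>{m<..L}. w a) * (\<Prod>k\<in>{L<..2 * L}. w b) * (\<Prod>k\<in>{2 * L<..3 * L}. w d)"
    by (intro arg_cong2[where f = "(*)"] prod.cong) (auto simp: leg_def)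
  finally show ?thesis by (simp add: w_def)
qed

text \<open>The steps up to time \<open>m\<close> are summed out with total mass 1; all later steps
  are prescribed by the pattern.\<close>

lemma legs_weight:
  assumes p: "p \<in> {0..1}" and m: "m \<le> L"
  shows "(\<Sum>x | x \<in> paths {1..<3 * L + 1} \<and> legs m L a b d x. step_weight p 0 {1..<3 * L + 1} x) \<le>
    pmf (step_pmf p 0) a ^ (L - m) * pmf (step_pmf p 0) b ^ L * pmf (step_pmf p 0) d ^ L"
proof -
  define A B where "A = {1..m}" and "B = {m<..3 * L}"
  define w where "w = pmf (step_pmf p 0)"
  have un: "{1..<3 * L + 1} = A \<union> B" and dis: "A \<inter> B = {}" and fin: "finite A" "finite B"
    using m by (auto simp: A_def B_def)
  define t where "t = restrict (leg L a b d) B"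
  have "(\<Sum>x | x \<in> paths {1..<3 * L + 1} \<and> legs m L a b d x. step_weight p 0 {1..<3 * L + 1} x) =
      (\<Sum>x\<in>paths (A \<union> B). if legs m L a b d x then step_weight p 0 (A \<union> B) x else 0)"
    unfolding un using fin by (simp add: sum.If_cases Int_def)
  also have "\<dots> = (\<Sum>y\<in>paths A. \<Sum>z\<in>paths B.
      if z = t then step_weight p 0 A y * step_weight p 0 B z else 0)"
    unfolding sum_paths_Un[OF dis]
  proof (intro sum.cong refl)
    fix y z assume yz: "y \<in> paths A" "z \<in> paths B"
    let ?u = "\<lambda>k. if k \<in> A then y k else z k"
    have "legs m L a b d ?u \<longleftrightarrow> (\<forall>k\<in>B. z k = leg L a b d k)"
      using dis unfolding legs_def B_def[symmetric] by (intro ball_cong) auto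
    also have "\<dots> \<longleftrightarrow> z = t"
      using yz(2) by (auto simp: t_def paths_def fun_eq_iff PiE_iff extensional_def)
    finally have "legs m L a b d ?u \<longleftrightarrow> z = t" .
    moreover have "step_weight p 0 (A \<union> B) ?u = step_weight p 0 A y * step_weight p 0 B z"
    proof -
      have "step_weight p 0 A ?u = step_weight p 0 A y" by (rule step_weight_cong) simp
      moreover have "step_weight p 0 B ?u = step_weight p 0 B z"
        using dis by (intro step_weight_cong) auto
      ultimately show ?thesis by (simp add: step_weight_Un[OF dis fin])
    qed
    ultimately show "(if legs m L a b d ?u then step_weight p 0 (A \<union> B) ?u else 0) =
        (if z = t then step_weight p 0 A y * step_weight p 0 B z else 0)" by simp
  qed
  also have "\<dots> \<le> (\<Sum>y\<in>paths A. step_weight p 0 A y * step_weight p 0 B t)"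
    using fin by (intro sum_mono) (simp add: sum.delta)
  also have "\<dots> = (\<Sum>y\<in>paths A. step_weight p 0 A y) * step_weight p 0 B t"
    by (simp add: sum_distrib_right)
  also have "\<dots> = step_weight p 0 B t"
    using sum_step_weight[OF p _ fin(1), of 0] by simp
  also have "\<dots> = w a ^ (L - m) * w b ^ L * w d ^ L"
    unfolding B_def w_def
    by (rule legs_step_weight[OF _ m]) (simp add: legs_def t_def B_def)
  finally show ?thesis by (simp add: w_def)
qed

lemma legs_record_weight:
  assumes p: "p \<in> {0..1}" and m: "m \<le> L"
    and R: "\<And>x. x \<in> paths {1..<3 * L + 1} \<Longrightarrow> legs m L a b d x \<Longrightarrow> R \<le> card (walk x ` {1..<3 * L + 1})"
  shows "(\<Sum>x | x \<in> paths {1..<3 * L + 1} \<and> legs m L a b d x. record_weight p 0 \<eta> (3 * L + 1) x) \<le>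
    pmf (step_pmf p 0) a ^ (L - m) * pmf (step_pmf p 0) b ^ L * pmf (step_pmf p 0) d ^ L * (1 / 2) ^ R"
proof -
  have "(\<Sum>x | x \<in> paths {1..<3 * L + 1} \<and> legs m L a b d x. record_weight p 0 \<eta> (3 * L + 1) x) \<le>
      (\<Sum>x | x \<in> paths {1..<3 * L + 1} \<and> legs m L a b d x. step_weight p 0 {1..<3 * L + 1} x * (1 / 2) ^ R)"
    unfolding record_weight_def
    using R by (intro sum_mono mult_left_mono site_weight_le_range) auto
  also have "\<dots> = (\<Sum>x | x \<in> paths {1..<3 * L + 1} \<and> legs m L a b d x. step_weight p 0 {1..<3 * L + 1} x) * (1 / 2) ^ R"
    by (simp add: sum_distrib_right)
  also have "\<dots> \<le> pmf (step_pmf p 0) a ^ (L - m) * pmf (step_pmf p 0) b ^ L * pmf (step_pmf p 0) d ^ L * (1 / 2) ^ R"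
    by (intro mult_right_mono legs_weight p m) auto
  finally show ?thesis .
qed

section \<open>Decoding the early path backwards in a known scenery\<close>

fun back_pos :: "(int \<Rightarrow> color) \<Rightarrow> (nat \<Rightarrow> color) \<Rightarrow> nat \<Rightarrow> nat \<Rightarrow> int" where
  "back_pos c \<eta> m 0 = 0"
| "back_pos c \<eta> m (Suc i) =
    (if c (back_pos c \<eta> m i + 1) = \<eta> (m - Suc i) then back_pos c \<eta> m i + 1 else back_pos c \<eta> m i - 1)"

lemma color_eq_cases: "(a :: color) \<noteq> b \<Longrightarrow> c \<noteq> b \<Longrightarrow> a = c"
  by (cases a; cases b; cases c) auto

text \<open>\<open>back_pos\<close> retraces the record from site 0 at time \<open>m\<close>,
  \<open>i\<close> steps into the past. The two neighbours of a site have different colours, so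
  exactly one of them shows the colour recorded one step earlier.\<close>

lemma back_pos_color:
  assumes "split_coloring c" "c 0 = \<eta> m"
  shows "c (back_pos c \<eta> m i) = \<eta> (m - i)"
proof (cases i)
  case (Suc j)
  define b where "b = back_pos c \<eta> m j"
  have ne: "c (b - 1) \<noteq> c (b + 1)" using split_coloring_nbrs[OF assms(1)] .
  show ?thesis
  proof (cases "c (b + 1) = \<eta> (m - Suc j)")
    case True
    thus ?thesis by (simp add: Suc b_def)
  next
    case False
    have "c (b - 1) = \<eta> (m - Suc j)" using color_eq_cases[OF ne False[symmetric]] .
    thus ?thesis using False by (simp add: Suc b_def)
  qed
qed (simp add: assms)

lemma back_pos_unique:
  assumes "split_coloring c" "z = back_pos c \<eta> m i + 1 \<or> z = back_pos c \<eta> m i - 1" "c z = \<eta> (m - Suc i)"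
  shows "z = back_pos c \<eta> m (Suc i)"
proof -
  define b where "b = back_pos c \<eta> m i"
  have ne: "c (b - 1) \<noteq> c (b + 1)" using split_coloring_nbrs[OF assms(1)] .
  from assms(2) show ?thesis
  proof
    assume "z = back_pos c \<eta> m i + 1"
    thus ?thesis using assms(3) by simp
  next
    assume z: "z = back_pos c \<eta> m i - 1"
    hence "c (b + 1) \<noteq> \<eta> (m - Suc i)" using ne assms(3) by (metis b_def)
    thus ?thesis using z by (simp add: b_def)
  qed
qed

lemma back_pos_bound: "\<bar>back_pos c \<eta> m i\<bar> \<le> int i"
  by (induction i) auto

text \<open>Reflection swaps the two candidates of each backward step, and only one of them fits the
  record.\<close>

lemma back_pos_reflect:
  assumes "split_coloring c"
  shows "back_pos (\<lambda>z. c (- z)) \<eta> m i = - back_pos c \<eta> m i"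
proof (induction i)
  case (Suc i)
  define b where "b = back_pos c \<eta> m i"
  have "c (b - 1) \<noteq> c (b + 1)" using split_coloring_nbrs[OF assms] .
  hence "c (b - 1) = \<eta> (m - Suc i) \<longleftrightarrow> c (b + 1) \<noteq> \<eta> (m - Suc i)" using color_eq_cases[of "c (b - 1)" "c (b + 1)" "\<eta> (m - Suc i)"] by metis
  thus ?case by (simp add: Suc flip: b_def)
qed simp

lemma tent_Suc: "tent L (Suc k) = tent L k + leg L 1 (-1) 1 (Suc k)"
  by (auto simp: tent_def leg_def)

lemma legs_alt_walk:
  assumes "legs m L s (- s) s x" "k \<in> {m..3 * L}" "m \<le> L"
  shows "walk x k = walk x m + s * (tent L k - int m)"
proof -
  have "m \<le> k" using assms by simp
  thus ?thesis using assms(2)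
  proof (induction k rule: dec_induct)
    case base
    thus ?case using assms(3) by (simp add: tent_def)
  next
    case (step k)
    have "x (Suc k) = s * leg L 1 (-1) 1 (Suc k)"
      using assms(1) step by (auto simp: legs_def leg_def)
    thus ?case using step by (simp add: walk_Suc tent_Suc algebra_simps)
  qed
qed

text \<open>The second leg sweeps this whole window of sites. The sign \<open>s\<close> is 1 for the
  zigzag and -1 for its mirror image.\<close>

lemma legs_alt_colored:
  assumes legs: "legs m L s (- s) s x" and m: "1 \<le> m" "m \<le> L" and zz: "zigzag_record m L c \<zeta>"
    and z: "- int m \<le> z" "z \<le> int L - int m"
  shows "colored_at \<zeta> (3 * L + 1) x (walk x m + s * z) (c z)"
proof -
  \<comment> \<open>The time on the second leg at which \<open>tent L k - int m\<close> equals
    \<open>z\<close>.\<close>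
  define k where "k = nat (2 * int L - int m - z)"
  have k: "int k = 2 * int L - int m - z" using z m by (simp add: k_def)
  hence kk: "L \<le> k" "k \<le> 2 * L" using z by linarith+
  have t: "tent L k - int m = z" using kk k by (auto simp: tent_def)
  have mem: "k \<in> {m..3 * L}" using kk m by auto
  have "walk x k = walk x m + s * z" using legs_alt_walk[OF legs mem m(2)] t by simp
  moreover have "\<zeta> k = c z" using zz mem t unfolding zigzag_record_def by auto
  moreover have "k \<in> {1..<3 * L + 1}" using mem m by auto
  ultimately show ?thesis unfolding colored_at_def by blast
qed

lemma walk_near:
  assumes x: "\<And>i. i \<in> {j<..k} \<Longrightarrow> \<bar>x i\<bar> \<le> 1" and "j \<le> k"
  shows "\<bar>walk x k - walk x j\<bar> \<le> int (k - j)"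
proof -
  have "\<bar>\<Sum>i\<in>{j<..k}. x i\<bar> \<le> (\<Sum>i\<in>{j<..k}. 1)"
    by (intro order_trans[OF sum_abs] sum_mono x)
  thus ?thesis using walk_split[OF assms(2), of x] by simp
qed

lemma colored_at_unique:
  assumes "consistent {1..<n} (walk x) \<eta>" "colored_at \<eta> n x (walk x k) a" "k \<in> {1..<n}"
  shows "\<eta> k = a"
  using assms consistentD[OF assms(1), of k] unfolding colored_at_def by metis

text \<open>As \<open>2 * m \<le> L\<close>, the second leg reveals all sites within distance
  \<open>m\<close> of \<open>S m\<close>. The early path stays among them, so its steps are forced
  one by one, backwards from time \<open>m\<close>.\<close>

lemma legs_alt_back_pos:
  assumes x: "x \<in> paths {1..<3 * L + 1}" and p: "p \<in> {0..1}"
    and nz: "record_weight p 0 \<zeta> (3 * L + 1) x \<noteq> 0"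
    and legs: "legs m L s (- s) s x" and s: "s = 1 \<or> s = -1" and m: "1 \<le> m" "2 * m \<le> L"
    and zz: "zigzag_record m L c \<zeta>" and c: "split_coloring c" and "i < m"
  shows "walk x (m - i) = walk x m + s * back_pos c \<zeta> m i"
  using \<open>i < m\<close>
proof (induction i)
  case (Suc i)
  note con = record_weight_nonzeroD(1)[OF x nz p]
  define k where "k = m - Suc i"
  have k: "m - i = Suc k" "1 \<le> k" "k \<le> m" using Suc.prems by (auto simp: k_def)
  have ss: "s * s = 1" using s by auto
  have st: "x j = 1 \<or> x j = -1" if "1 \<le> j" "j \<le> m" for j
    using record_weight_nonzeroD(2)[OF x nz p, of j] that m by auto
  \<comment> \<open>Position at time \<open>k\<close> in scenery coordinates, with the orientation
    \<open>s\<close> removed.\<close>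
  define z where "z = s * (walk x k - walk x m)"
  have sz: "s * z = walk x k - walk x m" using ss by (simp add: z_def flip: mult.assoc)
  have "\<bar>walk x m - walk x k\<bar> \<le> int (m - k)"
  proof (rule walk_near)
    fix i assume "i \<in> {k<..m}"
    thus "\<bar>x i\<bar> \<le> 1" using st[of i] k by auto
  qed (rule k(3))
  hence "\<bar>z\<bar> \<le> int m" using s k by (auto simp: z_def abs_mult)
  hence "colored_at \<zeta> (3 * L + 1) x (walk x m + s * z) (c z)"
    using m by (intro legs_alt_colored[OF legs _ _ zz]) auto
  hence "c z = \<zeta> k"
    using colored_at_unique[OF con, of k "c z"] sz k m by simp
  moreover have "z = back_pos c \<zeta> m i + 1 \<or> z = back_pos c \<zeta> m i - 1"
  proof -
    have "walk x (Suc k) = walk x m + s * back_pos c \<zeta> m i" using Suc k by simp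
    moreover have "x (Suc k) = 1 \<or> x (Suc k) = -1" using st[of "Suc k"] k Suc.prems by (auto simp: k_def)
    ultimately show ?thesis using s unfolding z_def walk_Suc by (elim disjE) auto
  qed
  ultimately have "z = back_pos c \<zeta> m (Suc i)"
    using back_pos_unique[OF c, of z \<zeta> m i] by (simp only: k_def)
  thus ?case using sz by (simp add: k_def)
qed simp

text \<open>\<open>S 1\<close> is at most \<open>m - 1\<close> away from \<open>S m\<close>, so both
  of its neighbours still lie in the revealed window. For the mirror image their colours are
  swapped.\<close>

lemma legs_alt_neighbours:
  assumes x: "x \<in> paths {1..<3 * L + 1}" and p: "p \<in> {0..1}"
    and nz: "record_weight p 0 \<zeta> (3 * L + 1) x \<noteq> 0"
    and legs: "legs m L s (- s) s x" and s: "s = 1 \<or> s = -1" and m: "1 \<le> m" "2 * m \<le> L"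
    and zz: "zigzag_record m L c \<zeta>" and c: "split_coloring c"
  defines "b \<equiv> back_pos c \<zeta> m (m - 1)"
  shows "colored_at \<zeta> (3 * L + 1) x (walk x 1 - 1) (c (b - s)) \<and>
    colored_at \<zeta> (3 * L + 1) x (walk x 1 + 1) (c (b + s))"
proof -
  have w: "walk x 1 = walk x m + s * b"
    using legs_alt_back_pos[OF x p nz legs s m zz c, of "m - 1"] m by (simp add: b_def)
  have b: "\<bar>b\<bar> \<le> int m - 1"
    using back_pos_bound[of c \<zeta> m "m - 1"] m by (simp add: b_def of_nat_diff)
  have "colored_at \<zeta> (3 * L + 1) x (walk x m + s * (b - s)) (c (b - s))"
    by (rule legs_alt_colored[OF legs _ _ zz]) (use b s m in auto)
  moreover have "colored_at \<zeta> (3 * L + 1) x (walk x m + s * (b + s)) (c (b + s))"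
    by (rule legs_alt_colored[OF legs _ _ zz]) (use b s m in auto)
  moreover have "walk x m + s * (b - s) = walk x 1 - 1" "walk x m + s * (b + s) = walk x 1 + 1"
    using s unfolding w by (auto simp: algebra_simps)
  ultimately show ?thesis by simp
qed

section \<open>Comparison of the leg patterns with the zigzag\<close>

lemma pmf_step_0:
  assumes "p \<in> {0..1}"
  shows "pmf (step_pmf p 0) 1 = p" "pmf (step_pmf p 0) (-1) = 1 - p"
  using pmf_step[OF assms, of 0] by simp_all

text \<open>The contribution of one path: the backward decoding up to time \<open>m\<close>,
  followed by the zigzag. It visits at most \<open>L + 1\<close> sites, and since \<open>p\<close>
  is at least 1/2 each early step has weight at least \<open>1 - p\<close>.\<close>

lemma zigzag_partition_ge:
  assumes p: "p \<in> {1/2..1}" and m: "1 \<le> m" "2 * m \<le> L"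
    and zz: "zigzag_record m L c \<zeta>" and c: "split_coloring c"
  shows "(1 - p) ^ m * (p ^ (L - m) * (1 - p) ^ L * p ^ L) * (1 / 2) ^ (L + 1) \<le>
    partition_sum p 0 \<zeta> (3 * L + 1)"
proof -
  have p01: "p \<in> {0..1}" using p by auto
  \<comment> \<open>Positions in scenery coordinates. At time 0 the value \<open>\<zeta> 0\<close>
    merely picks the sign of the first step; consistency is asked from time 1 on.\<close>
  define pos where "pos = (\<lambda>k. if k \<le> m then back_pos c \<zeta> m (m - k) else tent L k - int m)"
  define x where "x = restrict (\<lambda>k. pos k - pos (k - 1)) {1..<3 * L + 1}"
  have c0: "c 0 = \<zeta> m"
    using zz m unfolding zigzag_record_def by (auto simp: tent_def dest!: bspec[of _ _ m])
  have pos_ge: "pos k = tent L k - int m" if "m \<le> k" for k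
    using that m by (auto simp: pos_def tent_def)
  have color: "\<zeta> k = c (pos k)" if "k \<in> {1..<3 * L + 1}" for k
  proof (cases "k \<le> m")
    case True
    thus ?thesis using back_pos_color[where c = c and \<eta> = \<zeta> and m = m and i = "m - k", OF c c0] by (simp add: pos_def)
  next
    case False
    thus ?thesis using zz that by (simp add: pos_def zigzag_record_def)
  qed
  have w: "walk x k = pos k - pos 0" if "k < 3 * L + 1" for k
    using that by (induction k) (auto simp: walk_Suc x_def)
  have small: "x k = 1 \<or> x k = -1" if "1 \<le> k" "k \<le> m" for k
  proof -
    have "m - (k - 1) = Suc (m - k)" using that by simp
    hence "pos (k - 1) = pos k + 1 \<or> pos (k - 1) = pos k - 1"
      using that by (auto simp: pos_def)
    thus ?thesis using that m by (auto simp: x_def)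
  qed
  have legs: "legs m L 1 (-1) 1 x"
    unfolding legs_def
  proof
    fix k assume k: "k \<in> {m<..3 * L}"
    then obtain j where j: "k = Suc j" by (cases k) auto
    show "x k = leg L 1 (- 1) 1 k"
      using k m by (simp add: x_def j pos_ge tent_Suc)
  qed
  have xp: "x \<in> paths {1..<3 * L + 1}"
    unfolding paths_def
  proof (rule PiE_I)
    fix k assume k: "k \<in> {1..<3 * L + 1}"
    show "x k \<in> {-1, 0, 1}"
    proof (cases "k \<le> m")
      case True thus ?thesis using small[of k] k by auto
    next
      case False
      hence "x k = leg L 1 (-1) 1 k" using legs k by (auto simp: legs_def)
      thus ?thesis by (simp add: leg_def)
    qed
  qed (auto simp: x_def)
  have "consistent {1..<3 * L + 1} (walk x) \<zeta>"
    unfolding consistent_def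
  proof (intro ballI impI)
    fix i j assume ij: "i \<in> {1..<3 * L + 1}" "j \<in> {1..<3 * L + 1}" "walk x i = walk x j"
    hence "pos i = pos j" using w[of i] w[of j] by simp
    thus "\<zeta> i = \<zeta> j" using color ij by simp
  qed
  moreover have "card (walk x ` {1..<3 * L + 1}) \<le> L + 1"
  proof -
    have bd: "pos k \<in> {- int m..int L - int m}" if "k \<in> {1..<3 * L + 1}" for k
    proof (cases "k \<le> m")
      case True
      thus ?thesis using back_pos_bound[of c \<zeta> m "m - k"] m by (auto simp: pos_def)
    next
      case False
      thus ?thesis using that by (auto simp: pos_def tent_def)
    qed
    have "walk x ` {1..<3 * L + 1} \<subseteq> (\<lambda>z. z - pos 0) ` {- int m..int L - int m}"
    proof (rule image_subsetI)
      fix k assume k: "k \<in> {1..<3 * L + 1}"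
      hence "walk x k = pos k - pos 0" by (intro w) simp
      thus "walk x k \<in> (\<lambda>z. z - pos 0) ` {- int m..int L - int m}" using bd[OF k] by (rule image_eqI)
    qed
    hence "card (walk x ` {1..<3 * L + 1}) \<le> card ((\<lambda>z. z - pos 0) ` {- int m..int L - int m})"
      by (intro card_mono) auto
    also have "\<dots> \<le> card {- int m..int L - int m}" by (rule card_image_le) simp
    finally show ?thesis by simp
  qed
  ultimately have sw: "(1 / 2) ^ (L + 1) \<le> site_weight {1..<3 * L + 1} (walk x) \<zeta>"
    unfolding site_weight_def by (simp only: if_True) (rule power_decreasing, auto)
  have un: "{1..<3 * L + 1} = {1..m} \<union> {m<..3 * L}" using m by auto
  have "step_weight p 0 {1..<3 * L + 1} x = step_weight p 0 {1..m} x * step_weight p 0 {m<..3 * L} x"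
    unfolding un by (rule step_weight_Un) auto
  also have "step_weight p 0 {m<..3 * L} x = p ^ (L - m) * (1 - p) ^ L * p ^ L"
    using legs_step_weight[OF legs, of p 0] m by (simp add: pmf_step_0[OF p01])
  finally have "step_weight p 0 {1..<3 * L + 1} x = step_weight p 0 {1..m} x * (p ^ (L - m) * (1 - p) ^ L * p ^ L)" .
  moreover have "(1 - p) ^ m \<le> step_weight p 0 {1..m} x"
  proof -
    have "(\<Prod>k\<in>{1..m}. 1 - p) \<le> step_weight p 0 {1..m} x"
      unfolding step_weight_def
    proof (rule prod_mono)
      fix k assume "k \<in> {1..m}"
      hence "x k = 1 \<or> x k = -1" using small by auto
      thus "0 \<le> 1 - p \<and> 1 - p \<le> pmf (step_pmf p 0) (x k)"
        using p pmf_step_0[OF p01] by auto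
    qed
    thus ?thesis by simp
  qed
  ultimately have "(1 - p) ^ m * (p ^ (L - m) * (1 - p) ^ L * p ^ L) \<le> step_weight p 0 {1..<3 * L + 1} x"
    using p by (simp add: mult_right_mono)
  hence "(1 - p) ^ m * (p ^ (L - m) * (1 - p) ^ L * p ^ L) * (1 / 2) ^ (L + 1) \<le> record_weight p 0 \<zeta> (3 * L + 1) x"
    unfolding record_weight_def using sw p by (intro mult_mono) auto
  also have "\<dots> \<le> partition_sum p 0 \<zeta> (3 * L + 1)"
    unfolding partition_sum_def using xp by (intro member_le_sum) auto
  finally show ?thesis .
qed

text \<open>The range is at least as large as a straight stretch: one leg, two equal consecutive
  legs, or all three. The first leg is shorter by \<open>m\<close>.\<close>

lemma legs_card_ge:
  assumes legs: "legs m L a b d x" and abd: "a \<noteq> 0" "b \<noteq> 0" "d \<noteq> 0" and m: "1 \<le> m" "2 * m \<le> L"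
  shows "L \<le> card (walk x ` {1..<3 * L + 1})"
    and "a = b \<or> b = d \<Longrightarrow> 2 * L - m \<le> card (walk x ` {1..<3 * L + 1})"
    and "a = b \<Longrightarrow> b = d \<Longrightarrow> 3 * L - m \<le> card (walk x ` {1..<3 * L + 1})"
proof -
  have seg: "j - i + 1 \<le> card (walk x ` {1..<3 * L + 1})"
    if "m \<le> i" "i \<le> j" "j \<le> 3 * L" "\<And>k. k \<in> {i<..j} \<Longrightarrow> leg L a b d k = s" "s \<noteq> 0" for i j s
  proof (rule card_walk_segment[where s = s])
    fix k assume k: "k \<in> {i<..j}"
    have "x k = leg L a b d k" using legs k that(1,3) by (auto simp: legs_def)
    thus "x k = s" using that(4)[OF k] by simp
  qed (use that m in auto)
  show "L \<le> card (walk x ` {1..<3 * L + 1})"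
    using seg[of L "2 * L" b] m abd by (simp add: leg_def)
  show "2 * L - m \<le> card (walk x ` {1..<3 * L + 1})" if ab: "a = b \<or> b = d"
    using ab
  proof
    assume "a = b"
    hence "leg L a b d k = b" if "k \<in> {m<..2 * L}" for k using that by (simp add: leg_def)
    from seg[of m "2 * L" b, OF _ _ _ this] show ?thesis using m abd by simp
  next
    assume "b = d"
    hence "leg L a b d k = b" if "k \<in> {L<..3 * L}" for k using that by (simp add: leg_def)
    from seg[of L "3 * L" b, OF _ _ _ this] show ?thesis using m abd by simp
  qed
  show "3 * L - m \<le> card (walk x ` {1..<3 * L + 1})" if "a = b" "b = d"
  proof -
    have "leg L a b d k = b" for k using that by (simp add: leg_def)
    from seg[of m "3 * L" b, OF _ _ _ this] show ?thesis using m abd by simp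
  qed
qed

text \<open>Collects the losses from the first \<open>m\<close> steps; it does not depend on
  \<open>L\<close>, so it is beaten by any geometric decay in \<open>L\<close>.\<close>

definition zigzag_const :: "real \<Rightarrow> nat \<Rightarrow> real" where
  "zigzag_const p m = 2 * (2 / (1 - p)\<^sup>2) ^ m"

context
  fixes p q :: real and m A L :: nat
  assumes q: "0 < q" "q \<le> p" "p \<le> 1" and L: "L = m + A"
begin

lemmas power_expand = power_add power_mult_distrib power_divide power_one power_one_right power2_eq_square

text \<open>Against the zigzag, the straight walk replaces \<open>q\<close> by \<open>p\<close> on
  the middle leg but visits about \<open>2 * L\<close> more sites, a factor
  \<open>p / (4 * q)\<close> per unit of \<open>L\<close>. With \<open>q = 1 - p\<close> this is
  below 1 exactly for \<open>p < 4/5\<close>.\<close>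

lemma ratio_straight:
  "p ^ (L - m) * p ^ L * p ^ L * (1 / 2) ^ (3 * L - m) \<le>
   2 * (2 / q\<^sup>2) ^ m * (p / (4 * q)) ^ L * (q ^ m * (p ^ (L - m) * q ^ L * p ^ L) * (1 / 2) ^ (L + 1))"
proof -
  \<comment> \<open>Naming the powers reduces the comparison to a rational identity.\<close>
  define X Y U V g h where "X = p ^ m" and "Y = q ^ m" and "U = p ^ A" and "V = q ^ A"
    and "g = (2 :: real) ^ m" and "h = (2 :: real) ^ A"
  note folds = X_def[symmetric] Y_def[symmetric] U_def[symmetric] V_def[symmetric]
    g_def[symmetric] h_def[symmetric]
  have four: "(4 :: real) ^ m = g * g" "(4 :: real) ^ A = h * h"
    by (simp_all add: g_def h_def flip: power_mult_distrib)
  have nz: "X \<noteq> 0" "Y \<noteq> 0" "U \<noteq> 0" "V \<noteq> 0" "g \<noteq> 0" "h \<noteq> 0"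
    using q by (auto simp: X_def Y_def U_def V_def g_def h_def)
  have e: "3 * L - m = m + m + A + A + A" "L - m = A" "L + 1 = m + A + 1" using L by auto
  have "p ^ (L - m) * p ^ L * p ^ L * (1 / 2) ^ (3 * L - m) =
      2 * (2 / q) ^ m * (p / (4 * q)) ^ L * (q ^ m * (p ^ (L - m) * q ^ L * p ^ L) * (1 / 2) ^ (L + 1))"
    using nz unfolding e unfolding L
    by (simp only: power_expand folds four) (simp add: field_simps)
  also have "\<dots> \<le> 2 * (2 / q\<^sup>2) ^ m * (p / (4 * q)) ^ L * (q ^ m * (p ^ (L - m) * q ^ L * p ^ L) * (1 / 2) ^ (L + 1))"
  proof (intro mult_right_mono mult_left_mono power_mono)
    have "q * q \<le> q * 1" using q by (intro mult_left_mono) auto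
    thus "2 / q \<le> 2 / q\<^sup>2" using q by (intro divide_left_mono) (auto simp: power2_eq_square)
  qed (use q in auto)
  finally show ?thesis .
qed

text \<open>One leg to the left, as in the zigzag, but about \<open>L\<close> more sites.\<close>

lemma ratio_other:
  "q ^ (L - m) * p ^ L * p ^ L * (1 / 2) ^ (2 * L - m) \<le>
   2 * (2 / q\<^sup>2) ^ m * (1 / 2) ^ L * (q ^ m * (p ^ (L - m) * q ^ L * p ^ L) * (1 / 2) ^ (L + 1))"
proof -
  define X Y U V g h where "X = p ^ m" and "Y = q ^ m" and "U = p ^ A" and "V = q ^ A"
    and "g = (2 :: real) ^ m" and "h = (2 :: real) ^ A"
  note folds = X_def[symmetric] Y_def[symmetric] U_def[symmetric] V_def[symmetric]
    g_def[symmetric] h_def[symmetric]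
  have four: "(4 :: real) ^ m = g * g" "(4 :: real) ^ A = h * h"
    by (simp_all add: g_def h_def flip: power_mult_distrib)
  have nz: "X \<noteq> 0" "Y \<noteq> 0" "U \<noteq> 0" "V \<noteq> 0" "g \<noteq> 0" "h \<noteq> 0"
    using q by (auto simp: X_def Y_def U_def V_def g_def h_def)
  have e: "2 * L - m = m + A + A" "L - m = A" "L + 1 = m + A + 1" using L by auto
  have "q ^ (L - m) * p ^ L * p ^ L * (1 / 2) ^ (2 * L - m) =
      p ^ m * (2 * (2 / q\<^sup>2) ^ m * (1 / 2) ^ L * (q ^ m * (p ^ (L - m) * q ^ L * p ^ L) * (1 / 2) ^ (L + 1)))"
    using nz unfolding e unfolding L
    by (simp only: power_expand folds four) (simp add: field_simps)
  also have "\<dots> \<le> 1 * (2 * (2 / q\<^sup>2) ^ m * (1 / 2) ^ L * (q ^ m * (p ^ (L - m) * q ^ L * p ^ L) * (1 / 2) ^ (L + 1)))"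
    using q by (intro mult_right_mono power_le_one) auto
  finally show ?thesis by simp
qed

text \<open>The range bound is about that of the zigzag, but two legs instead of one go
  left.\<close>

lemma ratio_mirror:
  "q ^ (L - m) * p ^ L * q ^ L * (1 / 2) ^ L \<le>
   2 * (2 / q\<^sup>2) ^ m * (q / p) ^ L * (q ^ m * (p ^ (L - m) * q ^ L * p ^ L) * (1 / 2) ^ (L + 1))"
proof -
  define X Y U V g h where "X = p ^ m" and "Y = q ^ m" and "U = p ^ A" and "V = q ^ A"
    and "g = (2 :: real) ^ m" and "h = (2 :: real) ^ A"
  note folds = X_def[symmetric] Y_def[symmetric] U_def[symmetric] V_def[symmetric]
    g_def[symmetric] h_def[symmetric]
  have four: "(4 :: real) ^ m = g * g" "(4 :: real) ^ A = h * h"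
    by (simp_all add: g_def h_def flip: power_mult_distrib)
  have nz: "X \<noteq> 0" "Y \<noteq> 0" "U \<noteq> 0" "V \<noteq> 0" "g \<noteq> 0" "h \<noteq> 0"
    using q by (auto simp: X_def Y_def U_def V_def g_def h_def)
  have e: "L - m = A" "L + 1 = m + A + 1" using L by auto
  have "q ^ (L - m) * p ^ L * q ^ L * (1 / 2) ^ L =
      p ^ m * (1 / 2) ^ m * (2 * (2 / q\<^sup>2) ^ m * (q / p) ^ L * (q ^ m * (p ^ (L - m) * q ^ L * p ^ L) * (1 / 2) ^ (L + 1)))"
    using nz unfolding e unfolding L
    by (simp only: power_expand folds four) (simp add: field_simps)
  also have "\<dots> \<le> 1 * (2 * (2 / q\<^sup>2) ^ m * (q / p) ^ L * (q ^ m * (p ^ (L - m) * q ^ L * p ^ L) * (1 / 2) ^ (L + 1)))"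
    using q by (intro mult_right_mono mult_le_one power_le_one) auto
  finally show ?thesis by simp
qed

end

definition alternating :: "nat \<Rightarrow> nat \<Rightarrow> (nat \<Rightarrow> int) \<Rightarrow> bool" where
  "alternating m L x \<longleftrightarrow> legs m L 1 (-1) 1 x \<or> legs m L (-1) 1 (-1) x"

text \<open>Each pattern is compared with the single path of \<open>zigzag_partition_ge\<close>.
  Patterns that miss a turn lose by their larger range, the mirror image by its two legs to the
  left.\<close>

lemma legs_bound:
  assumes p: "p \<in> {1/2..<1}" and m: "1 \<le> m" "2 * m \<le> L"
    and zz: "zigzag_record m L c \<zeta>" and c: "split_coloring c"
    and abd: "a \<in> {-1, 1}" "b \<in> {-1, 1}" "d \<in> {-1, 1}"
  shows "a = b \<or> b = d \<Longrightarrow>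
      (\<Sum>x | x \<in> paths {1..<3 * L + 1} \<and> legs m L a b d x. record_weight p 0 \<zeta> (3 * L + 1) x) \<le>
      zigzag_const p m * ((p / (4 * (1 - p))) ^ L + (1 / 2) ^ L) * partition_sum p 0 \<zeta> (3 * L + 1)"
    and "(\<Sum>x | x \<in> paths {1..<3 * L + 1} \<and> legs m L (-1) 1 (-1) x. record_weight p 0 \<zeta> (3 * L + 1) x) \<le>
      zigzag_const p m * ((1 - p) / p) ^ L * partition_sum p 0 \<zeta> (3 * L + 1)"
proof -
  define q where "q = 1 - p"
  define Z where "Z = partition_sum p 0 \<zeta> (3 * L + 1)"
  define lb where "lb = q ^ m * (p ^ (L - m) * q ^ L * p ^ L) * (1 / 2) ^ (L + 1)"
  define C where "C = 2 * (2 / q\<^sup>2) ^ m"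
  define w where "w = pmf (step_pmf p 0)"
  have p01: "p \<in> {0..1}" using p by auto
  have w: "w 1 = p" "w (-1) = q" using pmf_step_0[OF p01] by (simp_all add: w_def q_def)
  have q: "0 < q" "q \<le> p" "p \<le> 1" using p by (auto simp: q_def)
  have L: "L = m + (L - m)" using m by simp
  have C: "0 \<le> C" "zigzag_const p m = C" using q by (simp_all add: C_def zigzag_const_def q_def)
  have lb: "0 \<le> lb" "lb \<le> Z"
    unfolding lb_def Z_def q_def
    using zigzag_partition_ge[OF _ m zz c, of p] p by auto
  have wpos: "0 \<le> w s" for s by (simp add: w_def)
  have up: "(\<Sum>x | x \<in> paths {1..<3 * L + 1} \<and> legs m L a b d x. record_weight p 0 \<zeta> (3 * L + 1) x) \<le>
      w a ^ (L - m) * w b ^ L * w d ^ L * (1 / 2) ^ R"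
    if "\<And>x. x \<in> paths {1..<3 * L + 1} \<Longrightarrow> legs m L a b d x \<Longrightarrow> R \<le> card (walk x ` {1..<3 * L + 1})" for a b d R
    unfolding w_def using m by (intro legs_record_weight[OF p01 _ that]) auto
  show "(\<Sum>x | x \<in> paths {1..<3 * L + 1} \<and> legs m L (-1) 1 (-1) x. record_weight p 0 \<zeta> (3 * L + 1) x) \<le>
      zigzag_const p m * ((1 - p) / p) ^ L * partition_sum p 0 \<zeta> (3 * L + 1)"
  proof -
    have "(\<Sum>x | x \<in> paths {1..<3 * L + 1} \<and> legs m L (-1) 1 (-1) x. record_weight p 0 \<zeta> (3 * L + 1) x) \<le>
        w (-1) ^ (L - m) * w 1 ^ L * w (-1) ^ L * (1 / 2) ^ L"
      by (rule up[OF legs_card_ge(1)[OF _ _ _ _ m]]) auto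
    also have "\<dots> \<le> C * (q / p) ^ L * lb"
      unfolding w C_def lb_def by (rule ratio_mirror[OF q L])
    also have "\<dots> \<le> C * (q / p) ^ L * Z"
      using C q lb by (intro mult_left_mono) auto
    finally show ?thesis unfolding C Z_def q_def .
  qed
  assume ab: "a = b \<or> b = d"
  have "(\<Sum>x | x \<in> paths {1..<3 * L + 1} \<and> legs m L a b d x. record_weight p 0 \<zeta> (3 * L + 1) x) \<le>
      C * ((p / (4 * q)) ^ L + (1 / 2) ^ L) * lb"
  proof (cases "a = 1 \<and> b = 1 \<and> d = 1")
    case True
    hence "(\<Sum>x | x \<in> paths {1..<3 * L + 1} \<and> legs m L a b d x. record_weight p 0 \<zeta> (3 * L + 1) x) \<le>
        w a ^ (L - m) * w b ^ L * w d ^ L * (1 / 2) ^ (3 * L - m)"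
      by (intro up[OF legs_card_ge(3)[OF _ _ _ _ m]]) auto
    also have "\<dots> \<le> C * (p / (4 * q)) ^ L * lb"
      using True w ratio_straight[OF q L] by (simp add: C_def lb_def)
    also have "\<dots> \<le> C * ((p / (4 * q)) ^ L + (1 / 2) ^ L) * lb"
      using C lb by (intro mult_right_mono mult_left_mono) auto
    finally show ?thesis .
  next
    case False
    have "(\<Sum>x | x \<in> paths {1..<3 * L + 1} \<and> legs m L a b d x. record_weight p 0 \<zeta> (3 * L + 1) x) \<le>
        w a ^ (L - m) * w b ^ L * w d ^ L * (1 / 2) ^ (2 * L - m)"
      using ab abd by (intro up[OF legs_card_ge(2)[OF _ _ _ _ m]]) auto
    also have "\<dots> \<le> q ^ (L - m) * p ^ L * p ^ L * (1 / 2) ^ (2 * L - m)"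
    proof (rule mult_right_mono)
      have wle: "w s \<le> p" if "s \<in> {-1, 1}" for s using that w q by auto
      have qp: "q ^ L = q ^ (L - m) * q ^ m" "p ^ L = p ^ (L - m) * p ^ m"
        using L by (simp_all flip: power_add)
      \<comment> \<open>A leg to the left costs least in the first place, since that leg has only
        \<open>L - m\<close> prescribed steps.\<close>
      have mix: "p ^ (L - m) * q ^ L \<le> q ^ (L - m) * p ^ L"
        unfolding qp using q by (simp add: mult.left_commute mult_left_mono power_mono)
      show "w a ^ (L - m) * w b ^ L * w d ^ L \<le> q ^ (L - m) * p ^ L * p ^ L"
      proof (cases "a = -1")
        case True
        have "w b ^ L * w d ^ L \<le> p ^ L * p ^ L"
          using wle abd wpos q by (intro mult_mono power_mono) auto
        hence "q ^ (L - m) * (w b ^ L * w d ^ L) \<le> q ^ (L - m) * (p ^ L * p ^ L)"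
          using q by (intro mult_left_mono) auto
        thus ?thesis using True w by (simp add: mult.assoc)
      next
        case a: False
        have bd: "w b ^ L * w d ^ L \<le> q ^ L * p ^ L"
        proof (cases "b = -1")
          case True
          thus ?thesis using wle[of d] abd wpos w q by (auto intro!: mult_left_mono power_mono)
        next
          case b: False
          hence "d = -1" using False a abd by auto
          thus ?thesis using b w abd by auto
        qed
        have "p ^ (L - m) * (w b ^ L * w d ^ L) \<le> p ^ (L - m) * (q ^ L * p ^ L)"
          using bd q by (intro mult_left_mono) auto
        also have "\<dots> = (p ^ (L - m) * q ^ L) * p ^ L" by simp
        also have "\<dots> \<le> (q ^ (L - m) * p ^ L) * p ^ L"
          using mix q by (intro mult_right_mono) auto
        finally show ?thesis using a abd w by (auto simp: mult.assoc)
      qed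
    qed simp
    also have "\<dots> \<le> C * (1 / 2) ^ L * lb"
      unfolding C_def lb_def by (rule ratio_other[OF q L])
    also have "\<dots> \<le> C * ((p / (4 * q)) ^ L + (1 / 2) ^ L) * lb"
      using C lb q by (intro mult_right_mono mult_left_mono) auto
    finally show ?thesis .
  qed
  also have "\<dots> \<le> C * ((p / (4 * q)) ^ L + (1 / 2) ^ L) * Z"
    using C q lb by (intro mult_left_mono) auto
  finally show "(\<Sum>x | x \<in> paths {1..<3 * L + 1} \<and> legs m L a b d x. record_weight p 0 \<zeta> (3 * L + 1) x) \<le>
      zigzag_const p m * ((p / (4 * (1 - p))) ^ L + (1 / 2) ^ L) * partition_sum p 0 \<zeta> (3 * L + 1)"
    unfolding C Z_def q_def .
qed

text \<open>By \<open>zigzag_legs\<close> a path of positive weight follows some sign pattern, and a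
  pattern that does not alternate has two equal consecutive legs. The factor 8 counts all sign
  patterns.\<close>

lemma not_alternating_bound:
  assumes p: "p \<in> {1/2..<1}" and m: "1 \<le> m" "2 * m \<le> L"
    and zz: "zigzag_record m L c \<zeta>" and c: "split_coloring c"
  shows "(\<Sum>x | x \<in> paths {1..<3 * L + 1} \<and> \<not> alternating m L x. record_weight p 0 \<zeta> (3 * L + 1) x) \<le>
    8 * zigzag_const p m * ((p / (4 * (1 - p))) ^ L + (1 / 2) ^ L) * partition_sum p 0 \<zeta> (3 * L + 1)"
proof -
  define P where "P = paths {1..<3 * L + 1}"
  define r where "r = record_weight p 0 \<zeta> (3 * L + 1)"
  define S :: "(int \<times> int \<times> int) set" where
    "S = {(a, b, d). a \<in> {-1, 1} \<and> b \<in> {-1, 1} \<and> d \<in> {-1, 1} \<and> (a = b \<or> b = d)}"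
  define Q where "Q = (\<lambda>(a, b, d). {x \<in> P. legs m L a b d x})"
  define K where "K = zigzag_const p m * ((p / (4 * (1 - p))) ^ L + (1 / 2) ^ L) * partition_sum p 0 \<zeta> (3 * L + 1)"
  have p01: "p \<in> {0..1}" using p by auto
  have Ssub: "S \<subseteq> {-1, 1} \<times> {-1, 1} \<times> {-1, 1}" by (auto simp: S_def)
  have finS: "finite S" by (rule finite_subset[OF Ssub]) simp
  have "card S \<le> card ({-1, 1} \<times> {-1, 1} \<times> {-1, 1 :: int} :: (int \<times> int \<times> int) set)"
    by (rule card_mono[OF _ Ssub]) simp
  hence cardS: "card S \<le> 8" by (simp add: card_cartesian_product)
  have "(\<Sum>x | x \<in> P \<and> \<not> alternating m L x. r x) = (\<Sum>x | x \<in> P \<and> \<not> alternating m L x \<and> r x \<noteq> 0. r x)"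
    by (rule sum.mono_neutral_right) (auto simp: P_def)
  also have "\<dots> \<le> sum r (\<Union>t\<in>S. Q t)"
  proof (rule sum_mono2)
    show "{x \<in> P. \<not> alternating m L x \<and> r x \<noteq> 0} \<subseteq> (\<Union>t\<in>S. Q t)"
    proof
      fix x assume x: "x \<in> {x \<in> P. \<not> alternating m L x \<and> r x \<noteq> 0}"
      then obtain a b d where abd: "a \<in> {-1, 1}" "b \<in> {-1, 1}" "d \<in> {-1, 1}" "legs m L a b d x"
        using zigzag_legs[OF m(1) _ _ p01 zz c, of x] m by (auto simp: P_def r_def)
      hence "a = b \<or> b = d" using x by (auto simp: alternating_def)
      thus "x \<in> (\<Union>t\<in>S. Q t)" using abd x by (auto simp: S_def Q_def intro!: bexI[of _ "(a, b, d)"])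
    qed
    show "finite (\<Union>t\<in>S. Q t)" using finS by (auto simp: Q_def P_def)
  qed (auto simp: r_def)
  also have "\<dots> \<le> (\<Sum>t\<in>S. sum r (Q t))"
    by (rule sum_UN_le[OF finS]) (auto simp: Q_def P_def r_def)
  also have "\<dots> \<le> (\<Sum>t\<in>S. K)"
  proof (rule sum_mono)
    fix t assume "t \<in> S"
    then obtain a b d where t: "t = (a, b, d)" "a \<in> {-1, 1}" "b \<in> {-1, 1}" "d \<in> {-1, 1}" "a = b \<or> b = d"
      by (auto simp: S_def)
    show "sum r (Q t) \<le> K"
      using legs_bound(1)[OF p m zz c t(2-5)] by (simp add: t(1) Q_def P_def r_def K_def)
  qed
  also have "\<dots> \<le> 8 * K"
  proof -
    have "0 \<le> partition_sum p 0 \<zeta> (3 * L + 1)" by (simp add: partition_sum_def sum_nonneg)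
    hence "0 \<le> K" using p by (simp add: K_def zigzag_const_def)
    thus ?thesis using cardS by (simp add: mult_right_mono)
  qed
  finally show ?thesis by (simp add: P_def r_def K_def mult.assoc)
qed

section \<open>The conditional law of \<open>Y 0\<close> under zigzag extensions\<close>

lemma legs_fun_upd: "1 \<le> m \<Longrightarrow> legs m L a b d (x(1 := s)) \<longleftrightarrow> legs m L a b d x"
  by (auto simp: legs_def)

lemma zigzag_partition_pos:
  assumes "p \<in> {1/2..<1}"
  shows "0 < partition_sum p 0 \<zeta> n"
  using assms pmf_step_0(1)[of p] by (intro partition_sum_pos) auto

text \<open>On the zigzag both neighbours of \<open>S 1\<close> are seen, and the colour of the left
  one decides between \<open>p\<close> and \<open>1 - p\<close>. The two error terms account for
  paths that miss a turn and for the mirror image; the latter vanishes for large \<open>L\<close>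
  only if \<open>p > 1/2\<close>.\<close>

lemma cond_black_zigzag:
  assumes p: "p \<in> {1/2..<1}" and m: "1 \<le> m" "2 * m \<le> L"
    and zz: "zigzag_record m L c \<zeta>" and c: "split_coloring c"
  shows "\<bar>cond_black p 0 \<zeta> (3 * L + 1) - (if c (back_pos c \<zeta> m (m - 1) - 1) = Black then p else 1 - p)\<bar> \<le>
    8 * zigzag_const p m * ((p / (4 * (1 - p))) ^ L + (1 / 2) ^ L) + zigzag_const p m * ((1 - p) / p) ^ L"
proof -
  define b where "b = back_pos c \<zeta> m (m - 1)"
  define v where "v = (if c (b - 1) = Black then p else 1 - p)"
  define r where "r = record_weight p 0 \<zeta> (3 * L + 1)"
  define Z where "Z = partition_sum p 0 \<zeta> (3 * L + 1)"
  define P where "P = paths {1..<3 * L + 1}"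
  have p01: "p \<in> {0..1}" using p by auto
  have Z: "0 < Z" unfolding Z_def by (rule zigzag_partition_pos[OF p])
  have "(\<Sum>x | x \<in> P \<and> legs m L 1 (-1) 1 x. black_weight p 0 \<zeta> (3 * L + 1) x) =
      v * (\<Sum>x | x \<in> P \<and> legs m L 1 (-1) 1 x. r x)"
    unfolding v_def P_def r_def
  proof (rule black_weight_neighbours[where b = "c (b + 1)"])
    show "c (b - 1) \<noteq> c (b + 1)" by (rule split_coloring_nbrs[OF c])
  qed (use p01 m legs_alt_neighbours[OF _ p01 _ _ _ m zz c, of _ 1] in \<open>auto simp: legs_fun_upd[unfolded One_nat_def] b_def\<close>)
  hence first: "\<bar>cond_black p 0 \<zeta> (3 * L + 1) - v\<bar> \<le> (\<Sum>x | x \<in> P \<and> \<not> legs m L 1 (-1) 1 x. r x) / Z"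
    using Z p unfolding P_def r_def Z_def by (intro cond_black_approx) (auto simp: v_def)
  have "(\<Sum>x | x \<in> P \<and> \<not> legs m L 1 (-1) 1 x. r x) \<le>
      (\<Sum>x\<in>{x \<in> P. \<not> alternating m L x} \<union> {x \<in> P. legs m L (-1) 1 (-1) x}. r x)"
    by (rule sum_mono2) (auto simp: P_def r_def alternating_def)
  also have "\<dots> \<le> (\<Sum>x | x \<in> P \<and> \<not> alternating m L x. r x) + (\<Sum>x | x \<in> P \<and> legs m L (-1) 1 (-1) x. r x)"
    by (subst sum_Un) (auto simp: P_def r_def intro!: sum_nonneg)
  also have "\<dots> \<le> 8 * zigzag_const p m * ((p / (4 * (1 - p))) ^ L + (1 / 2) ^ L) * Z + zigzag_const p m * ((1 - p) / p) ^ L * Z"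
    unfolding P_def r_def Z_def
    by (intro add_mono not_alternating_bound[OF p m zz c] legs_bound(2)[OF p m zz c, of 1 1 1]) auto
  finally have "(\<Sum>x | x \<in> P \<and> \<not> legs m L 1 (-1) 1 x. r x) / Z \<le>
      8 * zigzag_const p m * ((p / (4 * (1 - p))) ^ L + (1 / 2) ^ L) + zigzag_const p m * ((1 - p) / p) ^ L"
    using Z by (simp add: divide_le_eq distrib_right)
  with first show ?thesis by (simp add: v_def b_def)
qed

text \<open>Changing the first step translates all sites from time 1 on.\<close>

lemma colored_at_fun_upd:
  assumes "1 \<le> n"
  shows "colored_at \<eta> n (x(1 := s)) (walk (x(1 := s)) 1 + z) a \<longleftrightarrow> colored_at \<eta> n x (walk x 1 + z) a"
proof -
  have "walk (x(1 := s)) k - walk (x(1 := s)) 1 = walk x k - walk x 1" if "1 \<le> k" for k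
    using walk_split[OF that, of "x(1 := s)"] walk_split[OF that, of x] by simp
  hence "walk (x(1 := s)) i = walk (x(1 := s)) 1 + z \<longleftrightarrow> walk x i = walk x 1 + z" if "i \<in> {1..<n}" for i
    using that by (metis add_diff_cancel_left' atLeastLessThan_iff diff_add_cancel add.commute)
  thus ?thesis by (auto simp: colored_at_def)
qed

lemma colored_at_inj:
  assumes con: "consistent {1..<n} (walk x) \<eta>" and "colored_at \<eta> n x z a" "colored_at \<eta> n x z b"
  shows "a = b"
proof -
  obtain i k where i: "i \<in> {1..<n}" "walk x i = z" "\<eta> i = a" and k: "k \<in> {1..<n}" "walk x k = z" "\<eta> k = b"
    using assms(2,3) unfolding colored_at_def by blast
  show ?thesis using consistentD[OF con i(1) k(1)] i k by simp
qed

text \<open>For \<open>p = 1/2\<close> it does not matter which neighbour has which colour.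
  Splitting by the colour of the left neighbour reduces the claim to
  \<open>black_weight_neighbours\<close>, and both classes give 1/2.\<close>

lemma black_weight_half:
  assumes n: "2 \<le> n" and E: "\<And>x s. E (x(1 := s)) \<longleftrightarrow> E x"
    and col: "\<And>x. x \<in> paths {1..<n} \<Longrightarrow> E x \<Longrightarrow> record_weight (1/2) 0 \<eta> n x \<noteq> 0 \<Longrightarrow>
      \<exists>a b. a \<noteq> b \<and> colored_at \<eta> n x (walk x 1 - 1) a \<and> colored_at \<eta> n x (walk x 1 + 1) b"
  shows "(\<Sum>x | x \<in> paths {1..<n} \<and> E x. black_weight (1/2) 0 \<eta> n x) =
    1 / 2 * (\<Sum>x | x \<in> paths {1..<n} \<and> E x. record_weight (1/2) 0 \<eta> n x)"
proof -
  define P where "P = paths {1..<n}"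
  define E' where "E' = (\<lambda>a x. E x \<and> colored_at \<eta> n x (walk x 1 - 1) a)"
  have h: "(1 / 2 :: real) \<in> {0..1}" by simp
  have part: "(\<Sum>x | x \<in> P \<and> E' a x. black_weight (1/2) 0 \<eta> n x) =
      1 / 2 * (\<Sum>x | x \<in> P \<and> E' a x. record_weight (1/2) 0 \<eta> n x)" for a
  proof -
    obtain b :: color where b: "a \<noteq> b" by (cases a) auto
    have "(\<Sum>x | x \<in> P \<and> E' a x. black_weight (1/2) 0 \<eta> n x) =
      (if a = Black then 1 / 2 else 1 - 1 / 2) * (\<Sum>x | x \<in> P \<and> E' a x. record_weight (1/2) 0 \<eta> n x)"
      unfolding P_def
    proof (rule black_weight_neighbours[OF n _ h _ b])
      show "E' a (x(1 := s)) \<longleftrightarrow> E' a x" for x s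
        using colored_at_fun_upd[of n \<eta> x s "-1" a] n E[of x s] by (simp add: E'_def)
      fix x assume x: "x \<in> paths {1..<n}" "E' a x" "record_weight (1/2) 0 \<eta> n x \<noteq> 0"
      obtain a' b' where ab: "a' \<noteq> b'" "colored_at \<eta> n x (walk x 1 - 1) a'" "colored_at \<eta> n x (walk x 1 + 1) b'"
        using col[OF x(1) _ x(3)] x(2) unfolding E'_def by blast
      note con = record_weight_nonzeroD(1)[OF x(1,3) h]
      have "a' = a" using x(2) ab(2) colored_at_inj[OF con] unfolding E'_def by blast
      hence "b' = b" using ab(1) b color_eq_cases[of b' a b] by auto
      thus "colored_at \<eta> n x (walk x 1 - 1) a \<and> colored_at \<eta> n x (walk x 1 + 1) b"
        using ab x(2) by (simp add: E'_def)
    qed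
    thus ?thesis by simp
  qed
  have split: "(\<Sum>x | x \<in> P \<and> E x. f x) = (\<Sum>x | x \<in> P \<and> E' Black x. f x) + (\<Sum>x | x \<in> P \<and> E' White x. f x)"
    if f: "\<And>x. record_weight (1/2) 0 \<eta> n x = 0 \<Longrightarrow> f x = 0" for f :: "_ \<Rightarrow> real"
  proof -
    define Q where "Q a = {x \<in> P. E' a x \<and> record_weight (1/2) 0 \<eta> n x \<noteq> 0}" for a
    have nz: "(\<Sum>x | x \<in> P \<and> E' a x. f x) = sum f (Q a)" for a
      using f by (intro sum.mono_neutral_right) (auto simp: P_def Q_def)
    have "Q Black \<inter> Q White = {}"
    proof -
      have False if x: "x \<in> Q Black" "x \<in> Q White" for x
      proof -
        have "consistent {1..<n} (walk x) \<eta>"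
          using x by (intro record_weight_nonzeroD(1)[OF _ _ h]) (auto simp: Q_def P_def)
        from colored_at_inj[OF this, of "walk x 1 - 1" Black White] show False
          using x by (simp add: Q_def E'_def)
      qed
      thus ?thesis by blast
    qed
    moreover have "(\<Sum>x | x \<in> P \<and> E x. f x) = sum f (Q Black \<union> Q White)"
    proof (rule sum.mono_neutral_right)
      show "\<forall>x\<in>{x \<in> P. E x} - (Q Black \<union> Q White). f x = 0"
      proof
        fix x assume x: "x \<in> {x \<in> P. E x} - (Q Black \<union> Q White)"
        have "record_weight (1/2) 0 \<eta> n x = 0"
        proof (rule ccontr)
          assume nz: "record_weight (1/2) 0 \<eta> n x \<noteq> 0"
          then obtain a where "colored_at \<eta> n x (walk x 1 - 1) a"
            using col[of x] x by (auto simp: P_def)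
          thus False using x nz by (cases a) (auto simp: Q_def E'_def)
        qed
        thus "f x = 0" by (rule f)
      qed
    qed (auto simp: P_def Q_def E'_def)
    ultimately show ?thesis unfolding nz by (simp add: sum.union_disjoint P_def Q_def)
  qed
  have "black_weight (1/2) 0 \<eta> n x = 0" if "record_weight (1/2) 0 \<eta> n x = 0" for x
    using that black_weight_le[of "1/2" 0 \<eta> n x] black_weight_nonneg[of "1/2" 0 \<eta> n x] by simp
  thus ?thesis
    using split[of "black_weight (1/2) 0 \<eta> n"] split[of "record_weight (1/2) 0 \<eta> n"] part[of Black] part[of White]
    by (simp add: P_def)
qed

text \<open>The mirror image is as likely as the zigzag when \<open>p = 1/2\<close>, but it reveals
  both neighbours of \<open>S 1\<close> too, so only paths that miss a turn count as error.\<close>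

lemma cond_black_zigzag_half:
  assumes m: "1 \<le> m" "2 * m \<le> L" and zz: "zigzag_record m L c \<zeta>" and c: "split_coloring c"
  shows "\<bar>cond_black (1/2) 0 \<zeta> (3 * L + 1) - 1 / 2\<bar> \<le>
    8 * zigzag_const (1/2) m * ((1 / 4) ^ L + (1 / 2) ^ L)"
proof -
  define P where "P = paths {1..<3 * L + 1}"
  define Z where "Z = partition_sum (1/2) 0 \<zeta> (3 * L + 1)"
  have h: "(1 / 2 :: real) \<in> {1/2..<1}" "(1 / 2 :: real) \<in> {0..1}" by simp_all
  have Z: "0 < Z" unfolding Z_def by (rule zigzag_partition_pos[OF h(1)])
  have "(\<Sum>x | x \<in> P \<and> alternating m L x. black_weight (1/2) 0 \<zeta> (3 * L + 1) x) =
      1 / 2 * (\<Sum>x | x \<in> P \<and> alternating m L x. record_weight (1/2) 0 \<zeta> (3 * L + 1) x)"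
    unfolding P_def
  proof (rule black_weight_half)
    fix x assume x: "x \<in> paths {1..<3 * L + 1}" "alternating m L x" "record_weight (1/2) 0 \<zeta> (3 * L + 1) x \<noteq> 0"
    define b where "b = back_pos c \<zeta> m (m - 1)"
    obtain s where s: "s = 1 \<or> s = -1" "legs m L s (- s) s x"
      using x(2) that[of 1] that[of "-1"] by (auto simp: alternating_def)
    have "c (b - s) \<noteq> c (b + s)" using s(1) split_coloring_nbrs[OF c, of b] by auto
    thus "\<exists>a b. a \<noteq> b \<and> colored_at \<zeta> (3 * L + 1) x (walk x 1 - 1) a \<and> colored_at \<zeta> (3 * L + 1) x (walk x 1 + 1) b"
      using legs_alt_neighbours[OF x(1) h(2) x(3) s(2,1) m zz c] unfolding b_def by blast
  qed (use m in \<open>auto simp: alternating_def legs_fun_upd[unfolded One_nat_def]\<close>)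
  hence "\<bar>cond_black (1/2) 0 \<zeta> (3 * L + 1) - 1 / 2\<bar> \<le>
      (\<Sum>x | x \<in> P \<and> \<not> alternating m L x. record_weight (1/2) 0 \<zeta> (3 * L + 1) x) / Z"
    using Z unfolding P_def Z_def by (intro cond_black_approx) auto
  also have "\<dots> \<le> 8 * zigzag_const (1/2) m * ((1 / 4) ^ L + (1 / 2) ^ L) * Z / Z"
    using not_alternating_bound[OF h(1) m zz c] Z
    by (intro divide_right_mono) (auto simp: P_def Z_def)
  finally show ?thesis using Z by simp
qed

section \<open>Bad configurations from zigzag extensions\<close>

lemma back_pos_cong:
  assumes "\<And>k. 1 \<le> k \<Longrightarrow> k \<le> m \<Longrightarrow> \<zeta> k = \<eta> k" "i < m"
  shows "back_pos c \<zeta> m i = back_pos c \<eta> m i"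
  using assms(2) by (induction i) (auto simp: assms(1))

lemma ex_split_coloring: "\<exists>c. split_coloring c \<and> c 0 = a"
proof -
  obtain b :: color where b: "b \<noteq> a" by (cases a) auto
  define c where "c = (\<lambda>z :: int. if z mod 4 = 0 \<or> z mod 4 = 1 then a else b)"
  have "(z + 2) mod 4 = 0 \<or> (z + 2) mod 4 = 1 \<longleftrightarrow> \<not> (z mod 4 = 0 \<or> z mod 4 = 1)" for z :: int
    by presburger
  hence "split_coloring c" using b by (auto simp: split_coloring_def c_def)
  moreover have "c 0 = a" by (simp add: c_def)
  ultimately show ?thesis by blast
qed

lemma split_coloring_reflect: "split_coloring c \<Longrightarrow> split_coloring (\<lambda>z. c (- z))"
  unfolding split_coloring_def
proof
  fix z assume "\<forall>z. c (z + 2) \<noteq> c z"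
  from spec[OF this, of "- (z + 2)"] show "c (- (z + 2)) \<noteq> c (- z)" by simp
qed

text \<open>The condition \<open>c 0 = \<eta> m\<close> makes the given configuration and the zigzag
  agree at the time \<open>m\<close> where they meet.\<close>

lemma ex_zigzag_record:
  assumes "1 \<le> m" "m \<le> L" "c 0 = \<eta> m"
  shows "\<exists>\<zeta>\<in>configs. (\<forall>k. 1 \<le> k \<longrightarrow> k \<le> m \<longrightarrow> \<zeta> k = \<eta> k) \<and> zigzag_record m L c \<zeta>"
proof -
  define \<zeta> where "\<zeta> = restrict (\<lambda>k. if k \<le> m then \<eta> k else c (tent L k - int m)) {1..}"
  have "\<zeta> \<in> configs" by (simp add: configs_def \<zeta>_def)
  moreover have "zigzag_record m L c \<zeta>"
    using assms by (auto simp: zigzag_record_def \<zeta>_def tent_def le_antisym)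
  ultimately show ?thesis by (intro bexI[of _ \<zeta>]) (auto simp: \<zeta>_def)
qed

text \<open>The bases are below 1 because \<open>p < 4/5\<close> and \<open>p > 1/2\<close>,
  respectively.\<close>

lemma zigzag_error_small:
  fixes p C :: real
  assumes p: "p \<in> {1/2<..<4/5}" and "0 < \<delta>"
  shows "\<exists>L\<ge>L0. 8 * C * ((p / (4 * (1 - p))) ^ L + (1 / 2) ^ L) + C * ((1 - p) / p) ^ L < \<delta>"
proof -
  have "(\<lambda>L. 8 * C * ((p / (4 * (1 - p))) ^ L + (1 / 2) ^ L) + C * ((1 - p) / p) ^ L)
      \<longlonglongrightarrow> 8 * C * (0 + 0) + C * 0"
    using p by (intro tendsto_intros LIMSEQ_power_zero) auto
  hence "\<forall>\<^sub>F L in sequentially. 8 * C * ((p / (4 * (1 - p))) ^ L + (1 / 2) ^ L) + C * ((1 - p) / p) ^ L < \<delta>"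
    using assms(2) by (intro order_tendstoD) auto
  thus ?thesis
    unfolding eventually_sequentially by (metis le_cases)
qed

text \<open>The two extensions reflect the scenery, which swaps the colours of the two neighbours of \<open>S 1\<close>.\<close>

lemma bad_config_all:
  assumes p: "p \<in> {1/2<..<4/5}"
  shows "bad_config p 0 \<eta>"
  unfolding bad_config_def
\<comment> \<open>The two limits \<open>p\<close> and \<open>1 - p\<close> are
  \<open>2 * p - 1\<close> apart. Two extensions within a quarter of that of their limits differ by
  at least half of it, so \<open>\<eta>\<close> is a quarter away from one of them.\<close>
proof (intro exI[of _ "(2 * p - 1) / 4"] conjI allI impI)
  show "0 < (2 * p - 1) / 4" using p by simp
  fix m :: nat assume m: "1 \<le> m"
  have p': "p \<in> {1/2..<1}" using p by auto
  obtain c where c: "split_coloring c" "c 0 = \<eta> m" using ex_split_coloring by blast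
  define c' where "c' = (\<lambda>z. c (- z))"
  have c': "split_coloring c'" "c' 0 = \<eta> m"
    using split_coloring_reflect[OF c(1)] c(2) by (simp_all add: c'_def)
  obtain L where L: "2 * m \<le> L" and err: "8 * zigzag_const p m * ((p / (4 * (1 - p))) ^ L + (1 / 2) ^ L) +
      zigzag_const p m * ((1 - p) / p) ^ L < (2 * p - 1) / 4"
    using zigzag_error_small[OF p, of "(2 * p - 1) / 4" "2 * m"] p by auto
  have mL: "m \<le> L" using L by simp
  obtain \<zeta> where \<zeta>: "\<zeta> \<in> configs" "\<And>k. 1 \<le> k \<Longrightarrow> k \<le> m \<Longrightarrow> \<zeta> k = \<eta> k" "zigzag_record m L c \<zeta>"
    using ex_zigzag_record[of m L c \<eta>, OF m mL c(2)] by blast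
  obtain \<zeta>' where \<zeta>': "\<zeta>' \<in> configs" "\<And>k. 1 \<le> k \<Longrightarrow> k \<le> m \<Longrightarrow> \<zeta>' k = \<eta> k" "zigzag_record m L c' \<zeta>'"
    using ex_zigzag_record[of m L c' \<eta>, OF m mL c'(2)] by blast
  define b where "b = back_pos c \<eta> m (m - 1)"
  have b: "back_pos c \<zeta> m (m - 1) = b" "back_pos c' \<zeta>' m (m - 1) = - b"
    using back_pos_cong[of m \<zeta> \<eta> "m - 1" c] back_pos_cong[of m \<zeta>' \<eta> "m - 1" c'] \<zeta>(2) \<zeta>'(2) m
      back_pos_reflect[OF c(1), of \<eta> m "m - 1"] by (simp_all add: b_def c'_def)
  define v v' where "v = (if c (b - 1) = Black then p else 1 - p)" and "v' = (if c (b + 1) = Black then p else 1 - p)"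
  \<comment> \<open>In the reflected scenery \<open>S 1\<close> sits at \<open>- b\<close>, and its
    left neighbour has the colour that the right neighbour of \<open>b\<close> has in
    \<open>c\<close>.\<close>
  have "c' (- b - 1) = c (b + 1)" by (simp add: c'_def add.commute)
  hence near: "\<bar>cond_black p 0 \<zeta> (3 * L + 1) - v\<bar> < (2 * p - 1) / 4" "\<bar>cond_black p 0 \<zeta>' (3 * L + 1) - v'\<bar> < (2 * p - 1) / 4"
    using cond_black_zigzag[OF p' m L \<zeta>(3) c(1)] cond_black_zigzag[OF p' m L \<zeta>'(3) c'(1)] err
    unfolding b v_def v'_def by simp_all
  have "c (b - 1) \<noteq> c (b + 1)" by (rule split_coloring_nbrs[OF c(1)])
  hence "\<bar>v - v'\<bar> = 2 * p - 1"
    unfolding v_def v'_def using p by (cases "c (b - 1)"; cases "c (b + 1)") auto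
  hence "(2 * p - 1) / 4 \<le> \<bar>cond_black p 0 \<eta> (3 * L + 1) - cond_black p 0 \<zeta> (3 * L + 1)\<bar> \<or>
      (2 * p - 1) / 4 \<le> \<bar>cond_black p 0 \<eta> (3 * L + 1) - cond_black p 0 \<zeta>' (3 * L + 1)\<bar>"
    using near by (auto simp: abs_if field_simps split: if_splits)
  then obtain \<xi> where "\<xi> \<in> {\<zeta>, \<zeta>'}"
    "(2 * p - 1) / 4 \<le> \<bar>cond_black p 0 \<eta> (3 * L + 1) - cond_black p 0 \<xi> (3 * L + 1)\<bar>"
    by blast
  moreover have "m < 3 * L + 1" using mL by simp
  ultimately show "\<exists>n>m. \<exists>\<zeta>\<in>configs. (\<forall>k\<in>{0<..<m}. \<zeta> k = \<eta> k) \<and>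
      (2 * p - 1) / 4 \<le> \<bar>cond_black p 0 \<eta> n - cond_black p 0 \<zeta> n\<bar>"
    using \<zeta>(1,2) \<zeta>'(1,2)
    by (intro exI[of _ "3 * L + 1"] conjI bexI[of _ \<xi>]) auto
qed

text \<open>Including time 0 costs at most one new site, hence a factor 1/2, and nothing if the walk
  is back at the origin at time 2. The latter has conditional probability 1/2, and 1/2 + 1/4 =
  3/4.\<close>

lemma cond_black_all_black:
  assumes n: "3 \<le> n" and \<eta>: "\<And>k. 1 \<le> k \<Longrightarrow> \<eta> k = Black"
  shows "3 / 4 \<le> cond_black (1/2) 0 \<eta> n"
proof -
  define P where "P = paths {1..<n}"
  define r where "r = record_weight (1/2) 0 \<eta> n"
  define Z where "Z = partition_sum (1/2) 0 \<eta> n"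
  have h: "(1 / 2 :: real) \<in> {1/2..<1}" "(1 / 2 :: real) \<in> {0..1}" by simp_all
  have Z: "0 < Z" unfolding Z_def by (rule zigzag_partition_pos[OF h(1)])
  have ge: "r x / 2 \<le> black_weight (1/2) 0 \<eta> n x" for x
  proof -
    have "consistent {..<n} (walk x) (\<eta>(0 := Black))" "consistent {1..<n} (walk x) \<eta>"
      using \<eta> by (auto simp: consistent_def)
    moreover have "card (walk x ` {..<n}) \<le> card (walk x ` {1..<n}) + 1"
    proof -
      have "walk x ` {..<n} \<subseteq> insert (walk x 0) (walk x ` {1..<n})"
      proof (rule image_subsetI)
        fix k assume "k \<in> {..<n}"
        thus "walk x k \<in> insert (walk x 0) (walk x ` {1..<n})" by (cases "k = 0") auto
      qed
      hence "card (walk x ` {..<n}) \<le> card (insert (walk x 0) (walk x ` {1..<n}))"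
        by (intro card_mono) auto
      thus ?thesis by (simp add: card_insert_if split: if_splits)
    qed
    hence "(1 / 2 :: real) ^ (card (walk x ` {1..<n}) + 1) \<le> (1 / 2) ^ card (walk x ` {..<n})"
      by (intro power_decreasing) auto
    ultimately have "site_weight {1..<n} (walk x) \<eta> / 2 \<le> site_weight {..<n} (walk x) (\<eta>(0 := Black))"
      by (simp add: site_weight_def)
    thus ?thesis
      unfolding r_def record_weight_def black_weight_def
      by (subst times_divide_eq_right[symmetric], rule mult_left_mono) simp_all
  qed
  have ret: "black_weight (1/2) 0 \<eta> n x = r x" if "x 1 = - x 2" for x
  proof -
    have "walk x 2 = 0" using that by (simp add: walk_def numeral_2_eq_2)
    thus ?thesis using black_weight_known[of 2 n x "1/2" 0 \<eta>] n \<eta> by (simp add: r_def)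
  qed
  have bw: "r x / 2 + (if x 1 = - x 2 then r x / 2 else 0) \<le> black_weight (1/2) 0 \<eta> n x" for x
    using ge[of x] ret[of x] by auto
  have half: "(\<Sum>x | x \<in> P \<and> x 1 = - x 2. r x) = Z / 2"
  proof -
    \<comment> \<open>\<open>X 1\<close> is independent of the record and of \<open>X 2\<close>, so
      \<open>X 1 = - X 2\<close> keeps probability 1/2 given both.\<close>
    have a: "(\<Sum>x | x \<in> P \<and> x 2 = s. r x * (if x 1 = - s then 1 else 0)) =
        1 / 2 * (\<Sum>x | x \<in> P \<and> x 2 = s. r x)" if s: "s \<in> {-1, 1}" for s
    proof -
      have "(\<Sum>x | x \<in> P \<and> x 2 = s. r x * (if x 1 = - s then 1 else 0)) =
        (\<Sum>t\<in>{-1, 0, 1}. pmf (step_pmf (1/2) 0) t * (if t = - s then 1 else 0)) * (\<Sum>x | x \<in> P \<and> x 2 = s. r x)"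
        unfolding P_def r_def using n h by (intro sum_first_step_factor) auto
      also have "(\<Sum>t\<in>{-1, 0, 1}. pmf (step_pmf (1/2) 0) t * (if t = - s then 1 else 0)) = 1 / 2"
        using s pmf_step_0[OF h(2)] by auto
      finally show ?thesis .
    qed
    have z: "r x = 0" if "x \<in> P" "x 2 \<notin> {-1, 1}" for x
      using record_weight_nonzeroD(2)[of x n "1/2" \<eta> 2] that n by (auto simp: P_def r_def)
    have sp: "(\<Sum>x\<in>P. f x) = (\<Sum>x | x \<in> P \<and> x 2 = -1. f x) + (\<Sum>x | x \<in> P \<and> x 2 = 1. f x)"
      if "\<And>x. x \<in> P \<Longrightarrow> x 2 \<notin> {-1, 1} \<Longrightarrow> f x = 0" for f :: "_ \<Rightarrow> real"
    proof -
      have "(\<Sum>x\<in>P. f x) = (\<Sum>x\<in>{x \<in> P. x 2 = -1} \<union> {x \<in> P. x 2 = 1}. f x)"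
        using that by (intro sum.mono_neutral_right) (auto simp: P_def)
      thus ?thesis by (subst (asm) sum.union_disjoint) (auto simp: P_def)
    qed
    have "(\<Sum>x | x \<in> P \<and> x 1 = - x 2. r x) = (\<Sum>x\<in>P. r x * (if x 1 = - x 2 then 1 else 0))"
      by (simp add: P_def sum.If_cases Int_def if_distrib cong: if_cong)
    also have "\<dots> = (\<Sum>x | x \<in> P \<and> x 2 = -1. r x * (if x 1 = - x 2 then 1 else 0)) +
        (\<Sum>x | x \<in> P \<and> x 2 = 1. r x * (if x 1 = - x 2 then 1 else 0))"
      using z by (intro sp) auto
    also have "\<dots> = (\<Sum>x | x \<in> P \<and> x 2 = -1. r x * (if x 1 = - (-1) then 1 else 0)) +
        (\<Sum>x | x \<in> P \<and> x 2 = 1. r x * (if x 1 = - 1 then 1 else 0))"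
      by (intro arg_cong2[where f = "(+)"] sum.cong) auto
    also have "\<dots> = 1 / 2 * (\<Sum>x | x \<in> P \<and> x 2 = -1. r x) + 1 / 2 * (\<Sum>x | x \<in> P \<and> x 2 = 1. r x)"
      using a[of "-1"] a[of 1] by simp
    also have "\<dots> = 1 / 2 * (\<Sum>x\<in>P. r x)" using sp[of r] z by simp
    finally show ?thesis by (simp add: Z_def partition_sum_def P_def r_def)
  qed
  have "3 / 4 * Z = (\<Sum>x\<in>P. r x / 2 + (if x 1 = - x 2 then r x / 2 else 0))"
  proof -
    have "(\<Sum>x\<in>P. if x 1 = - x 2 then r x / 2 else 0) = (\<Sum>x | x \<in> P \<and> x 1 = - x 2. r x) / 2"
      by (simp add: P_def sum.If_cases Int_def sum_divide_distrib)
    moreover have "(\<Sum>x\<in>P. r x / 2) = Z / 2"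
      by (simp add: Z_def partition_sum_def P_def r_def sum_divide_distrib)
    ultimately show ?thesis unfolding sum.distrib half by simp
  qed
  also have "\<dots> \<le> (\<Sum>x\<in>P. black_weight (1/2) 0 \<eta> n x)" by (intro sum_mono bw)
  finally show ?thesis
    using Z n by (simp add: cond_black_eq P_def Z_def[symmetric] le_divide_eq)
qed

lemma bad_config_all_black:
  assumes \<eta>: "\<And>k. 1 \<le> k \<Longrightarrow> \<eta> k = Black"
  shows "bad_config (1/2) 0 \<eta>"
  unfolding bad_config_def
\<comment> \<open>The gap between 3/4 and the limit 1/2 is 1/4, of which the extension may use up
  1/8.\<close>
proof (intro exI[of _ "1 / 8"] conjI allI impI)
  fix m :: nat assume m: "1 \<le> m"
  obtain c where c: "split_coloring c" "c 0 = \<eta> m" using ex_split_coloring by blast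
  define C where "C = zigzag_const (1/2) m"
  have "(\<lambda>L. 8 * C * ((1 / 4) ^ L + (1 / 2) ^ L)) \<longlonglongrightarrow> 8 * C * (0 + 0)"
    by (intro tendsto_intros LIMSEQ_power_zero) auto
  hence "\<forall>\<^sub>F L in sequentially. 8 * C * ((1 / 4) ^ L + (1 / 2) ^ L) < 1 / 8"
    by (intro order_tendstoD) auto
  then obtain L where L: "2 * m \<le> L" and err: "8 * C * ((1 / 4) ^ L + (1 / 2) ^ L) < 1 / 8"
    unfolding eventually_sequentially by (metis le_cases)
  have mL: "m \<le> L" using L by simp
  obtain \<zeta> where \<zeta>: "\<zeta> \<in> configs" "\<And>k. 1 \<le> k \<Longrightarrow> k \<le> m \<Longrightarrow> \<zeta> k = \<eta> k" "zigzag_record m L c \<zeta>"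
    using ex_zigzag_record[of m L c \<eta>, OF m mL c(2)] by blast
  have "\<bar>cond_black (1/2) 0 \<zeta> (3 * L + 1) - 1 / 2\<bar> < 1 / 8"
    using cond_black_zigzag_half[OF m L \<zeta>(3) c(1)] err by (simp add: C_def)
  moreover have "3 / 4 \<le> cond_black (1/2) 0 \<eta> (3 * L + 1)"
    using m L by (intro cond_black_all_black \<eta>) auto
  ultimately have "1 / 8 \<le> \<bar>cond_black (1/2) 0 \<eta> (3 * L + 1) - cond_black (1/2) 0 \<zeta> (3 * L + 1)\<bar>"
    by linarith
  moreover have "m < 3 * L + 1" using mL by simp
  ultimately show "\<exists>n>m. \<exists>\<zeta>\<in>configs. (\<forall>k\<in>{0<..<m}. \<zeta> k = \<eta> k) \<and>
      1 / 8 \<le> \<bar>cond_black (1/2) 0 \<eta> n - cond_black (1/2) 0 \<zeta> n\<bar>"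
    using \<zeta>(1,2) by (intro exI[of _ "3 * L + 1"] conjI bexI[of _ \<zeta>]) auto
qed simp

section \<open>A good configuration of the symmetric walk\<close>

text \<open>The exponent 0 is excluded: a turn at time 1 would compare the colours at times 0 and 2,
  and a configuration starts at time 1.\<close>

definition turning_time :: "nat \<Rightarrow> bool" where
  "turning_time t \<longleftrightarrow> (\<exists>j\<ge>1. t = 2 ^ j)"

fun other_color :: "color \<Rightarrow> color" where
  "other_color Black = White"
| "other_color White = Black"

lemma other_color_neq [simp]: "other_color a \<noteq> a" "a \<noteq> other_color a"
  by (cases a; simp)+

text \<open>A turn at time \<open>k\<close> requires equal colours at \<open>k - 1\<close> and
  \<open>k + 1\<close>, which here holds exactly at the turning times. The value at 0 starts the
  recursion along the even times.\<close>

fun dyadic_record :: "nat \<Rightarrow> color" where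
  "dyadic_record 0 = Black"
| "dyadic_record (Suc 0) = Black"
| "dyadic_record (Suc (Suc t)) =
     (if turning_time (Suc t) then dyadic_record t else other_color (dyadic_record t))"

lemma not_turning_between:
  assumes "(2 :: nat) ^ j < t" "t < 2 ^ Suc j"
  shows "\<not> turning_time t"
proof
  assume "turning_time t"
  then obtain i where "t = 2 ^ i" by (auto simp: turning_time_def)
  hence "(2 :: nat) ^ j < 2 ^ i" "(2 :: nat) ^ i < 2 ^ Suc j" using assms by auto
  hence "j < i" "i < Suc j" by (simp_all only: power_strict_increasing_iff power_less_imp_less_exp one_less_numeral_iff Num.num.simps semiring_norm)
  thus False by simp
qed

text \<open>\<open>fold_offset f k\<close> is the distance from the fold at time \<open>f\<close> of a walk that reads the record
  backwards from \<open>f\<close>, turns there and at every earlier turning time.\<close>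

definition fold_sign :: "nat \<Rightarrow> nat \<Rightarrow> int" where
  "fold_sign f k = (-1) ^ card {t \<in> {k..f}. turning_time t}"

definition fold_offset :: "nat \<Rightarrow> nat \<Rightarrow> int" where
  "fold_offset f k = - (\<Sum>i\<in>{k<..f}. fold_sign f i)"

lemma fold_sign_cases: "fold_sign f k = 1 \<or> fold_sign f k = -1"
  unfolding fold_sign_def using minus_one_power_iff by metis

lemma fold_sign_step:
  assumes "k \<le> f"
  shows "fold_sign f k = (if turning_time k then - fold_sign f (Suc k) else fold_sign f (Suc k))"
proof -
  have "{t \<in> {k..f}. turning_time t} =
      (if turning_time k then insert k {t \<in> {Suc k..f}. turning_time t} else {t \<in> {Suc k..f}. turning_time t})"
    using assms by (auto simp: Suc_le_eq order.order_iff_strict)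
  thus ?thesis by (simp add: fold_sign_def)
qed

lemma fold_offset_step: "k < f \<Longrightarrow> fold_offset f k = fold_offset f (Suc k) - fold_sign f (Suc k)"
proof -
  assume "k < f"
  hence "{k<..f} = insert (Suc k) {Suc k<..f}" by auto
  thus ?thesis by (simp add: fold_offset_def)
qed

lemma fold_offset_self [simp]: "fold_offset f f = 0"
  by (simp add: fold_offset_def)

lemma fold_offset_lipschitz:
  assumes "k \<le> l" "l \<le> f"
  shows "\<bar>fold_offset f k - fold_offset f l\<bar> \<le> int (l - k)"
  using assms(1)
proof (induction k rule: inc_induct)
  case (step k)
  have "\<bar>fold_offset f k - fold_offset f (Suc k)\<bar> \<le> 1"
    using fold_offset_step[of k f] fold_sign_cases[of f "Suc k"] step assms(2) by auto
  thus ?case using step by (auto simp: of_nat_diff)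
qed simp

text \<open>There is no turning time strictly between \<open>h\<close> and \<open>f = 2 * h\<close>,
  so backwards from \<open>f\<close> the offset grows to \<open>h\<close>. The remaining steps down
  to time \<open>k \<ge> 1\<close> take away at most \<open>h - 1\<close>.\<close>

lemma fold_offset_bounds:
  assumes j: "1 \<le> j" and k: "k < 2 ^ j" "1 \<le> k"
  shows "1 \<le> fold_offset (2 ^ j) k" "fold_offset (2 ^ j) k \<le> int (2 ^ j - k)"
proof -
  define f h where "f = (2 :: nat) ^ j" and "h = (2 :: nat) ^ (j - 1)"
  have fh: "f = 2 * h" "1 \<le> h" using j by (cases j; simp add: f_def h_def)+
  have tf: "turning_time f" using j by (auto simp: turning_time_def f_def)
  have sgn: "fold_sign f i = -1" if "h < i" "i \<le> f" for i
  proof -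
    have "\<not> turning_time t" if "h < t" "t < f" for t
      using not_turning_between[of "j - 1" t] that j by (simp add: f_def h_def)
    hence "{t \<in> {i..f}. turning_time t} = {f}" using that tf by (auto simp: order.order_iff_strict)
    thus ?thesis by (simp add: fold_sign_def)
  qed
  have top: "fold_offset f i = int (f - i)" if "h \<le> i" "i \<le> f" for i
  proof -
    have "(\<Sum>i\<in>{i<..f}. fold_sign f i) = (\<Sum>i\<in>{i<..f}. - 1)" using that by (intro sum.cong sgn) auto
    thus ?thesis by (simp add: fold_offset_def)
  qed
  show "fold_offset (2 ^ j) k \<le> int (2 ^ j - k)"
    using fold_offset_lipschitz[of k f f] k by (simp add: f_def)
  show "1 \<le> fold_offset (2 ^ j) k"
  proof (cases "h \<le> k")
    case True
    thus ?thesis using top[of k] k unfolding f_def[symmetric] by (simp add: of_nat_diff)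
  next
    case False
    hence "\<bar>fold_offset f k - fold_offset f h\<bar> \<le> int (h - k)"
      using fh by (intro fold_offset_lipschitz) auto
    thus ?thesis using top[of h] fh k False by (simp add: f_def[symmetric] of_nat_diff)
  qed
qed

lemma dyadic_record_step2:
  assumes "1 \<le> k"
  shows "dyadic_record (Suc k) = (if turning_time k then dyadic_record (k - 1) else other_color (dyadic_record (k - 1)))"
  using assms by (cases k) auto

text \<open>The past of the fold reads the same colours as its future. The induction goes backwards
  two steps at a time: at a turning time the offset returns to its previous value, elsewhere it
  moves by two and the colour changes on both sides.\<close>

lemma dyadic_record_fold:
  assumes j: "1 \<le> j" and k: "1 \<le> k" "k \<le> 2 ^ j"
  shows "dyadic_record (nat (int (2 ^ j) + fold_offset (2 ^ j) k)) = dyadic_record k"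
  using k
proof (induction "2 ^ j - k" arbitrary: k rule: less_induct)
  case less
  define f where "f = (2 :: nat) ^ j"
  define g where "g = fold_offset f"
  have f2: "2 \<le> f" using j by (cases j) (auto simp: f_def)
  have tf: "turning_time f" using j by (auto simp: turning_time_def f_def)
  consider "k = f" | "k = f - 1" "k < f" | "Suc (Suc k) \<le> f" using less.prems f2 by (fastforce simp: f_def)
  thus ?case
  proof cases
    case 1
    show ?thesis unfolding f_def[symmetric] 1 by simp
  next
    case 2
    have "fold_sign f f = -1"
    proof -
      have "{t \<in> {f..f}. turning_time t} = {f}" using tf by auto
      thus ?thesis by (simp add: fold_sign_def)
    qed
    hence "g k = 1" using fold_offset_step[of k f] 2 by (simp add: g_def)
    moreover have "dyadic_record (Suc f) = dyadic_record (f - 1)"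
      using dyadic_record_step2[of f] tf f2 by simp
    ultimately show ?thesis using 2 by (simp add: g_def f_def[symmetric] nat_add_distrib)
  next
    case 3
    have IH: "dyadic_record (nat (int f + g (Suc (Suc k)))) = dyadic_record (Suc (Suc k))"
      using less.hyps[of "Suc (Suc k)"] less.prems 3 by (simp add: f_def g_def)
    have g1: "g k = g (Suc k) - fold_sign f (Suc k)" "g (Suc k) = g (Suc (Suc k)) - fold_sign f (Suc (Suc k))"
      using fold_offset_step[of k f] fold_offset_step[of "Suc k" f] 3 by (simp_all add: g_def)
    show ?thesis
    proof (cases "turning_time (Suc k)")
      case True
      hence "g k = g (Suc (Suc k))" using g1 fold_sign_step[of "Suc k" f] 3 by simp
      thus ?thesis using IH True by (simp add: f_def g_def)
    next
      case False
      define s where "s = fold_sign f (Suc k)"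
      have gs: "g k = g (Suc k) - s" "g (Suc (Suc k)) = g (Suc k) + s"
        using g1 fold_sign_step[of "Suc k" f] 3 False by (simp_all add: s_def)
      define u where "u = nat (int f + g (Suc k))"
      have b: "1 \<le> g (Suc k)" "g (Suc k) \<le> int (f - Suc k)"
        using fold_offset_bounds[OF j, of "Suc k"] 3 by (simp_all add: g_def f_def)
      hence iu: "int u = int f + g (Suc k)" by (simp add: u_def)
      \<comment> \<open>The mirrored time \<open>u\<close> lies strictly between the consecutive
        turning times \<open>f\<close> and \<open>2 * f\<close>, so the record changes across
        it.\<close>
      have "f < u" "u < 2 * f" using iu b 3 by linarith+
      hence nt: "\<not> turning_time u" using not_turning_between[of j u] by (simp add: f_def)
      have "1 \<le> u" using iu b by linarith
      hence ne: "dyadic_record (Suc u) = other_color (dyadic_record (u - 1))"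
        using dyadic_record_step2[of u] nt by simp
      have e: "dyadic_record (Suc (Suc k)) = other_color (dyadic_record k)" using False by simp
      have oo: "other_color (other_color a) = a" for a by (cases a) auto
      from fold_sign_cases[of f "Suc k"] show ?thesis
      proof
        assume "fold_sign f (Suc k) = 1"
        hence "int f + g k = int u - 1" "int f + g (Suc (Suc k)) = int u + 1"
          using gs iu by (simp_all add: s_def)
        hence "nat (int f + g k) = u - 1" "nat (int f + g (Suc (Suc k))) = Suc u" by linarith+
        thus ?thesis using IH ne e by (metis f_def g_def oo)
      next
        assume "fold_sign f (Suc k) = -1"
        hence "int f + g k = int u + 1" "int f + g (Suc (Suc k)) = int u - 1"
          using gs iu by (simp_all add: s_def)
        hence "nat (int f + g k) = Suc u" "nat (int f + g (Suc (Suc k))) = u - 1" by linarith+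
        thus ?thesis using IH ne e by (metis f_def g_def oo)
      qed
    qed
  qed
qed

section \<open>Folding paths at the turning times\<close>

definition fold_path :: "nat \<Rightarrow> (nat \<Rightarrow> int) \<Rightarrow> nat \<Rightarrow> int" where
  "fold_path f x k = (if k \<in> {2..f} then fold_sign f k * x k else x k)"

definition unfolded :: "nat \<Rightarrow> (nat \<Rightarrow> int) \<Rightarrow> bool" where
  "unfolded K x \<longleftrightarrow> (\<forall>j\<in>{1..K}. x (Suc (2 ^ j)) = x (2 ^ j))"

lemma fold_path_paths: "x \<in> paths {1..<n} \<Longrightarrow> f < n \<Longrightarrow> fold_path f x \<in> paths {1..<n}"
proof -
  assume x: "x \<in> paths {1..<n}" and f: "f < n"
  show ?thesis
    unfolding paths_def
  proof (rule PiE_I)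
    fix k assume "k \<in> {1..<n}"
    from paths_mem[OF x this] show "fold_path f x k \<in> {-1, 0, 1}"
      using fold_sign_cases[of f k] by (auto simp: fold_path_def)
  next
    fix k assume "k \<notin> {1..<n}"
    thus "fold_path f x k = undefined"
      using x f by (auto simp: fold_path_def paths_def PiE_iff extensional_def)
  qed
qed

lemma run_constant:
  assumes "\<And>k. a < k \<Longrightarrow> k < b \<Longrightarrow> x (Suc k) = x k" "k \<in> {a<..b}"
  shows "x k = x (Suc a)"
proof -
  have "Suc a \<le> k" using assms by simp
  thus ?thesis using assms(2)
  proof (induction k rule: dec_induct)
    case (step k)
    thus ?case using assms(1)[of k] by simp
  qed simp
qed

lemma walk_run:
  assumes "\<And>k. k \<in> {a<..b} \<Longrightarrow> x k = d" "a \<le> b"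
  shows "walk x b = walk x a + d * int (b - a)"
proof -
  have "(\<Sum>k\<in>{a<..b}. x k) = (\<Sum>k\<in>{a<..b}. d)" by (intro sum.cong assms) auto
  thus ?thesis using walk_split[OF assms(2), of x] by (simp add: mult.commute)
qed

context
  fixes K n :: nat and \<zeta> :: "nat \<Rightarrow> color"
  assumes n: "2 ^ Suc K < n" and agree: "\<And>k. 1 \<le> k \<Longrightarrow> k \<le> 2 ^ Suc K \<Longrightarrow> \<zeta> k = dyadic_record k"
begin

abbreviation "rw \<equiv> record_weight (1/2) 0 \<zeta> n"

lemma dyadic_straight:
  assumes x: "x \<in> paths {1..<n}" "rw x \<noteq> 0" and k: "2 \<le> k" "k < 2 ^ Suc K" "\<not> turning_time k"
  shows "x (Suc k) = x k"
proof (rule consistent_straight)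
  have h: "(1 / 2 :: real) \<in> {0..1}" by simp
  show "consistent {1..<n} (walk x) \<zeta>" by (rule record_weight_nonzeroD(1)[OF x h])
  show "x k = 1 \<or> x k = -1" "x (Suc k) = 1 \<or> x (Suc k) = -1"
    using record_weight_nonzeroD(2)[OF x h, of k] record_weight_nonzeroD(2)[OF x h, of "Suc k"] n k by auto
  have "dyadic_record (Suc k) \<noteq> dyadic_record (k - 1)"
    using dyadic_record_step2[of k] k by simp
  thus "\<zeta> (Suc k) \<noteq> \<zeta> (k - 1)" using agree[of "Suc k"] agree[of "k - 1"] k by simp
qed (use n k in auto)

text \<open>Between turning times the record forbids turns, and at the turning times up to
  \<open>2 ^ J\<close> the path makes none.\<close>

lemma unfolded_run:
  assumes x: "x \<in> paths {1..<n}" "rw x \<noteq> 0" and u: "unfolded J x" and J: "J \<le> K" and k: "k \<in> {1<..2 ^ Suc J}"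
  shows "x k = x 2"
proof -
  have "x k = x (Suc 1)"
  proof (rule run_constant[OF _ k])
    fix i :: nat assume i: "1 < i" "i < 2 ^ Suc J"
    have "(2 :: nat) ^ Suc J \<le> 2 ^ Suc K" using J by (intro power_increasing) auto
    from less_le_trans[OF i(2) this] have iK: "i < 2 ^ Suc K" .
    show "x (Suc i) = x i"
    proof (cases "turning_time i")
      case True
      then obtain j where j: "1 \<le> j" "i = 2 ^ j" by (auto simp: turning_time_def)
      hence "j < Suc J" using i by (simp only: power_strict_increasing_iff)
      thus ?thesis using u j by (auto simp: unfolded_def)
    next
      case False
      thus ?thesis using dyadic_straight[OF x _ iK] i by simp
    qed
  qed
  thus ?thesis by (simp add: numeral_2_eq_2)
qed

text \<open>At the first fold the walk runs back past \<open>S 1\<close> and sees both of its neighbours.\<close>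

lemma folded_neighbours:
  assumes x: "x \<in> paths {1..<n}" "rw x \<noteq> 0" and nu: "\<not> unfolded K x"
  shows "\<exists>a b. a \<noteq> b \<and> colored_at \<zeta> n x (walk x 1 - 1) a \<and> colored_at \<zeta> n x (walk x 1 + 1) b"
proof -
  have h: "(1 / 2 :: real) \<in> {0..1}" by simp
  define J where "J = (LEAST j. 1 \<le> j \<and> j \<le> K \<and> x (Suc (2 ^ j)) \<noteq> x (2 ^ j))"
  have ex: "\<exists>j. 1 \<le> j \<and> j \<le> K \<and> x (Suc (2 ^ j)) \<noteq> x (2 ^ j)" using nu by (auto simp: unfolded_def)
  have J: "1 \<le> J" "J \<le> K" "x (Suc (2 ^ J)) \<noteq> x (2 ^ J)"
    using LeastI_ex[OF ex] by (auto simp: J_def)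
  have uJ: "unfolded (J - 1) x"
    unfolding unfolded_def
  proof
    fix j assume j: "j \<in> {1..J - 1}"
    hence "j < J" by auto
    from not_less_Least[OF this[unfolded J_def]] show "x (Suc (2 ^ j)) = x (2 ^ j)"
      using j J by auto
  qed
  define f where "f = (2 :: nat) ^ J"
  have f: "2 \<le> f" "2 ^ Suc J = 2 * f" using J by (cases J; simp add: f_def)+
  have fK: "2 * f < n" "2 * f \<le> 2 ^ Suc K"
  proof -
    show "2 * f \<le> 2 ^ Suc K" using J by (simp add: f_def)
    thus "2 * f < n" using n by simp
  qed
  have st: "x k = 1 \<or> x k = -1" if "k \<in> {1..<n}" for k
    using record_weight_nonzeroD(2)[OF x h that] .
  define d where "d = x 2"
  have d: "d = 1 \<or> d = -1" using st[of 2] f fK by (auto simp: d_def)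
  have up: "x k = d" if "k \<in> {1<..f}" for k
    using unfolded_run[OF x uJ, of k] J that by (simp add: d_def f_def)
  have down: "x k = - d" if "k \<in> {f<..2 * f}" for k
  proof -
    have "x k = x (Suc f)"
    proof (rule run_constant[OF _ that])
      fix i assume i: "f < i" "i < 2 * f"
      have "\<not> turning_time i" using not_turning_between[of J i] i by (simp add: f_def)
      thus "x (Suc i) = x i" using i f fK by (intro dyadic_straight[OF x]) auto
    qed
    also have "x (Suc f) = - d"
      using J(3) up[of f] d st[of "Suc f"] f fK by (auto simp: f_def)
    finally show ?thesis .
  qed
  have top: "walk x f = walk x 1 + d * (int f - 1)"
    using walk_run[of 1 f x d, OF up] f by (simp add: of_nat_diff)
  have w: "walk x k = walk x 1 + d * (2 * int f - 1 - int k)" if "f \<le> k" "k \<le> 2 * f" for k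
  proof -
    have "walk x k = walk x f + (- d) * int (k - f)"
      using that by (intro walk_run down) auto
    thus ?thesis using top that by (simp add: of_nat_diff algebra_simps)
  qed
  \<comment> \<open>After the fold at time \<open>f\<close> the walk is back at \<open>S 1\<close>
    at time \<open>2 * f - 1\<close>, so the times just before and after show its two
    neighbours.\<close>
  define p r where "p = 2 * f - 2" and "r = 2 * f"
  have at: "walk x p = walk x 1 + d" "walk x r = walk x 1 - d"
    using w[of p] w[of r] f by (simp_all add: p_def r_def of_nat_diff algebra_simps)
  have "dyadic_record r \<noteq> dyadic_record p"
  proof -
    have "\<not> turning_time (2 * f - 1)"
      using not_turning_between[of J "2 * f - 1"] f by (simp add: f_def)
    thus ?thesis using dyadic_record_step2[of "2 * f - 1"] f by (simp add: p_def r_def numeral_2_eq_2)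
  qed
  hence ne: "\<zeta> r \<noteq> \<zeta> p" using agree[of r] agree[of p] f fK by (simp add: p_def r_def)
  have mem: "p \<in> {1..<n}" "r \<in> {1..<n}" using f fK by (auto simp: p_def r_def)
  have col: "colored_at \<zeta> n x (walk x 1 + d) (\<zeta> p)" "colored_at \<zeta> n x (walk x 1 - d) (\<zeta> r)"
    using mem at by (auto simp: colored_at_def)
  from d show ?thesis
  proof
    assume "d = 1"
    thus ?thesis using col ne by auto
  next
    assume "d = -1"
    hence "colored_at \<zeta> n x (walk x 1 - 1) (\<zeta> p)" "colored_at \<zeta> n x (walk x 1 + 1) (\<zeta> r)"
      using col by simp_all
    thus ?thesis using ne by metis
  qed
qed

text \<open>Up to a translation, the folded walk visits only sites of the original walk.\<close>

lemma fold_path_weight: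
  assumes x: "x \<in> paths {1..<n}" "rw x \<noteq> 0" and u: "unfolded K x" and J: "J \<le> K"
  shows "rw x \<le> rw (fold_path (2 ^ J) x)"
proof (cases "J = 0")
  case True
  \<comment> \<open>Folding at time 1 changes no step; this is why \<open>K\<close> turning times
    yield \<open>K + 1\<close> images.\<close>
  hence "fold_path (2 ^ J) x = x" by (auto simp: fold_path_def fun_eq_iff)
  thus ?thesis by simp
next
  case False
  hence J1: "1 \<le> J" by simp
  have h: "(1 / 2 :: real) \<in> {0..1}" by simp
  define f where "f = (2 :: nat) ^ J"
  define y where "y = fold_path f x"
  have fK: "2 * f \<le> 2 ^ Suc K" using J by (simp add: f_def)
  hence fn: "2 * f < n" using n by simp
  have f2: "2 \<le> f" using J1 by (cases J) (auto simp: f_def)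
  note con = record_weight_nonzeroD(1)[OF x h]
  have st: "x k = 1 \<or> x k = -1" if "k \<in> {1..<n}" for k
    using record_weight_nonzeroD(2)[OF x h that] .
  define d where "d = x 2"
  have d: "d = 1 \<or> d = -1" using st[of 2] f2 fn by (auto simp: d_def)
  have run: "x k = d" if "k \<in> {1<..2 * f}" for k
    using unfolded_run[OF x u, of k] that fK by (auto simp: d_def)
  have "step_weight (1/2) 0 {1..<n} y = step_weight (1/2) 0 {1..<n} x"
    unfolding step_weight_def
  proof (rule prod.cong)
    fix k assume k: "k \<in> {1..<n}"
    show "pmf (step_pmf (1/2) 0) (y k) = pmf (step_pmf (1/2) 0) (x k)"
      using st[OF k] fold_sign_cases[of f k] pmf_step_0[OF h] by (auto simp: y_def fold_path_def)
  qed simp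
  define D where "D = walk x f - walk y f"
  \<comment> \<open>A time at which \<open>x\<close> visits the site that \<open>y\<close>,
    translated by \<open>D\<close>, visits at time \<open>k\<close>. It exists because
    \<open>x\<close> runs straight up to time \<open>2 * f\<close>.\<close>
  define \<tau> where "\<tau> = (\<lambda>k. if k \<le> f then nat (int f + fold_offset f k) else k)"
  have off: "0 \<le> fold_offset f k" "fold_offset f k \<le> int f" if "k \<in> {1..f}" for k
    using fold_offset_bounds[OF J1, of k] that by (cases "k = f"; auto simp: f_def)+
  have \<tau>: "\<tau> k \<in> {1..<n}" if "k \<in> {1..<n}" for k
    using that off[of k] f2 fn by (auto simp: \<tau>_def nat_less_iff Suc_le_eq)
  have wy: "walk y k + D = walk x (\<tau> k)" if k: "k \<in> {1..<n}" for k
  proof (cases "k \<le> f")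
    case True
    have kf: "k \<in> {1..f}" using True k by simp
    have "(\<Sum>i\<in>{k<..f}. y i) = (\<Sum>i\<in>{k<..f}. d * fold_sign f i)"
    proof (rule sum.cong)
      fix i assume i: "i \<in> {k<..f}"
      hence "x i = d" using k by (intro run) auto
      thus "y i = d * fold_sign f i" using i k by (simp add: y_def fold_path_def)
    qed simp
    hence "walk y f = walk y k - d * fold_offset f k"
      using walk_split[OF True, of y] by (simp add: fold_offset_def flip: sum_distrib_left)
    moreover have "walk x (\<tau> k) = walk x f + d * int (\<tau> k - f)"
      using True off[OF kf] f2 by (intro walk_run run) (auto simp: \<tau>_def nat_le_iff)
    moreover have "int (\<tau> k - f) = fold_offset f k"
      using True off[OF kf] by (simp add: \<tau>_def nat_add_distrib)
    ultimately show ?thesis by (simp add: D_def)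
  next
    case False
    have "(\<Sum>i\<in>{f<..k}. y i) = (\<Sum>i\<in>{f<..k}. x i)"
      by (intro sum.cong) (auto simp: y_def fold_path_def)
    thus ?thesis
      using False walk_split[of f k x] walk_split[of f k y] by (simp add: \<tau>_def D_def)
  qed
  have col: "\<zeta> k = \<zeta> (\<tau> k)" if k: "k \<in> {1..<n}" for k
  proof (cases "k \<le> f")
    case True
    have kf: "k \<in> {1..f}" using True k by simp
    have t: "\<tau> k = nat (int (2 ^ J) + fold_offset (2 ^ J) k)" using True by (simp add: \<tau>_def f_def)
    have "dyadic_record (\<tau> k) = dyadic_record k"
      unfolding t using k True by (intro dyadic_record_fold[OF J1]) (auto simp: f_def)
    moreover have "int (\<tau> k) = int f + fold_offset f k" using True off[OF kf] by (simp add: \<tau>_def)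
    hence "1 \<le> \<tau> k" "\<tau> k \<le> 2 ^ Suc K" using off[OF kf] f2 fK by linarith+
    moreover have "k \<le> 2 ^ Suc K" using True fK f2 by linarith
    ultimately show ?thesis using agree[of k] agree[of "\<tau> k"] k by simp
  qed (simp add: \<tau>_def)
  have "consistent {1..<n} (walk y) \<zeta>"
    unfolding consistent_def
  proof (intro ballI impI)
    fix i j assume ij: "i \<in> {1..<n}" "j \<in> {1..<n}" "walk y i = walk y j"
    have "walk x (\<tau> i) = walk x (\<tau> j)" using wy[OF ij(1)] wy[OF ij(2)] ij(3) by simp
    from consistentD[OF con \<tau>[OF ij(1)] \<tau>[OF ij(2)] this]
    show "\<zeta> i = \<zeta> j" using col[OF ij(1)] col[OF ij(2)] by simp
  qed
  moreover have "card (walk y ` {1..<n}) \<le> card (walk x ` {1..<n})"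
  proof -
    have "walk y ` {1..<n} \<subseteq> (\<lambda>z. z - D) ` walk x ` {1..<n}"
    proof (rule image_subsetI)
      fix k assume k: "k \<in> {1..<n}"
      have "walk y k = walk x (\<tau> k) - D" using wy[OF k] by simp
      thus "walk y k \<in> (\<lambda>z. z - D) ` walk x ` {1..<n}" using \<tau>[OF k] by blast
    qed
    hence "card (walk y ` {1..<n}) \<le> card ((\<lambda>z. z - D) ` walk x ` {1..<n})"
      by (intro card_mono) auto
    also have "\<dots> \<le> card (walk x ` {1..<n})" by (rule card_image_le) simp
    finally show ?thesis .
  qed
  ultimately have "site_weight {1..<n} (walk x) \<zeta> \<le> site_weight {1..<n} (walk y) \<zeta>"
    using con by (simp add: site_weight_def power_decreasing)
  thus ?thesis
    using \<open>step_weight (1/2) 0 {1..<n} y = step_weight (1/2) 0 {1..<n} x\<close>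
    by (simp add: record_weight_def mult_left_mono flip: y_def f_def)
qed

text \<open>Beyond the fold the path is still unfolded, so the last power of two, up to
  \<open>2 ^ K\<close>, at which the image turns is the fold time; no such turn means
  \<open>i = 0\<close>. Once the fold time is known, the sign changes can be undone.\<close>

lemma fold_path_inj:
  assumes x: "x \<in> paths {1..<n}" "rw x \<noteq> 0" "unfolded K x" "i \<le> K"
    and y: "y \<in> paths {1..<n}" "rw y \<noteq> 0" "unfolded K y" "j \<le> K"
    and eq: "fold_path (2 ^ i) x = fold_path (2 ^ j) y"
  shows "i = j \<and> x = y"
proof -
  have h: "(1 / 2 :: real) \<in> {0..1}" by simp
  have turn: "fold_path (2 ^ i) x (Suc (2 ^ l)) \<noteq> fold_path (2 ^ i) x (2 ^ l) \<longleftrightarrow> l = i"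
    if x: "x \<in> paths {1..<n}" "rw x \<noteq> 0" "unfolded K x" and l: "1 \<le> l" "i \<le> l" "l \<le> K" for x i l
  proof -
    have ul: "x (Suc (2 ^ l)) = x (2 ^ l)" using x(3) l by (simp add: unfolded_def)
    show ?thesis
    proof (cases "l = i")
      case True
      have tl: "turning_time (2 ^ l)" using l(1) by (auto simp: turning_time_def)
      have "{t \<in> {2 ^ l..2 ^ l}. turning_time t} = {2 ^ l}" using tl by auto
      hence s: "fold_sign (2 ^ l) (2 ^ l) = -1" by (simp add: fold_sign_def)
      have "(2 :: nat) ^ l \<le> 2 ^ Suc K" using l by (intro power_increasing) auto
      hence "2 ^ l \<in> {1..<n}" using n by simp
      hence "x (2 ^ l) \<noteq> 0" using record_weight_nonzeroD(2)[OF x(1,2) h, of "2 ^ l"] by auto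
      moreover have "2 \<le> (2 :: nat) ^ l" using l(1) by (cases l) auto
      ultimately show ?thesis using True ul s by (simp add: fold_path_def)
    next
      case False
      hence "(2 :: nat) ^ i < 2 ^ l" using l by (intro power_strict_increasing) auto
      moreover have "fold_path (2 ^ i) x k = x k" if "2 ^ i < k" for k
        using that by (simp add: fold_path_def)
      ultimately have "fold_path (2 ^ i) x (2 ^ l) = x (2 ^ l)" "fold_path (2 ^ i) x (Suc (2 ^ l)) = x (Suc (2 ^ l))"
        by (simp_all only: less_SucI)
      thus ?thesis using ul False by simp
    qed
  qed
  have ij: "i = j"
  proof (rule ccontr)
    assume "i \<noteq> j"
    moreover have False if "i < j"
      using turn[OF x(1-3), of j i] turn[OF y(1-3), of j j] that y(4) eq by simp
    moreover have False if "j < i"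
      using turn[OF x(1-3), of i i] turn[OF y(1-3), of i j] that x(4) eq by simp
    ultimately show False by linarith
  qed
  have "x k = y k" for k
    using fun_cong[OF eq, of k] fold_sign_cases[of "2 ^ i" k] unfolding ij
    by (auto simp: fold_path_def split: if_splits)
  thus ?thesis using ij by auto
qed

text \<open>The \<open>K + 1\<close> foldings produce distinct paths, none lighter than the
  original, so the partition sum contains the unfolded weight \<open>K + 1\<close> times.\<close>

lemma unfolded_weight_le:
  "real (K + 1) * (\<Sum>x | x \<in> paths {1..<n} \<and> unfolded K x. rw x) \<le> partition_sum (1/2) 0 \<zeta> n"
proof -
  define S where "S = {x \<in> paths {1..<n}. unfolded K x \<and> rw x \<noteq> 0}"
  define \<Phi> where "\<Phi> = (\<lambda>(j :: nat, x). fold_path (2 ^ j) x)"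
  have finS: "finite S" by (simp add: S_def)
  have inj: "inj_on \<Phi> ({..K} \<times> S)"
    using fold_path_inj by (auto simp: inj_on_def \<Phi>_def S_def)
  have sub: "\<Phi> ` ({..K} \<times> S) \<subseteq> paths {1..<n}"
  proof
    fix y assume "y \<in> \<Phi> ` ({..K} \<times> S)"
    then obtain j x where jx: "j \<le> K" "x \<in> S" "y = fold_path (2 ^ j) x" by (auto simp: \<Phi>_def)
    have "(2 :: nat) ^ j \<le> 2 ^ Suc K" using jx by (intro power_increasing) auto
    hence "2 ^ j < n" using n by linarith
    moreover have "x \<in> paths {1..<n}" using jx by (simp add: S_def)
    ultimately show "y \<in> paths {1..<n}" unfolding jx(3) by (intro fold_path_paths)
  qed
  have "(\<Sum>x | x \<in> paths {1..<n} \<and> unfolded K x. rw x) = sum rw S"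
    by (rule sum.mono_neutral_right) (auto simp: S_def)
  hence "real (K + 1) * (\<Sum>x | x \<in> paths {1..<n} \<and> unfolded K x. rw x) = (\<Sum>j\<in>{..K}. sum rw S)"
    by simp
  also have "\<dots> \<le> (\<Sum>j\<in>{..K}. \<Sum>x\<in>S. rw (\<Phi> (j, x)))"
    by (intro sum_mono) (auto simp: \<Phi>_def S_def intro!: fold_path_weight)
  also have "\<dots> = sum rw (\<Phi> ` ({..K} \<times> S))"
    by (simp add: sum.cartesian_product sum.reindex[OF inj] o_def case_prod_unfold)
  also have "\<dots> \<le> sum rw (paths {1..<n})"
    by (rule sum_mono2[OF _ sub]) auto
  finally show ?thesis by (simp add: partition_sum_def)
qed

text \<open>Paths that turn by time \<open>2 ^ K\<close> contribute exactly 1/2 by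
  \<open>black_weight_half\<close>; the others have posterior probability at most
  \<open>1 / (K + 1)\<close>.\<close>

lemma cond_black_dyadic: "\<bar>cond_black (1/2) 0 \<zeta> n - 1 / 2\<bar> \<le> 1 / real (K + 1)"
proof -
  have Z: "0 < partition_sum (1/2) 0 \<zeta> n" by (rule zigzag_partition_pos) simp
  have n2: "2 \<le> n" using n one_le_power[of "2 :: nat" K] unfolding power_Suc by linarith
  have "(\<Sum>x | x \<in> paths {1..<n} \<and> \<not> unfolded K x. black_weight (1/2) 0 \<zeta> n x) =
      1 / 2 * (\<Sum>x | x \<in> paths {1..<n} \<and> \<not> unfolded K x. rw x)"
  proof (rule black_weight_half[OF n2])
    \<comment> \<open>Turning times start at 2, so changing \<open>X 1\<close> does not affect
      whether a path is unfolded.\<close>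
    have "(2 :: nat) ^ j \<noteq> 1" if "1 \<le> j" for j using that by simp
    thus "\<not> unfolded K (x(1 := s)) \<longleftrightarrow> \<not> unfolded K x" for x s
      by (auto simp: unfolded_def)
  qed (use folded_neighbours in blast)
  hence "\<bar>cond_black (1/2) 0 \<zeta> n - 1 / 2\<bar> \<le>
      (\<Sum>x | x \<in> paths {1..<n} \<and> \<not> \<not> unfolded K x. rw x) / partition_sum (1/2) 0 \<zeta> n"
    using n2 Z by (intro cond_black_approx) auto
  also have "\<dots> \<le> 1 / real (K + 1)"
    using unfolded_weight_le Z by (simp add: field_simps)
  finally show ?thesis .
qed

end

text \<open>The bound of \<open>cond_black_dyadic\<close> only asks for agreement up to time
  \<open>2 ^ Suc K\<close>, so it holds for \<open>\<eta>\<close> and for every competing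
  \<open>\<zeta>\<close> alike.\<close>

lemma not_bad_config_dyadic:
  assumes \<eta>: "\<And>k. 1 \<le> k \<Longrightarrow> \<eta> k = dyadic_record k"
  shows "\<not> bad_config (1/2) 0 \<eta>"
proof
  assume "bad_config (1/2) 0 \<eta>"
  then obtain \<delta> where \<delta>: "0 < \<delta>" "\<And>m. 1 \<le> m \<Longrightarrow> \<exists>n>m. \<exists>\<zeta>\<in>configs. (\<forall>k\<in>{0<..<m}. \<zeta> k = \<eta> k) \<and>
      \<bar>cond_black (1/2) 0 \<eta> n - cond_black (1/2) 0 \<zeta> n\<bar> \<ge> \<delta>"
    unfolding bad_config_def by blast
  obtain K :: nat where "2 / \<delta> < real K" using reals_Archimedean2 by blast
  hence K: "2 / real (K + 1) < \<delta>" using \<delta>(1) by (simp add: field_simps)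
  obtain n \<zeta> where n: "n > 2 ^ Suc K + 1" and \<zeta>: "\<forall>k\<in>{0<..<2 ^ Suc K + 1}. \<zeta> k = \<eta> k"
    "\<bar>cond_black (1/2) 0 \<eta> n - cond_black (1/2) 0 \<zeta> n\<bar> \<ge> \<delta>"
    using \<delta>(2)[of "2 ^ Suc K + 1"] by auto
  have "\<bar>cond_black (1/2) 0 \<eta> n - 1 / 2\<bar> \<le> 1 / real (K + 1)"
    "\<bar>cond_black (1/2) 0 \<zeta> n - 1 / 2\<bar> \<le> 1 / real (K + 1)"
    using n \<zeta>(1) \<eta> by (intro cond_black_dyadic; simp)+
  hence "\<bar>cond_black (1/2) 0 \<eta> n - cond_black (1/2) 0 \<zeta> n\<bar> \<le> 1 / real (K + 1) + 1 / real (K + 1)"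
    by linarith
  thus False using K \<zeta>(2) by simp
qed

theorem theorem1p3:
  shows "(\<exists>N. openin (top_of_set params) N \<and> (1, 0) \<in> N \<and>
              {p_star<..1} \<times> {0} \<subseteq> N \<and>
              (\<forall>(p, e)\<in>N. bad_set p e = {}))
       \<and> (\<forall>p\<in>{1/2<..<4/5}. bad_set p 0 = configs)
       \<and> bad_set (1/2) 0 \<notin> {{}, configs}"
proof (intro conjI ballI)
  show "\<exists>N. openin (top_of_set params) N \<and> (1, 0) \<in> N \<and> {p_star<..1} \<times> {0} \<subseteq> N \<and>
      (\<forall>(p, e)\<in>N. bad_set p e = {})"
    by (rule good_neighborhood)
  show "bad_set p 0 = configs" if "p \<in> {1/2<..<4/5}" for p
    using bad_config_all[OF that] by (auto simp: bad_set_def)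
  have "restrict (\<lambda>_. Black) {1..} \<in> bad_set (1/2) 0"
    by (auto simp: bad_set_def configs_def intro!: bad_config_all_black)
  moreover have "restrict dyadic_record {1..} \<in> configs - bad_set (1/2) 0"
    using not_bad_config_dyadic[of "restrict dyadic_record {1..}"] by (simp add: bad_set_def configs_def)
  ultimately show "bad_set (1/2) 0 \<notin> {{}, configs}" by blast
qed

end
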